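(* Let $p>1$, $q=p/(p-1)$, let $K\subset\mathbb{R}$ be a compact set, and let $\mu\in\mathcal{P}_p(\mathbb{R}^N)$ be a successively $\mathcal{W}_p$-continuous probability measure for which there is a constant $C'$ with $\int\|x_{t+1:N}\|^p\,\bar\mu_{x_{1:t}}(dx_{t+1:N})\le C'(1+\|x_{1:t}\|^p)$ for all $x_{1:t}\in\mathbb{R}^t$, $t=1,\dots,N-1$. Let $f:\mathbb{R}^N\times K^N\to\mathbb{R}$ be a lower semicontinuous function which satisfies: (1) The mapping $x\mapsto f(x,\alpha)$ is differentiable, $(x,\alpha)\mapsto\nabla_xf(x,\alpha)$ is continuous, and $\|\nabla_xf(x,\alpha)\|\le C(1+\|x\|^{p-1-\varepsilon})$ for some $\varepsilon>0$ and a constant $C>0$. (2) The mapping $\alpha\mapsto f(x,\alpha)$ is $\varepsilon(x)$-strongly convex for all $x\in\operatorname{spt}(\mu)$, where $\mu(\varepsilon(x)>0)=1$, i.e. $$f(x,\widetilde\alpha)-f(x,\alpha)\ge\langle\nabla_\alpha f(x,\alpha),\widetilde\alpha-\alpha\rangle+\tfrac12\varepsilon(x)\|\widetilde\alpha-\alpha\|^2$$ for any $x\in\mathbb{R}^N$ and $\alpha,\widetilde\alpha\in K^N$. For $\delta>0$ let $$V(\delta):=\inf_{\alpha\in\mathcal{A}}\ \sup_{\gamma\in\Pi_{\mathrm{bc},\delta}(\mu,\cdot)}\int f(y,\alpha(x,y))\,\gamma(dx,dy),$$ and let $V(0):=\inf_{\alpha}\int f(x,\alpha(x))\,\mu(dx)$,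 the infimum being over predictable controls $\alpha:\mathbb{R}^N\to K^N$; let $\mathcal{A}^*=\operatorname{argmin}(V(0))$ be the set of minimizers of the latter problem. Then the sensitivity $\Upsilon:=\lim_{\delta\to0+}\frac{V(\delta)-V(0)}{\delta}$ is given by $$\Upsilon=\inf_{\alpha\in\mathcal{A}^*}\Bigg[\Big\|\int\partial_1f(x,\alpha)\,\bar\mu_{x_1}(dx_{2:N})\Big\|_{L^q(\mu^1(dx_1))}+\sum_{t=2}^N\int\Big\|\int\partial_tf(x,\alpha)\,\bar\mu_{x_{1:t}}(dx_{t+1:N})\Big\|_{L^q(\mu_{x_{1:t-1}}(dx_t))}\,\mu(dx_{1:t-1})\Bigg],$$ where $\alpha=\alpha(x)$ and $\partial_t$ denotes the partial derivative in $x_t$.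
   Context: Fix $N\in\mathbb{N}$. For $x\in\mathbb{R}^k$ let $\|x\|=(\sum_{t=1}^k|x_t|^p)^{1/p}$ and $x_{s:t}=(x_s,\dots,x_t)$. $\mathcal{P}(\mathbb{R}^k)$ is the set of Borel probability measures, $\mathcal{P}_p(\mathbb{R}^k)$ those with finite $p$-th moment, $\operatorname{spt}(\mu)$ the support of $\mu$, and $\mathcal{W}_p$ the $p$-Wasserstein distance. For $\mu\in\mathcal{P}_p(\mathbb{R}^N)$ write the disintegration $\mu=\mu^1\otimes\mu_{x_1}\otimes\dots\otimes\mu_{x_{1:N-1}}$, where $\mu^1$ is the first marginal, $\mu_{x_{1:t}}\in\mathcal{P}(\mathbb{R})$ is the conditional distribution of the $(t+1)$-st coordinate given that the first $t$ coordinates equal $x_{1:t}$, $\mu_{x_{1:0}}:=\mu^1$, and let $\bar\mu_{x_{1:t}}=\mu_{x_{1:t}}\otimes\dots\otimes\mu_{x_{1:N-1}}$ be the conditional distribution of the coordinates $t+1,\dots,N$ (for $t=N$ the integral against $\bar\mu_{x_{1:N}}$ is omitted). $\mu(dx_{1:t-1})$ denotes integration against the law of the first $t-1$ coordinates. $\mu$ is successively $\mathcal{W}_p$-continuous if $\mathbb{R}^t\ni x_{1:t}\mapsto\mu_{x_{1:t}}$ is continuous with respect to $\mathcal{W}_p$ for each $t=1,\dots,N-1$ (this version of the kernels is used). For $\pi\in\mathcal{P}(\mathbb{R}^2)$ set $\mathcal{C}_p(\pi)=(\int|x-y|^p\,\pi(dx,dy))^{1/p}$. For $\eta\in\mathcal{P}(\mathbb{R})$,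 $\Pi_\delta(\eta,\cdot)$ is the set of $\pi\in\mathcal{P}(\mathbb{R}^2)$ with first marginal $\eta$ and $\mathcal{C}_p(\pi)<\delta$. For two measures, $\Pi(\mu,\nu)$ denotes the set of couplings. $\Pi_\delta(\mu,\cdot)$, for $\mu$ on $\mathbb{R}^N$, is the set of measures $\gamma=\gamma^1\otimes\gamma_{x_1,y_1}\otimes\dots\otimes\gamma_{x_{1:N-1},y_{1:N-1}}$ on $\mathbb{R}^N\times\mathbb{R}^N$ with Borel measurable kernels (giving the conditional law of $(x_{s+1},y_{s+1})$ given $(x_{1:s},y_{1:s})$) such that $\gamma_{x_{1:s-1},y_{1:s-1}}\in\Pi_\delta(\mu_{x_{1:s-1}},\cdot)$ for $s=1,\dots,N$ (with $\gamma_{x_{1:0},y_{1:0}}:=\gamma^1$). Such a $\gamma$ with second marginal $\nu$ is bicausal if $\gamma^1\in\Pi(\mu^1,\nu^1)$ and $\gamma_{x_{1:t},y_{1:t}}\in\Pi(\mu_{x_{1:t}},\nu_{y_{1:t}})$ for $\gamma$-a.e. $(x,y)$, $t=1,\dots,N-1$. Set $\Pi_{\mathrm{bc},\delta}(\mu,\cdot):=\{\gamma\in\Pi_\delta(\mu,\cdot):\gamma\text{ is bicausal}\}$. $\mathcal{A}$ is the set of predictable controls: Borel measurable $\alpha=(\alpha_1,\dots,\alpha_N):\mathbb{R}^N\times\mathbb{R}^N\to K^N$ such that $\alpha_t(x,y)$ depends only on $(x_{1:t-1},y_{1:t-1})$. Predictable controls $\alpha:\mathbb{R}^N\to K^N$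 are Borel maps with $\alpha_t(x)$ depending only on $x_{1:t-1}$.
   Formalization: K is additionally assumed convex (a compact interval), as part of strong convexity of α ↦ f(x,α) on K^N; for non-convex K, e.g. K=[0,1]∪[2,3] with N=2, the stated formula can fail. *)

theory Defs
  imports "HOL-Probability.Probability"
begin

text \<open>
  Points of $\mathbb{R}^N$ are vectors in type \<open>'n pts\<close>, where \<open>'n\<close> is a finite linearly ordered
  index type with $N$ elements; \<open>t :: 'n\<close> is the time index and \<open>{..<t}\<close>, \<open>{..t}\<close>, \<open>{t<..}\<close> are the
  times before, up to and after \<open>t\<close>. A map on $\mathbb{R}^{t-1}$ (a function of $x_{1:t-1}$) is
  represented as a map on $\mathbb{R}^N$ whose value depends only on the coordinates \<open>s < t\<close>; its
  continuity and measurability are unaffected by this.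
\<close>

type_synonym 'n pts = "(real, 'n) vec"

definition pnorm_on :: "'n set \<Rightarrow> real \<Rightarrow> ('n::finite) pts \<Rightarrow> real" where
  "pnorm_on I p x = (\<Sum>i\<in>I. \<bar>x $ i\<bar> powr p) powr (1 / p)"

abbreviation pnorm :: "real \<Rightarrow> ('n::finite) pts \<Rightarrow> real" where
  "pnorm \<equiv> pnorm_on UNIV"

definition set_coord :: "('n::finite) pts \<Rightarrow> 'n \<Rightarrow> real \<Rightarrow> 'n pts" where
  "set_coord x t v = (\<chi> i. if i = t then v else x $ i)"

definition set_coords ::
  "('n::finite) pts \<times> 'n pts \<Rightarrow> 'n \<Rightarrow> real \<times> real \<Rightarrow> 'n pts \<times> 'n pts" where
  "set_coords z t w = (set_coord (fst z) t (fst w), set_coord (snd z) t (snd w))"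

definition agree_before :: "'n::{finite,linorder} \<Rightarrow> 'n pts \<Rightarrow> 'n pts \<Rightarrow> bool" where
  "agree_before t x x' \<longleftrightarrow> (\<forall>s<t. x $ s = x' $ s)"

abbreviation borel_probs :: "'a::topological_space measure set" where
  "borel_probs \<equiv> space (prob_algebra borel)"

definition moment_probs :: "real \<Rightarrow> ('a::topological_space \<Rightarrow> real) \<Rightarrow> 'a measure set" where
  "moment_probs p nm = {\<mu> \<in> borel_probs. integrable \<mu> (\<lambda>x. nm x powr p)}"

definition spt :: "'a::topological_space measure \<Rightarrow> 'a set" where
  "spt \<mu> = {x. \<forall>U. open U \<and> x \<in> U \<longrightarrow> emeasure \<mu> U \<noteq> 0}"

definition Lnorm :: "real \<Rightarrow> 'a measure \<Rightarrow> ('a \<Rightarrow> real) \<Rightarrow> real" where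
  "Lnorm q M g = (\<integral>x. \<bar>g x\<bar> powr q \<partial>M) powr (1 / q)"

definition couplings ::
  "'a::topological_space measure \<Rightarrow> 'b::topological_space measure \<Rightarrow> ('a \<times> 'b) measure set" where
  "couplings \<mu> \<nu> = {\<pi> \<in> borel_probs. distr \<pi> borel fst = \<mu> \<and> distr \<pi> borel snd = \<nu>}"

text \<open>The case distinction is needed since the Bochner integral of a non-integrable function is \<open>0\<close>.\<close>

definition cost :: "real \<Rightarrow> (real \<times> real) measure \<Rightarrow> ereal" where
  "cost p \<pi> =
    (if integrable \<pi> (\<lambda>(x, y). \<bar>x - y\<bar> powr p)
     then ereal ((\<integral>(x, y). \<bar>x - y\<bar> powr p \<partial>\<pi>) powr (1 / p)) else \<infinity>)"

definition Wasserstein :: "real \<Rightarrow> real measure \<Rightarrow> real measure \<Rightarrow> ereal" where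
  "Wasserstein p \<mu> \<nu> = (INF \<pi> \<in> couplings \<mu> \<nu>. cost p \<pi>)"

definition near_couplings :: "real \<Rightarrow> real \<Rightarrow> real measure \<Rightarrow> (real \<times> real) measure set" where
  "near_couplings p \<delta> \<eta> =
    {\<pi> \<in> borel_probs. distr \<pi> borel fst = \<eta> \<and> cost p \<pi> < ereal \<delta>}"

text \<open>\<open>\<kappa> t x\<close> is the law $\mu_{x_{1:t-1}}$ of coordinate \<open>t\<close> given the coordinates \<open>s < t\<close> of \<open>x\<close>;
  for the smallest \<open>t\<close> it does not depend on \<open>x\<close> and is the first marginal.\<close>

definition kernels :: "('n::{finite,linorder} \<Rightarrow> 'n pts \<Rightarrow> real measure) \<Rightarrow> bool" where
  "kernels \<kappa> \<longleftrightarrow>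
    (\<forall>t. \<kappa> t \<in> borel \<rightarrow>\<^sub>M prob_algebra borel \<and>
         (\<forall>x x'. agree_before t x x' \<longrightarrow> \<kappa> t x = \<kappa> t x'))"

definition pair_kernels ::
  "('n::{finite,linorder} \<Rightarrow> 'n pts \<times> 'n pts \<Rightarrow> (real \<times> real) measure) \<Rightarrow> bool" where
  "pair_kernels g \<longleftrightarrow>
    (\<forall>t. g t \<in> borel \<rightarrow>\<^sub>M prob_algebra borel \<and>
         (\<forall>x x' y y'. agree_before t x x' \<and> agree_before t y y' \<longrightarrow> g t (x, y) = g t (x', y')))"

text \<open>Starting from the point \<open>z\<close>, the coordinates in \<open>T\<close> are drawn successively, in increasing
  order, from the kernels, and are written into the current point by \<open>upd\<close>.\<close>

definition compose_kernels ::
  "('z::topological_space \<Rightarrow> 'n \<Rightarrow> 'a \<Rightarrow> 'z) \<Rightarrow> ('n::{finite,linorder} \<Rightarrow> 'z \<Rightarrow> 'a measure) \<Rightarrow>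
   'n set \<Rightarrow> 'z \<Rightarrow> 'z measure" where
  "compose_kernels upd \<kappa> T z =
    foldl (\<lambda>M t. M \<bind> (\<lambda>z. distr (\<kappa> t z) borel (upd z t)))
      (return borel z) (sorted_list_of_set T)"

text \<open>The starting point \<open>0\<close> is immaterial below, since all coordinates are overwritten before a
  kernel reads them.\<close>

definition disintegration ::
  "'n pts measure \<Rightarrow> ('n::{finite,linorder} \<Rightarrow> 'n pts \<Rightarrow> real measure) \<Rightarrow> bool" where
  "disintegration \<mu> \<kappa> \<longleftrightarrow> kernels \<kappa> \<and> \<mu> = compose_kernels set_coord \<kappa> UNIV 0"

definition pair_disintegration ::
  "('n pts \<times> 'n pts) measure \<Rightarrow>
   ('n::{finite,linorder} \<Rightarrow> 'n pts \<times> 'n pts \<Rightarrow> (real \<times> real) measure) \<Rightarrow> bool" where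
  "pair_disintegration \<gamma> g \<longleftrightarrow> pair_kernels g \<and> \<gamma> = compose_kernels set_coords g UNIV 0"

text \<open>$\bar\mu_{x_{1:t}}$, as a measure on whole paths \<open>z\<close> that agree with \<open>x\<close> up to time \<open>t\<close>.
  For the largest \<open>t\<close> it is the point mass at \<open>x\<close>.\<close>

definition future_law ::
  "('n::{finite,linorder} \<Rightarrow> 'n pts \<Rightarrow> real measure) \<Rightarrow> 'n \<Rightarrow> 'n pts \<Rightarrow> 'n pts measure" where
  "future_law \<kappa> t x = compose_kernels set_coord \<kappa> {t<..} x"

text \<open>The Wasserstein distance is a metric on measures with finite \<open>p\<close>-th moment, so the kernels take
  values there. The condition is void for the smallest \<open>t\<close>, where the kernel is constant.\<close>

definition successively_continuous ::
  "real \<Rightarrow> ('n::{finite,linorder} \<Rightarrow> 'n pts \<Rightarrow> real measure) \<Rightarrow> bool" where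
  "successively_continuous p \<kappa> \<longleftrightarrow>
    (\<forall>t x. \<kappa> t x \<in> moment_probs p abs) \<and>
    (\<forall>t x. ((\<lambda>x'. Wasserstein p (\<kappa> t x') (\<kappa> t x)) \<longlongrightarrow> 0) (at x))"

definition Pi_near ::
  "real \<Rightarrow> ('n::{finite,linorder} \<Rightarrow> 'n pts \<Rightarrow> real measure) \<Rightarrow> real \<Rightarrow>
   ('n pts \<times> 'n pts) measure set" where
  "Pi_near p \<kappa> \<delta> =
    {\<gamma>. \<exists>g. pair_disintegration \<gamma> g \<and> (\<forall>t x y. g t (x, y) \<in> near_couplings p \<delta> (\<kappa> t x))}"

text \<open>\<open>\<theta>\<close> disintegrates the second marginal of \<open>\<gamma>\<close>. For the smallest \<open>t\<close> all three kernels are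
  constant, so that the condition is the one on the first marginals.\<close>

definition bicausal ::
  "('n::{finite,linorder} \<Rightarrow> 'n pts \<Rightarrow> real measure) \<Rightarrow> ('n pts \<times> 'n pts) measure \<Rightarrow> bool" where
  "bicausal \<kappa> \<gamma> \<longleftrightarrow>
    (\<exists>g \<theta>. pair_disintegration \<gamma> g \<and> disintegration (distr \<gamma> borel snd) \<theta> \<and>
      (\<forall>t. AE z in \<gamma>. g t z \<in> couplings (\<kappa> t (fst z)) (\<theta> t (snd z))))"

definition Pi_bc ::
  "real \<Rightarrow> ('n::{finite,linorder} \<Rightarrow> 'n pts \<Rightarrow> real measure) \<Rightarrow> real \<Rightarrow>
   ('n pts \<times> 'n pts) measure set" where
  "Pi_bc p \<kappa> \<delta> = {\<gamma> \<in> Pi_near p \<kappa> \<delta>. bicausal \<kappa> \<gamma>}"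

definition cube :: "real set \<Rightarrow> ('n::finite) pts set" where
  "cube K = {a. \<forall>i. a $ i \<in> K}"

definition controls :: "real set \<Rightarrow> (('n::{finite,linorder}) pts \<Rightarrow> 'n pts) set" where
  "controls K =
    {\<alpha> \<in> borel_measurable borel. (\<forall>x. \<alpha> x \<in> cube K) \<and>
      (\<forall>t x x'. agree_before t x x' \<longrightarrow> \<alpha> x $ t = \<alpha> x' $ t)}"

definition pair_controls ::
  "real set \<Rightarrow> (('n::{finite,linorder}) pts \<times> 'n pts \<Rightarrow> 'n pts) set" where
  "pair_controls K =
    {\<alpha> \<in> borel_measurable borel. (\<forall>z. \<alpha> z \<in> cube K) \<and>
      (\<forall>t x x' y y'. agree_before t x x' \<and> agree_before t y y' \<longrightarrow>
        \<alpha> (x, y) $ t = \<alpha> (x', y') $ t)}"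

definition V_robust ::
  "real \<Rightarrow> ('n::{finite,linorder} \<Rightarrow> 'n pts \<Rightarrow> real measure) \<Rightarrow>
   ('n pts \<Rightarrow> 'n pts \<Rightarrow> real) \<Rightarrow> real set \<Rightarrow> real \<Rightarrow> ereal" where
  "V_robust p \<kappa> f K \<delta> =
    (INF \<alpha> \<in> pair_controls K. SUP \<gamma> \<in> Pi_bc p \<kappa> \<delta>. ereal (\<integral>z. f (snd z) (\<alpha> z) \<partial>\<gamma>))"

definition V_zero ::
  "('n::{finite,linorder}) pts measure \<Rightarrow> ('n pts \<Rightarrow> 'n pts \<Rightarrow> real) \<Rightarrow> real set \<Rightarrow> ereal" where
  "V_zero \<mu> f K = (INF \<alpha> \<in> controls K. ereal (\<integral>x. f x (\<alpha> x) \<partial>\<mu>))"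

definition optimal_controls ::
  "('n::{finite,linorder}) pts measure \<Rightarrow> ('n pts \<Rightarrow> 'n pts \<Rightarrow> real) \<Rightarrow> real set \<Rightarrow>
   ('n pts \<Rightarrow> 'n pts) set" where
  "optimal_controls \<mu> f K =
    {\<alpha>. is_arg_min (\<lambda>\<alpha>. \<integral>x. f x (\<alpha> x) \<partial>\<mu>) (\<lambda>\<alpha>. \<alpha> \<in> controls K) \<alpha>}"

definition lsc_on :: "'a::topological_space set \<Rightarrow> ('a \<Rightarrow> real) \<Rightarrow> bool" where
  "lsc_on S f \<longleftrightarrow> (\<forall>z\<in>S. \<forall>c<f z. \<forall>\<^sub>F w in at z within S. c < f w)"

text \<open>As for \<^const>\<open>convex_on\<close>, convexity of the domain is part of the notion. \<open>D\<close> is the gradient of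
  \<open>g\<close> at \<open>a\<close>, one-sided at boundary points of \<open>S\<close>.\<close>

definition strongly_convex_on ::
  "real \<Rightarrow> ('n::finite) pts set \<Rightarrow> ('n pts \<Rightarrow> real) \<Rightarrow> real \<Rightarrow> bool" where
  "strongly_convex_on p S g m \<longleftrightarrow> convex S \<and>
    (\<forall>a\<in>S. \<exists>D. (g has_derivative (\<lambda>h. D \<bullet> h)) (at a within S) \<and>
      (\<forall>b\<in>S. g b - g a \<ge> D \<bullet> (b - a) + m / 2 * (pnorm p (b - a))\<^sup>2))"

text \<open>\<open>Df x a\<close> plays the role of the gradient of \<open>f\<close> in \<open>x\<close>. The summand for the smallest \<open>t\<close> does not
  depend on \<open>x\<close>, so that its outer integral is that of a constant.\<close>

definition sensitivity ::
  "real \<Rightarrow> ('n::{finite,linorder}) pts measure \<Rightarrow> ('n \<Rightarrow> 'n pts \<Rightarrow> real measure) \<Rightarrow>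
   ('n pts \<Rightarrow> 'n pts \<Rightarrow> 'n pts) \<Rightarrow> ('n pts \<Rightarrow> 'n pts) \<Rightarrow> real" where
  "sensitivity q \<mu> \<kappa> Df \<alpha> =
    (\<Sum>t\<in>UNIV. \<integral>x. Lnorm q (\<kappa> t x)
      (\<lambda>v. \<integral>z. Df z (\<alpha> z) $ t \<partial>future_law \<kappa> t (set_coord x t v)) \<partial>\<mu>)"

end

theory Submission
  imports Defs
begin

text \<open>
  Upper bound: an optimal control \<open>\<alpha>\<close> of the unperturbed problem is used for all \<open>\<delta>\<close>. In the first-order
  expansion of \<open>f\<close> causality allows to replace the gradient by its conditional expectation given the
  past, and the conditional Hoelder inequality bounds the linear term by \<open>\<delta>\<close> times the sensitivity of
  \<open>\<alpha>\<close>; subcritical growth of the gradient makes the remainder \<open>o(\<delta>)\<close> uniformly over couplings.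

  Lower bound: the adversary moves \<open>x\<close> to \<open>x + \<delta> \<Phi>(x)\<close>, where \<open>\<Phi>\<close> is adapted, almost attains equality in
  the conditional Hoelder inequalities for \<open>\<alpha>\<close>, and is Lipschitz in the current coordinate. For small
  \<open>\<delta>\<close> this triangular map is invertible with adapted inverse, so that its graph is a bicausal
  coupling. A near-optimal control, read along the graph, is a predictable control of \<open>x\<close> alone and is
  minimizing for the unperturbed problem as \<open>\<delta>\<close> tends to 0; strong convexity forces it to converge
  to \<open>\<alpha>\<close>. The same convexity argument gives the existence of \<open>\<alpha>\<close>.
\<close>

section \<open>Successive composition of kernels\<close>

text \<open>In the robust problem the adversary answers the control, yet the lower bound plays one
  fixed direction, built for the optimal \<alpha>, against every control. Nothing is lost in the
  limit: strong convexity makes the minimizer unique up to null sets, and a control that undercuts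
  \<open>v0 + \<delta> * s\<close> must be nearly minimizing, hence close to \<alpha>, where the
  direction is almost extremal. Since \<open>eps x\<close> may come arbitrarily close to 0, there is
  no rate for this convergence; therefore the lower bound is argued by contradiction along a
  sequence.

  Two demands shape the direction. \<open>Pi_near\<close> bounds the cost of the kernels at every
  past, whereas conditional norms of the gradient are controlled only almost everywhere; this forces
  a renormalisation at each past. And \<open>bicausal\<close> wants the kernels of the second
  marginal as functions of y alone; this forces the transport to be injective. A Lipschitz bound in
  the coordinate being moved suffices for that, since the earlier coordinates have been recovered by
  the time it is inverted.\<close>

lemma
  fixes f :: "'a \<Rightarrow> real"
  assumes N: "N \<in> M \<rightarrow>\<^sub>M subprob_algebra B" and ne: "space M \<noteq> {}"
    and f: "integrable (M \<bind> N) f"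
  shows AE_integrable_bind: "AE x in M. integrable (N x) f"
    and integrable_integral_bind: "integrable M (\<lambda>x. \<integral>y. f y \<partial>N x)"
    and integral_integral_bind: "(\<integral>x. \<integral>y. f y \<partial>N x \<partial>M) = (\<integral>y. f y \<partial>(M \<bind> N))"
proof -
  have sets_N: "x \<in> space M \<Longrightarrow> sets (N x) = sets B" for x
    by (rule sets_kernel[OF N])
  have f_B[measurable]: "f \<in> borel_measurable B"
    using borel_measurable_integrable[OF f] sets_bind[OF sets_N ne]
    by (simp cong: measurable_cong_sets)
  have f_N: "x \<in> space M \<Longrightarrow> f \<in> borel_measurable (N x)" for x
    using f_B sets_N[of x] by (simp cong: measurable_cong_sets)
  have meas: "(\<lambda>x. \<integral>\<^sup>+y. ennreal (g (f y)) \<partial>N x) \<in> borel_measurable M"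
    if "g \<in> borel_measurable borel" for g :: "real \<Rightarrow> real"
    by (intro measurable_compose[OF N nn_integral_measurable_subprob_algebra]
        measurable_compose[OF measurable_compose[OF f_B that] measurable_ennreal])
  have split: "(\<integral>\<^sup>+x. \<integral>\<^sup>+y. ennreal (g (f y)) \<partial>N x \<partial>M) = (\<integral>\<^sup>+y. ennreal (g (f y)) \<partial>(M \<bind> N))"
    if "g \<in> borel_measurable borel" for g :: "real \<Rightarrow> real"
    by (intro nn_integral_bind[OF _ N, symmetric]
        measurable_compose[OF measurable_compose[OF f_B that] measurable_ennreal])
  have fin: "(\<integral>\<^sup>+y. ennreal \<bar>f y\<bar> \<partial>(M \<bind> N)) < \<infinity>"
    using f by (simp add: integrable_iff_bounded)
  have "(\<integral>\<^sup>+x. \<integral>\<^sup>+y. ennreal \<bar>f y\<bar> \<partial>N x \<partial>M) \<noteq> \<infinity>"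
    using split[of abs] fin by simp
  then have "AE x in M. (\<integral>\<^sup>+y. ennreal \<bar>f y\<bar> \<partial>N x) \<noteq> \<infinity>"
    using meas[of abs] by (intro nn_integral_PInf_AE) auto
  then show ae: "AE x in M. integrable (N x) f"
    using AE_space by eventually_elim (auto simp: integrable_iff_bounded f_N top.not_eq_extremum)
  \<comment> \<open>The identity \<open>split\<close> concerns nonnegative functions, so positive
    and negative parts are treated separately. Both are finite almost everywhere because the
    integral of \<open>\<bar>f y\<bar>\<close> dominates them.\<close>
  define pos where "pos x = (\<integral>\<^sup>+y. ennreal (f y) \<partial>N x)" for x
  define neg where "neg x = (\<integral>\<^sup>+y. ennreal (- f y) \<partial>N x)" for x
  have m[measurable]: "pos \<in> borel_measurable M" "neg \<in> borel_measurable M"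
    using meas[of "\<lambda>x. x"] meas[of uminus] by (auto simp: pos_def[abs_def] neg_def[abs_def])
  have ints: "integral\<^sup>N M pos = (\<integral>\<^sup>+y. ennreal (f y) \<partial>(M \<bind> N))"
      "integral\<^sup>N M neg = (\<integral>\<^sup>+y. ennreal (- f y) \<partial>(M \<bind> N))"
    using split[of "\<lambda>x. x"] split[of uminus] by (simp_all add: pos_def[abs_def] neg_def[abs_def])
  have "(\<integral>\<^sup>+y. ennreal (f y) \<partial>(M \<bind> N)) \<le> (\<integral>\<^sup>+y. ennreal \<bar>f y\<bar> \<partial>(M \<bind> N))"
      "(\<integral>\<^sup>+y. ennreal (- f y) \<partial>(M \<bind> N)) \<le> (\<integral>\<^sup>+y. ennreal \<bar>f y\<bar> \<partial>(M \<bind> N))"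
    by (auto intro!: nn_integral_mono ennreal_leI)
  then have fin2: "integral\<^sup>N M pos < \<infinity>" "integral\<^sup>N M neg < \<infinity>"
    using fin ints by (auto intro: le_less_trans)
  have "AE x in M. pos x \<noteq> \<infinity>" "AE x in M. neg x \<noteq> \<infinity>"
    using fin2 nn_integral_PInf_AE[of pos M] nn_integral_PInf_AE[of neg M] m by auto
  then have eqs: "(\<integral>\<^sup>+x. ennreal (enn2real (pos x)) \<partial>M) = integral\<^sup>N M pos"
      "(\<integral>\<^sup>+x. ennreal (enn2real (neg x)) \<partial>M) = integral\<^sup>N M neg"
    by (auto intro!: nn_integral_cong_AE simp: ennreal_enn2real_if)
  have i: "integrable M (\<lambda>x. enn2real (pos x))" "integrable M (\<lambda>x. enn2real (neg x))"
    using fin2 eqs by (auto intro!: integrableI_nonneg)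
  have rep: "AE x in M. (\<integral>y. f y \<partial>N x) = enn2real (pos x) - enn2real (neg x)"
    using ae by eventually_elim (simp add: real_lebesgue_integral_def pos_def neg_def)
  have mi: "(\<lambda>x. \<integral>y. f y \<partial>N x) \<in> borel_measurable M"
    by (intro measurable_compose[OF N integral_measurable_subprob_algebra]) measurable
  show "integrable M (\<lambda>x. \<integral>y. f y \<partial>N x)"
    using rep i mi by (subst integrable_cong_AE[OF _ _ rep]) auto
  have "(\<integral>x. \<integral>y. f y \<partial>N x \<partial>M) = (\<integral>x. enn2real (pos x) - enn2real (neg x) \<partial>M)"
    using rep mi by (intro integral_cong_AE) auto
  also have "\<dots> = (\<integral>x. enn2real (pos x) \<partial>M) - (\<integral>x. enn2real (neg x) \<partial>M)"
    using i by simp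
  also have "\<dots> = enn2real (integral\<^sup>N M pos) - enn2real (integral\<^sup>N M neg)"
    by (simp add: integral_eq_nn_integral eqs)
  also have "\<dots> = (\<integral>y. f y \<partial>(M \<bind> N))"
    by (simp add: real_lebesgue_integral_def[OF f] ints)
  finally show "(\<integral>x. \<integral>y. f y \<partial>N x \<partial>M) = (\<integral>y. f y \<partial>(M \<bind> N))" .
qed

lemma sorted_list_of_set_Un:
  fixes S T :: "'a::{finite,linorder} set"
  assumes "\<And>s t. s \<in> S \<Longrightarrow> t \<in> T \<Longrightarrow> s < t"
  shows "sorted_list_of_set (S \<union> T) = sorted_list_of_set S @ sorted_list_of_set T"
proof -
  have "S \<inter> T = {}" using assms by blast
  then have "sorted_wrt (<) (sorted_list_of_set S @ sorted_list_of_set T) \<and>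
      set (sorted_list_of_set S @ sorted_list_of_set T) = S \<union> T \<and>
      length (sorted_list_of_set S @ sorted_list_of_set T) = card (S \<union> T)"
    using assms by (auto simp: sorted_wrt_append card_Un_disjoint)
  then show ?thesis
    using sorted_list_of_set_unique[OF finite, of "sorted_list_of_set S @ sorted_list_of_set T" "S \<union> T"]
    by (simp only: simp_thms)
qed

text \<open>Abstract in the points \<open>'z\<close>, so as to cover both paths and pairs of paths; \<open>same T\<close> is agreement
  on the coordinates in \<open>T\<close>.\<close>

locale kernel_chain =
  fixes upd :: "'z::second_countable_topology \<Rightarrow> 'n::{finite,linorder} \<Rightarrow>
      'a::second_countable_topology \<Rightarrow> 'z"
    and k :: "'n \<Rightarrow> 'z \<Rightarrow> 'a measure"
    and same :: "'n set \<Rightarrow> 'z \<Rightarrow> 'z \<Rightarrow> bool"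
  assumes upd_measurable[measurable]: "(\<lambda>(z, a). upd z t a) \<in> borel \<Otimes>\<^sub>M borel \<rightarrow>\<^sub>M borel"
    and kernel_measurable[measurable]: "k t \<in> borel \<rightarrow>\<^sub>M prob_algebra borel"
    and same_pred: "Measurable.pred borel (same T z)"
    and same_refl: "same T z z"
    and same_trans: "same T z z' \<Longrightarrow> same T z' z'' \<Longrightarrow> same T z z''"
    and same_sym: "same T z z' \<Longrightarrow> same T z' z"
    and same_mono: "same T z z' \<Longrightarrow> S \<subseteq> T \<Longrightarrow> same S z z'"
    and same_UNIV: "same UNIV z z' \<Longrightarrow> z = z'"
    and same_empty: "same {} z z'"
    and same_upd: "same T z z' \<Longrightarrow> same (insert t T) (upd z t a) (upd z' t a)"
    and upd_same: "t \<notin> T \<Longrightarrow> same T z (upd z t a)"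
    and kernel_cong: "same {..<t} z z' \<Longrightarrow> k t z = k t z'"
begin

definition step :: "'n \<Rightarrow> 'z \<Rightarrow> 'z measure" where
  "step t z = distr (k t z) borel (upd z t)"

text \<open>Recursion on the first time drawn, which suits conditioning and induction better than
  the left fold in \<open>compose_kernels\<close>; \<open>law_eq_chain\<close> identifies the
  two.\<close>

primrec chain :: "'n list \<Rightarrow> 'z \<Rightarrow> 'z measure" where
  "chain [] z = return borel z"
| "chain (t # L) z = step t z \<bind> chain L"

definition law :: "'n set \<Rightarrow> 'z \<Rightarrow> 'z measure" where
  "law T = compose_kernels upd k T"

lemma kernel_sets[simp, measurable_cong]: "sets (k t z) = sets borel"
  and kernel_prob: "prob_space (k t z)"
  using measurable_space[OF kernel_measurable, of z t] by (auto simp: space_prob_algebra)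

lemma upd_measurable1[measurable]: "upd z t \<in> borel \<rightarrow>\<^sub>M borel"
  using measurable_compose[OF _ upd_measurable, of "\<lambda>a. (z, a)" borel t] by simp

lemma step_measurable[measurable]: "step t \<in> borel \<rightarrow>\<^sub>M prob_algebra borel"
  unfolding step_def by measurable

lemma chain_measurable[measurable]: "chain L \<in> borel \<rightarrow>\<^sub>M prob_algebra borel"
  by (induction L) (auto intro!: measurable_bind_prob_space)

lemma chain_measurable'[measurable]: "chain L \<in> borel \<rightarrow>\<^sub>M subprob_algebra borel"
  by (rule measurable_prob_algebraD) measurable

lemma step_measurable'[measurable]: "step t \<in> borel \<rightarrow>\<^sub>M subprob_algebra borel"
  by (rule measurable_prob_algebraD) measurable

lemma chain_prob: "prob_space (chain L z)"
  and chain_sets[simp, measurable_cong]: "sets (chain L z) = sets borel"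
  using measurable_space[OF chain_measurable, of z L] by (auto simp: space_prob_algebra)

lemma step_sets[simp, measurable_cong]: "sets (step t z) = sets borel"
  using measurable_space[OF step_measurable, of z t] by (auto simp: space_prob_algebra)

lemma chain_space[simp]: "space (chain L z) = UNIV" and step_space[simp]: "space (step t z) = UNIV"
  and kernel_space[simp]: "space (k t z) = UNIV"
  using sets_eq_imp_space_eq[OF chain_sets] sets_eq_imp_space_eq[OF step_sets]
      sets_eq_imp_space_eq[OF kernel_sets] by auto

lemma chain_Cons: "chain (t # L) z = k t z \<bind> (\<lambda>a. chain L (upd z t a))"
  unfolding chain.simps step_def by (subst bind_distr[OF _ chain_measurable']) auto

text \<open>Generalised to an arbitrary initial measure, so that the left fold unwinds by
  associativity of bind.\<close>

lemma foldl_chain: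
  assumes "sets M = sets borel"
  shows "foldl (\<lambda>M t. M \<bind> (\<lambda>z. distr (k t z) borel (upd z t))) M L = M \<bind> chain L"
  using assms
proof (induction L arbitrary: M)
  case Nil
  then show ?case by (simp add: bind_return'' eta_contract_eq cong: bind_cong)
next
  case (Cons t L)
  have ne: "space M \<noteq> {}" using sets_eq_imp_space_eq[OF Cons.prems] by simp
  have m: "step t \<in> M \<rightarrow>\<^sub>M subprob_algebra borel"
    using Cons.prems step_measurable' by (simp cong: measurable_cong_sets)
  have "sets (M \<bind> step t) = sets borel"
    using ne by (intro sets_bind) auto
  then have "foldl (\<lambda>M t. M \<bind> (\<lambda>z. distr (k t z) borel (upd z t))) (M \<bind> step t) L
      = M \<bind> step t \<bind> chain L"
    by (rule Cons.IH)
  also have "\<dots> = M \<bind> (\<lambda>z. step t z \<bind> chain L)"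
    by (rule bind_assoc[OF m chain_measurable'])
  finally show ?case by (simp add: step_def[abs_def])
qed

lemma law_eq_chain: "law T z = chain (sorted_list_of_set T) z"
  unfolding law_def compose_kernels_def by (subst foldl_chain) (auto intro!: bind_return[OF chain_measurable'])

lemma law_measurable[measurable]: "law T \<in> borel \<rightarrow>\<^sub>M prob_algebra borel"
  and law_measurable'[measurable]: "law T \<in> borel \<rightarrow>\<^sub>M subprob_algebra borel"
  and law_prob: "prob_space (law T z)"
  and law_sets[simp, measurable_cong]: "sets (law T z) = sets borel"
  and law_space[simp]: "space (law T z) = UNIV"
  unfolding law_eq_chain[abs_def]
  by (rule chain_measurable chain_measurable' chain_prob chain_sets chain_space)+

lemma chain_append: "chain (L1 @ L2) z = chain L1 z \<bind> chain L2"
proof (induction L1 arbitrary: z)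
  case Nil
  show ?case by (simp add: bind_return[OF chain_measurable'])
next
  case (Cons t L1)
  have IH: "chain (L1 @ L2) = (\<lambda>z. chain L1 z \<bind> chain L2)"
    by (rule ext) (rule Cons.IH)
  have "chain ((t # L1) @ L2) z = step t z \<bind> (\<lambda>z. chain L1 z \<bind> chain L2)"
    by (simp add: IH)
  also have "\<dots> = chain (t # L1) z \<bind> chain L2"
    unfolding chain.simps by (rule bind_assoc[symmetric, where N=borel and R=borel]) measurable
  finally show ?case .
qed

lemma chain_same: "T \<inter> set L = {} \<Longrightarrow> AE z' in chain L z. same T z z'"
proof (induction L arbitrary: z)
  case Nil
  show ?case by (subst chain.simps, subst AE_return) (auto simp: same_pred same_refl)
next
  case (Cons t L)
  have [measurable]: "Measurable.pred borel (same T z)" by (rule same_pred)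
  have "AE z' in chain L (upd z t a). same T z z'" for a
    using Cons.IH[of "upd z t a"] upd_same[of t T z a] Cons.prems by (auto intro: same_trans)
  moreover have "(\<lambda>a. chain L (upd z t a)) \<in> k t z \<rightarrow>\<^sub>M subprob_algebra borel"
    by measurable
  ultimately show ?case
    unfolding chain_Cons by (subst AE_bind[where B=borel]) auto
qed

text \<open>Invariant of the induction: the two points agree on all times not in the remaining list.
  As the list increases, these include every time before its head, so the head kernels coincide, and
  writing the same value at both points preserves the invariant. With the list exhausted, the points
  are equal.\<close>

lemma chain_cong:
  assumes "sorted_wrt (<) L" "T \<union> set L = UNIV" "same T z z'"
  shows "chain L z = chain L z'"
  using assms
proof (induction L arbitrary: T z z')
  case Nil
  then show ?case using same_UNIV by auto
next
  case (Cons t L)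
  have "{..<t} \<subseteq> T"
  proof
    fix s assume "s \<in> {..<t}"
    then have "s \<notin> set (t # L)" using Cons.prems(1) by auto
    then show "s \<in> T" using Cons.prems(2) by blast
  qed
  then have "k t z = k t z'"
    using Cons.prems(3) by (intro kernel_cong) (rule same_mono)
  moreover have "chain L (upd z t a) = chain L (upd z' t a)" for a
    using Cons.prems by (intro Cons.IH[of "insert t T"] same_upd) auto
  ultimately show ?case unfolding chain_Cons by simp
qed

lemma law_cong: "T \<union> U = UNIV \<Longrightarrow> same T z z' \<Longrightarrow> law U z = law U z'"
  unfolding law_eq_chain by (rule chain_cong[of _ T]) auto

lemma law_UNIV_const: "law UNIV z = law UNIV z'"
  using same_empty by (rule law_cong[rotated]) auto

lemma law_same: "T \<inter> U = {} \<Longrightarrow> AE z' in law U z. same T z z'"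
  unfolding law_eq_chain by (rule chain_same) auto

lemma law_split:
  assumes "\<And>s t. s \<in> S \<Longrightarrow> t \<in> T \<Longrightarrow> s < t"
  shows "law (S \<union> T) z = law S z \<bind> law T"
proof -
  have "sorted_list_of_set (S \<union> T) = sorted_list_of_set S @ sorted_list_of_set T"
    using assms by (rule sorted_list_of_set_Un)
  then show ?thesis
    by (simp add: law_eq_chain[abs_def] chain_append)
qed

lemma law_singleton: "law {t} = step t"
  by (rule ext) (simp add: law_eq_chain eta_contract_eq bind_return''[OF step_sets] chain.simps(1)[abs_def])

text \<open>The tower property: redrawing all times of an up-closed set from their conditional law
  changes nothing. A second draw repeats the first, because \<open>law U\<close> reads only times
  outside \<open>U\<close>, and those are left untouched by the first draw.\<close>

lemma law_absorb:
  assumes up: "\<And>s t. s \<in> U \<Longrightarrow> s \<le> t \<Longrightarrow> t \<in> U"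
  shows "law UNIV z \<bind> law U = law UNIV z"
proof -
  have split: "law UNIV z = law (- U) z \<bind> law U"
    using law_split[of "- U" U z] up by (force simp: not_less[symmetric])
  have "law UNIV z \<bind> law U = law (- U) z \<bind> (\<lambda>z. law U z \<bind> law U)"
    unfolding split by (rule bind_assoc[where N=borel and R=borel]) measurable
  also have "\<dots> = law (- U) z \<bind> law U"
  proof (rule bind_cong[OF refl])
    fix z
    have "AE z' in law U z. law U z' = law U z"
      using law_same[of "- U" U z]
      by (rule AE_mp) (auto intro!: AE_I2 law_cong[symmetric, of "- U"])
    then have "law U z \<bind> law U = law U z \<bind> (\<lambda>_. law U z)"
      using measurable_space[OF law_measurable, of z U]
      by (intro bind_cong_AE'[of _ borel _ borel]) (auto intro!: measurable_const)
    also have "\<dots> = law U z"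
      by (rule bind_const'[OF law_prob prob_space_imp_subprob_space[OF law_prob]])
    finally show "law U z \<bind> law U = law U z" .
  qed
  finally show ?thesis using split by simp
qed

lemma law_greaterThan_absorb: "law UNIV z \<bind> law {t<..} = law UNIV z"
  by (rule law_absorb) auto

text \<open>Disintegration around time \<open>t\<close>: redraw \<open>t\<close>, then its future.
  Conditioning on the strict past of \<open>t\<close> rests on this identity, conditioning on the
  times up to \<open>t\<close> on the preceding one.\<close>

lemma law_step_absorb: "(law UNIV z \<bind> step t) \<bind> law {t<..} = law UNIV z"
proof -
  have "(law UNIV z \<bind> step t) \<bind> law {t<..} = law UNIV z \<bind> (\<lambda>z. step t z \<bind> law {t<..})"
    by (rule bind_assoc[where N=borel and R=borel]) measurable
  also have "\<dots> = law UNIV z \<bind> law {t..}"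
  proof -
    have "{t} \<union> {t<..} = {t..}" by auto
    then show ?thesis
      using law_split[of "{t}" "{t<..}"] by (simp add: law_singleton cong: bind_cong)
  qed
  also have "\<dots> = law UNIV z"
    by (rule law_absorb) auto
  finally show ?thesis .
qed

text \<open>Coordinate \<open>t\<close> itself may be read, in contrast to kernels and controls,
  which see only earlier times.\<close>

definition adapted :: "'n \<Rightarrow> ('z \<Rightarrow> 'b) \<Rightarrow> bool" where
  "adapted t h \<longleftrightarrow> (\<forall>z z'. same {..t} z z' \<longrightarrow> h z = h z')"

lemma AE_law_adapted: "adapted t h \<Longrightarrow> AE z' in law {t<..} z. h z' = h z"
  using law_same[of "{..t}" "{t<..}" z] unfolding adapted_def
  by (rule AE_mp[rotated, rotated]) (auto intro!: AE_I2 dest: same_sym)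

context
  fixes M z0 assumes M: "M = law UNIV z0"
begin

lemma sets_M: "sets M = sets borel" and space_M: "space M = UNIV"
  by (auto simp: M)

lemma step_M_sets: "sets (M \<bind> step t) = sets borel"
  by (rule sets_bind) (auto simp: space_M)

lemma
  fixes h :: "'z \<Rightarrow> real"
  assumes h: "integrable M h"
  shows AE_integrable_future: "AE z in M. integrable (law {t<..} z) h"
    and integrable_future: "integrable M (\<lambda>z. \<integral>z'. h z' \<partial>law {t<..} z)"
    and integral_future: "(\<integral>z. \<integral>z'. h z' \<partial>law {t<..} z \<partial>M) = (\<integral>z. h z \<partial>M)"
proof -
  note sets_M[simp, measurable_cong] space_M[simp]
  have m: "law {t<..} \<in> M \<rightarrow>\<^sub>M subprob_algebra borel" by measurable
  have eq: "M \<bind> law {t<..} = M" unfolding M by (rule law_greaterThan_absorb)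
  have "integrable (M \<bind> law {t<..}) h" using h eq by simp
  note AE_integrable_bind[OF m _ this] integrable_integral_bind[OF m _ this]
    integral_integral_bind[OF m _ this]
  then show "AE z in M. integrable (law {t<..} z) h"
    "integrable M (\<lambda>z. \<integral>z'. h z' \<partial>law {t<..} z)"
    "(\<integral>z. \<integral>z'. h z' \<partial>law {t<..} z \<partial>M) = (\<integral>z. h z \<partial>M)"
    by (simp_all add: eq)
qed

lemma nn_integral_step_future:
  fixes h :: "'z \<Rightarrow> ennreal"
  assumes [measurable]: "h \<in> borel_measurable borel"
  shows "(\<integral>\<^sup>+z. \<integral>\<^sup>+z'. h z' \<partial>law {t<..} z \<partial>(M \<bind> step t)) = (\<integral>\<^sup>+z. h z \<partial>M)"
  using law_step_absorb[of z0 t] step_M_sets[of t]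
  by (auto simp: M nn_integral_bind[where B=borel, symmetric] cong: measurable_cong_sets)

text \<open>An adapted integrand is almost surely constant under \<open>law {t<..} z\<close>, so of
  the two redraws in \<open>law_step_absorb\<close> only the one of coordinate \<open>t\<close>
  remains visible. The versions for null sets and for integrable functions below rest on the same
  remark.\<close>

lemma nn_integral_adapted:
  fixes h :: "'z \<Rightarrow> ennreal"
  assumes [measurable]: "h \<in> borel_measurable borel" and a: "adapted t h"
  shows "(\<integral>\<^sup>+z. \<integral>\<^sup>+a. h (upd z t a) \<partial>k t z \<partial>M) = (\<integral>\<^sup>+z. h z \<partial>M)"
proof -
  note sets_M[simp, measurable_cong] space_M[simp]
  have "(\<integral>\<^sup>+z'. h z' \<partial>law {t<..} z) = h z" for z
    using prob_space.emeasure_space_1[OF law_prob[of "{t<..}" z]]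
    by (subst nn_integral_cong_AE[OF AE_law_adapted[OF a]]) simp
  then have "(\<integral>\<^sup>+z. h z \<partial>M) = (\<integral>\<^sup>+z. h z \<partial>(M \<bind> step t))"
    using nn_integral_step_future[of h t] by simp
  also have "\<dots> = (\<integral>\<^sup>+z. \<integral>\<^sup>+z'. h z' \<partial>step t z \<partial>M)"
    by (rule nn_integral_bind[where B=borel]) measurable
  also have "\<dots> = (\<integral>\<^sup>+z. \<integral>\<^sup>+a. h (upd z t a) \<partial>k t z \<partial>M)"
    unfolding step_def by (subst nn_integral_distr) auto
  finally show ?thesis by simp
qed

lemma AE_adapted:
  assumes [measurable]: "Measurable.pred borel P" and a: "adapted t P" and P: "AE z in M. P z"
  shows "AE z in M. AE a in k t z. P (upd z t a)"
proof -
  note sets_M[simp, measurable_cong] space_M[simp]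
  have eq: "(M \<bind> step t) \<bind> law {t<..} = M" unfolding M by (rule law_step_absorb)
  have "AE z in (M \<bind> step t) \<bind> law {t<..}. P z" unfolding eq by (rule P)
  then have "AE z in M \<bind> step t. AE z' in law {t<..} z. P z'"
    using step_M_sets[of t]
    by (subst (asm) AE_bind[where B=borel]) (auto cong: measurable_cong_sets)
  then have "AE z in M \<bind> step t. P z"
  proof eventually_elim
    case (elim z)
    with AE_law_adapted[OF a, of z] have "AE z' in law {t<..} z. P z" by eventually_elim simp
    then show ?case using prob_space.AE_const[OF law_prob[of "{t<..}" z]] by simp
  qed
  then have "AE z in M. AE z' in step t z. P z'"
    by (subst (asm) AE_bind[where B=borel]) auto
  then show ?thesis
    unfolding step_def by (subst (asm) AE_distr_iff) auto
qed

lemma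
  fixes h :: "'z \<Rightarrow> real"
  assumes a: "adapted t h" and h: "integrable M h"
  shows AE_integrable_adapted: "AE z in M. integrable (k t z) (\<lambda>a. h (upd z t a))"
    and integrable_adapted: "integrable M (\<lambda>z. \<integral>a. h (upd z t a) \<partial>k t z)"
    and integral_adapted: "(\<integral>z. \<integral>a. h (upd z t a) \<partial>k t z \<partial>M) = (\<integral>z. h z \<partial>M)"
proof -
  note sets_M[simp, measurable_cong] space_M[simp]
  have hm[measurable]: "h \<in> borel_measurable borel"
    using borel_measurable_integrable[OF h] by (simp cong: measurable_cong_sets)
  have m: "step t \<in> M \<rightarrow>\<^sub>M subprob_algebra borel" by measurable
  have sp: "space (M \<bind> step t) = UNIV" using sets_eq_imp_space_eq[OF step_M_sets] by simp
  have m2: "law {t<..} \<in> (M \<bind> step t) \<rightarrow>\<^sub>M subprob_algebra borel"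
    using step_M_sets by (auto cong: measurable_cong_sets)
  have eq: "(M \<bind> step t) \<bind> law {t<..} = M" unfolding M by (rule law_step_absorb)
  have c: "(\<integral>z'. h z' \<partial>law {t<..} z) = h z" for z
    using prob_space.prob_space[OF law_prob[of "{t<..}" z]]
    by (subst integral_cong_AE[OF _ _ AE_law_adapted[OF a]]) auto
  have i: "integrable (M \<bind> step t) h" and ie: "(\<integral>z. h z \<partial>(M \<bind> step t)) = (\<integral>z. h z \<partial>M)"
    using integrable_integral_bind[OF m2, of h] integral_integral_bind[OF m2, of h] h
    unfolding c by (simp_all add: eq sp)
  note AE_integrable_bind[OF m _ i] integrable_integral_bind[OF m _ i] integral_integral_bind[OF m _ i]
  moreover have "integrable (step t z) h \<longleftrightarrow> integrable (k t z) (\<lambda>a. h (upd z t a))" for z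
    unfolding step_def by (subst integrable_distr_eq) auto
  moreover have "(\<integral>z'. h z' \<partial>step t z) = (\<integral>a. h (upd z t a) \<partial>k t z)" for z
    unfolding step_def by (subst integral_distr) auto
  ultimately show "AE z in M. integrable (k t z) (\<lambda>a. h (upd z t a))"
    "integrable M (\<lambda>z. \<integral>a. h (upd z t a) \<partial>k t z)"
    "(\<integral>z. \<integral>a. h (upd z t a) \<partial>k t z \<partial>M) = (\<integral>z. h z \<partial>M)"
    by (simp_all add: ie)
qed

end

end

text \<open>The image of a chain under \<open>\<Phi>\<close> is a chain if every single step is
  intertwined. After a step the two points need to agree only on \<open>{..t}\<close>: later
  coordinates are overwritten before a kernel reads them, and up-closedness of the list guarantees
  that it contains all of them. The lemma serves for the first projection of a coupling, for the
  graph of a triangular map and for the map itself.\<close>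

lemma chain_intertwine:
  assumes c1: "kernel_chain upd k same" and c2: "kernel_chain upd' k' same'"
    and \<Phi>[measurable]: "\<Phi> \<in> borel \<rightarrow>\<^sub>M borel"
    and \<psi>: "\<And>t z. \<psi> t z \<in> borel \<rightarrow>\<^sub>M borel"
    and k': "\<And>t z. k' t (\<Phi> z) = distr (k t z) borel (\<psi> t z)"
    and upd': "\<And>t z a. same' {..t} (upd' (\<Phi> z) t (\<psi> t z a)) (\<Phi> (upd z t a))"
    and L: "sorted_wrt (<) L" "\<And>s t. s \<in> set L \<Longrightarrow> s \<le> t \<Longrightarrow> t \<in> set L"
  shows "distr (kernel_chain.chain upd k L z) borel \<Phi> = kernel_chain.chain upd' k' L (\<Phi> z)"
proof -
  interpret c1: kernel_chain upd k same by fact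
  interpret c2: kernel_chain upd' k' same' by fact
  show ?thesis using L
  proof (induction L arbitrary: z)
    case Nil
    show ?case by (simp add: distr_return)
  next
    case (Cons t L)
    have m2[measurable]: "(\<lambda>a. c2.chain L (upd' z t a)) \<in> borel \<rightarrow>\<^sub>M subprob_algebra borel" for z
      by measurable
    have up: "s \<in> set L \<Longrightarrow> s \<le> r \<Longrightarrow> r \<in> set L" for s r
      using Cons.prems by fastforce
    have cover: "{..t} \<union> set L = UNIV"
      using Cons.prems(2)[of t] by auto (metis linear)
    have "distr (c1.chain (t # L) z) borel \<Phi> = k t z \<bind> (\<lambda>a. distr (c1.chain L (upd z t a)) borel \<Phi>)"
      unfolding c1.chain_Cons by (rule distr_bind[where K=borel]) auto
    also have "\<dots> = k t z \<bind> (\<lambda>a. c2.chain L (upd' (\<Phi> z) t (\<psi> t z a)))"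
      using Cons.prems cover
      by (intro bind_cong refl, subst Cons.IH[OF _ up]) (auto intro!: c2.chain_cong[of _ "{..t}"] c2.same_sym[OF upd'])
    also have "\<dots> = k' t (\<Phi> z) \<bind> (\<lambda>a. c2.chain L (upd' (\<Phi> z) t a))"
      unfolding k' using \<psi>
      by (intro bind_distr[symmetric, of _ _ borel _ borel]) (auto cong: measurable_cong_sets)
    finally show ?case by (simp only: c2.chain_Cons)
  qed
qed

section \<open>Lipschitz approximation\<close>

definition same_pts :: "'n set \<Rightarrow> ('n::finite) pts \<Rightarrow> 'n pts \<Rightarrow> bool" where
  "same_pts T x x' \<longleftrightarrow> (\<forall>s\<in>T. x $ s = x' $ s)"

definition same_pairs :: "'n set \<Rightarrow> ('n::finite) pts \<times> 'n pts \<Rightarrow> 'n pts \<times> 'n pts \<Rightarrow> bool" where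
  "same_pairs T z z' \<longleftrightarrow> same_pts T (fst z) (fst z') \<and> same_pts T (snd z) (snd z')"

lemma set_coord_nth[simp]: "set_coord x t v $ s = (if s = t then v else x $ s)"
  by (simp add: set_coord_def)

lemma set_coord_id[simp]: "set_coord x t (x $ t) = x"
  by (simp add: vec_eq_iff)

lemma continuous_on_set_coord[continuous_intros]:
  assumes "continuous_on S f" "continuous_on S g"
  shows "continuous_on S (\<lambda>x. set_coord (f x) t (g x))"
  unfolding set_coord_def
proof (rule continuous_on_vec_lambda)
  show "continuous_on S (\<lambda>x. if i = t then g x else f x $ i)" for i
    using assms by (cases "i = t") (auto intro!: continuous_intros)
qed

lemma set_coord_measurable[measurable]:
  assumes "f \<in> M \<rightarrow>\<^sub>M borel" "g \<in> M \<rightarrow>\<^sub>M borel"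
  shows "(\<lambda>x. set_coord (f x) t (g x)) \<in> M \<rightarrow>\<^sub>M borel"
proof -
  have "(\<lambda>z. set_coord (fst z) t (snd z)) \<in> borel \<Otimes>\<^sub>M borel \<rightarrow>\<^sub>M borel"
    unfolding borel_prod by (intro borel_measurable_continuous_onI continuous_intros)
  from measurable_compose[OF measurable_Pair[OF assms] this] show ?thesis by simp
qed

lemma vec_nth_measurable[measurable]: "(\<lambda>x::'n::finite pts. x $ i) \<in> borel_measurable borel"
  by (intro borel_measurable_continuous_onI continuous_intros)

lemma vec_lambda_measurable[measurable (raw)]:
  assumes "\<And>i. (\<lambda>x. f x i) \<in> borel_measurable M"
  shows "(\<lambda>x. \<chi> i. f x i) \<in> M \<rightarrow>\<^sub>M (borel :: ('n::finite) pts measure)"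
  using assms by (subst borel_measurable_euclidean_space) (auto simp: Basis_vec_def inner_axis)

lemma kernel_chain_pts: "kernels \<kappa> \<Longrightarrow> kernel_chain set_coord \<kappa> same_pts"
proof (unfold_locales, goal_cases)
  case (3 T z)
  then show ?case unfolding same_pts_def by measurable
qed (auto simp: kernels_def same_pts_def vec_eq_iff agree_before_def)

lemma kernel_chain_pairs: "pair_kernels g \<Longrightarrow> kernel_chain set_coords g same_pairs"
proof (unfold_locales, goal_cases)
  case (1 t)
  then show ?case
    unfolding set_coords_def split_beta borel_prod[symmetric] by measurable
next
  case (3 T z)
  then show ?case unfolding same_pairs_def same_pts_def borel_prod[symmetric] by measurable
next
  case (12 t z z')
  then show ?case
    unfolding pair_kernels_def same_pairs_def same_pts_def agree_before_def
    by (cases z; cases z') auto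
qed (auto simp: pair_kernels_def same_pairs_def same_pts_def vec_eq_iff set_coords_def prod_eq_iff)

text \<open>By induction over integrable functions. The substance is the indicator of a set: inner
  regularity replaces the set by a compact \<open>F\<close>, and
  \<open>max 0 (1 - real n * infdist x F)\<close> is Lipschitz with constant \<open>n\<close> and
  tends to the indicator of \<open>F\<close>.\<close>

lemma lipschitz_approx_L1:
  fixes h :: "'a::{second_countable_topology, complete_space} \<Rightarrow> real"
  assumes fin: "finite_measure M" and sets_M[simp, measurable_cong]: "sets M = sets borel"
    and h: "integrable M h" and e: "0 < e"
  shows "\<exists>g L. (\<forall>x y. \<bar>g x - g y\<bar> \<le> L * dist x y) \<and> integrable M g \<and> (\<integral>x. \<bar>h x - g x\<bar> \<partial>M) < e"
  using h e
proof (induction h arbitrary: e rule: integrable_induct)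
  case (base A c)
  interpret finite_measure M by (rule fin)
  have sp: "space M = UNIV" using sets_eq_imp_space_eq[OF sets_M] by simp
  show ?case
  proof (cases "c = 0")
    case True
    then show ?thesis using base by (intro exI[of _ "\<lambda>_. 0"] exI[of _ 0]) auto
  next
    case c: False
    \<comment> \<open>Two errors occur, \<open>A\<close> against \<open>F\<close> and
      \<open>F\<close> against \<open>g\<close>, each weighted by
      \<open>\<bar>c\<bar>\<close>.\<close>
    define e' where "e' = e / (2 * \<bar>c\<bar>)"
    have e': "0 < e'" using base c by (simp add: e'_def)
    \<comment> \<open>A negative lower bound would be truncated to 0 by \<open>ennreal\<close>, and
      a strict inequality could then fail; in that case the empty set does.\<close>
    obtain F where F: "F \<subseteq> A" "compact F" "measure M A - e' < measure M F"
    proof (cases "measure M A - e' < 0")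
      case True
      then show ?thesis using that[of "{}"] by simp
    next
      case False
      have A: "A \<in> sets borel" using base by simp
      have reg: "emeasure M A = (SUP K \<in> {K. K \<subseteq> A \<and> compact K}. emeasure M K)"
        by (rule inner_regular) (auto simp: A)
      have "ennreal (measure M A - e') < emeasure M A"
        using False e' by (simp add: emeasure_eq_measure ennreal_less_iff)
      then obtain K where "K \<subseteq> A" "compact K" "ennreal (measure M A - e') < emeasure M K"
        unfolding reg by (subst (asm) less_SUP_iff) blast
      then show ?thesis
        using False by (intro that[of K]) (auto simp: emeasure_eq_measure ennreal_less_iff)
    qed
    have [measurable]: "F \<in> sets borel" "A \<in> sets borel"
      using F base by (auto intro: borel_compact)
    have "\<exists>g L. (\<forall>x y. \<bar>g x - g y\<bar> \<le> L * dist x y) \<and> integrable M g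
        \<and> (\<integral>x. \<bar>indicator F x - g x\<bar> \<partial>M) < e'"
    proof (cases "F = {}")
      case True
      then show ?thesis using e' by (intro exI[of _ "\<lambda>_. 0"] exI[of _ 0]) auto
    next
      case ne: False
      define g where "g n x = max 0 (1 - real n * infdist x F)" for n x
      have lip: "\<bar>g n x - g n y\<bar> \<le> real n * dist x y" for n x y
      proof -
        have "\<bar>infdist x F - infdist y F\<bar> \<le> dist x y"
          using infdist_triangle[of x F y] infdist_triangle[of y F x] by (auto simp: dist_commute)
        then have "real n * \<bar>infdist x F - infdist y F\<bar> \<le> real n * dist x y"
          by (intro mult_left_mono) auto
        moreover have "\<bar>g n x - g n y\<bar> \<le> \<bar>real n * infdist x F - real n * infdist y F\<bar>"
          unfolding g_def by (auto simp: max_def)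
        ultimately show ?thesis by (simp add: abs_mult flip: right_diff_distrib)
      qed
      have [measurable]: "g n \<in> borel_measurable borel" for n
        unfolding g_def by (intro borel_measurable_continuous_onI continuous_intros)
      have bd: "\<bar>g n x\<bar> \<le> 1" for n x unfolding g_def by (auto simp: infdist_nonneg)
      have int: "integrable M (g n)" for n
        by (rule integrable_const_bound[of _ 1]) (auto simp: bd)
      have lim: "(\<lambda>n. \<bar>indicator F x - g n x\<bar>) \<longlonglongrightarrow> 0" for x
      proof (cases "x \<in> F")
        case True
        then show ?thesis by (simp add: g_def)
      next
        case False
        then have pos: "0 < infdist x F"
          using F ne compact_imp_closed[of F] by (simp add: infdist_pos_not_in_closed)
        obtain n0 where n0: "1 / infdist x F < real n0" using reals_Archimedean2 by blast
        have "g n x = 0" if "n \<ge> n0" for n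
        proof -
          have "1 / infdist x F \<le> real n" using n0 that by linarith
          then have "1 \<le> real n * infdist x F" using pos by (simp add: field_simps)
          then show ?thesis by (simp add: g_def)
        qed
        then show ?thesis
          using False by (intro tendsto_eventually) (auto simp: eventually_sequentially)
      qed
      have "(\<lambda>n. \<integral>x. \<bar>indicator F x - g n x\<bar> \<partial>M) \<longlonglongrightarrow> (\<integral>x. 0 \<partial>M)"
      proof (rule integral_dominated_convergence[where w="\<lambda>_. 2"])
        show "AE x in M. norm \<bar>indicator F x - g n x\<bar> \<le> 2" for n
        proof (rule AE_I2)
          fix x show "norm \<bar>indicator F x - g n x\<bar> \<le> 2"
            using bd[of n x] by (auto simp: indicator_def)
        qed
      qed (use lim in auto)
      then have "\<forall>\<^sub>F n in sequentially. (\<integral>x. \<bar>indicator F x - g n x\<bar> \<partial>M) < e'"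
        using e' by (intro order_tendstoD(2)) auto
      then obtain n where "(\<integral>x. \<bar>indicator F x - g n x\<bar> \<partial>M) < e'"
        by (auto simp: eventually_sequentially)
      then show ?thesis using lip[of n] int[of n] by blast
    qed
    then obtain g L where g: "\<And>x y. \<bar>g x - g y\<bar> \<le> L * dist x y" "integrable M g"
      "(\<integral>x. \<bar>indicator F x - g x\<bar> \<partial>M) < e'" by blast
    have "(\<integral>x. \<bar>indicator A x *\<^sub>R c - c * g x\<bar> \<partial>M)
        \<le> (\<integral>x. \<bar>c\<bar> * (indicator A x - indicator F x) + \<bar>c\<bar> * \<bar>indicator F x - g x\<bar> \<partial>M)"
    proof (rule integral_mono)
      fix x
      have "\<bar>indicator A x *\<^sub>R c - c * g x\<bar> = \<bar>c\<bar> * \<bar>indicator A x - g x\<bar>"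
        by (simp add: abs_mult[symmetric] algebra_simps)
      also have "\<dots> \<le> \<bar>c\<bar> * ((indicator A x - indicator F x) + \<bar>indicator F x - g x\<bar>)"
        using F by (intro mult_left_mono) (auto simp: indicator_def)
      finally show "\<bar>indicator A x *\<^sub>R c - c * g x\<bar>
          \<le> \<bar>c\<bar> * (indicator A x - indicator F x) + \<bar>c\<bar> * \<bar>indicator F x - g x\<bar>"
        by (simp add: algebra_simps)
    qed (use g in \<open>auto simp: less_top[symmetric]\<close>)
    also have "\<dots> = \<bar>c\<bar> * (measure M A - measure M F) + \<bar>c\<bar> * (\<integral>x. \<bar>indicator F x - g x\<bar> \<partial>M)"
    proof -
      have "integrable M (\<lambda>x. \<bar>indicator F x - g x\<bar>)" "integrable M (indicator A :: _ \<Rightarrow> real)"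
          "integrable M (indicator F :: _ \<Rightarrow> real)"
        using g by (auto simp: less_top[symmetric])
      then show ?thesis by (simp add: sp)
    qed
    also have "\<dots> < \<bar>c\<bar> * e' + \<bar>c\<bar> * e'"
      using c F g by (intro add_strict_mono mult_strict_left_mono) auto
    also have "\<dots> = e" using c by (simp add: e'_def)
    finally have "(\<integral>x. \<bar>indicator A x *\<^sub>R c - c * g x\<bar> \<partial>M) < e" .
    moreover have "\<bar>c * g x - c * g y\<bar> \<le> (\<bar>c\<bar> * L) * dist x y" for x y
      using mult_left_mono[OF g(1)[of x y], of "\<bar>c\<bar>"]
      by (simp add: abs_mult[symmetric] algebra_simps)
    ultimately show ?thesis using g(2) by (intro exI[of _ "\<lambda>x. c * g x"] exI[of _ "\<bar>c\<bar> * L"]) auto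
  qed
next
  case (add f1 f2)
  obtain g1 L1 where 1: "\<And>x y. \<bar>g1 x - g1 y\<bar> \<le> L1 * dist x y" "integrable M g1"
    "(\<integral>x. \<bar>f1 x - g1 x\<bar> \<partial>M) < e / 2" using add.IH(1)[of "e / 2"] add.prems by auto
  obtain g2 L2 where 2: "\<And>x y. \<bar>g2 x - g2 y\<bar> \<le> L2 * dist x y" "integrable M g2"
    "(\<integral>x. \<bar>f2 x - g2 x\<bar> \<partial>M) < e / 2" using add.IH(2)[of "e / 2"] add.prems by auto
  have "(\<integral>x. \<bar>f1 x + f2 x - (g1 x + g2 x)\<bar> \<partial>M) \<le> (\<integral>x. \<bar>f1 x - g1 x\<bar> + \<bar>f2 x - g2 x\<bar> \<partial>M)"
    using 1 2 add.hyps by (intro integral_mono) auto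
  also have "\<dots> < e" using 1 2 add.hyps by simp
  finally show ?case
    using 1 2 abs_triangle_ineq
    by (intro exI[of _ "\<lambda>x. g1 x + g2 x"] exI[of _ "L1 + L2"])
      (auto simp: algebra_simps intro: order_trans[OF _ add_mono[OF 1(1) 2(1)]])
next
  case (lim f s)
  \<comment> \<open>The induction rule supplies approximants bounded by
    \<open>2 * \<bar>f x\<bar>\<close>, hence the dominating function
    \<open>3 * \<bar>f x\<bar>\<close>.\<close>
  have "(\<lambda>n. \<integral>x. \<bar>f x - s n x\<bar> \<partial>M) \<longlonglongrightarrow> (\<integral>x. 0 \<partial>M)"
  proof (rule integral_dominated_convergence[where w="\<lambda>x. 3 * \<bar>f x\<bar>"])
    show "AE x in M. (\<lambda>n. \<bar>f x - s n x\<bar>) \<longlonglongrightarrow> 0"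
      using lim.hyps(2) by (intro AE_I2 tendsto_rabs_zero) (auto intro!: tendsto_eq_intros)
    show "AE x in M. norm \<bar>f x - s n x\<bar> \<le> 3 * \<bar>f x\<bar>" for n
      using lim.hyps(3)[of _ n] by (intro AE_I2) fastforce
  qed (use lim.hyps in auto)
  then have "\<forall>\<^sub>F n in sequentially. (\<integral>x. \<bar>f x - s n x\<bar> \<partial>M) < e / 2"
    using lim.prems by (intro order_tendstoD(2)) auto
  then obtain n where n: "(\<integral>x. \<bar>f x - s n x\<bar> \<partial>M) < e / 2"
    by (auto simp: eventually_sequentially)
  obtain g L where g: "\<And>x y. \<bar>g x - g y\<bar> \<le> L * dist x y" "integrable M g"
    "(\<integral>x. \<bar>s n x - g x\<bar> \<partial>M) < e / 2" using lim.IH[of "e / 2" n] lim.prems by auto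
  have "(\<integral>x. \<bar>f x - g x\<bar> \<partial>M) \<le> (\<integral>x. \<bar>f x - s n x\<bar> + \<bar>s n x - g x\<bar> \<partial>M)"
    using g lim.hyps by (intro integral_mono) auto
  also have "\<dots> < e" using g n lim.hyps by simp
  finally show ?case using g by blast
qed

text \<open>Convergence in mean gives almost sure convergence along a subsequence. Clamping to
  \<open>[-R, R]\<close> is 1-Lipschitz, so it keeps the constants, and it fixes the limit because
  \<open>\<bar>h x\<bar> \<le> R\<close>.\<close>

lemma lipschitz_approx_AE:
  fixes h :: "'a::{second_countable_topology, complete_space} \<Rightarrow> real"
  assumes fin: "finite_measure M" and sets[simp, measurable_cong]: "sets M = sets borel" and [measurable]: "h \<in> borel_measurable borel"
    and bd: "\<And>x. \<bar>h x\<bar> \<le> R"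
  obtains g :: "nat \<Rightarrow> 'a \<Rightarrow> real" and L :: "nat \<Rightarrow> real" where
    "\<And>n x y. \<bar>g n x - g n y\<bar> \<le> L n * dist x y" "\<And>n x. \<bar>g n x\<bar> \<le> R"
    "\<And>n. g n \<in> borel_measurable borel" "AE x in M. (\<lambda>n. g n x) \<longlonglongrightarrow> h x"
proof -
  interpret finite_measure M by (rule fin)
  have R: "0 \<le> R" using bd[of undefined] by linarith
  have h: "integrable M h"
    by (rule integrable_const_bound[of _ R]) (auto simp: bd)
  have "\<forall>n::nat. \<exists>g L. (\<forall>x y. \<bar>g x - g y\<bar> \<le> L * dist x y) \<and> integrable M g
      \<and> (\<integral>x. \<bar>h x - g x\<bar> \<partial>M) < 1 / Suc n"
    using lipschitz_approx_L1[OF fin sets h] by simp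
  then obtain g L where g: "\<And>n x y. \<bar>g n x - g n y\<bar> \<le> L n * dist x y" "\<And>n. integrable M (g n)"
      "\<And>n. (\<integral>x. \<bar>h x - g n x\<bar> \<partial>M) < 1 / Suc n"
    by metis
  have "(\<lambda>n. \<integral>x. norm (h x - g n x) \<partial>M) \<longlonglongrightarrow> 0"
  proof (rule tendsto_sandwich[OF _ _ tendsto_const LIMSEQ_Suc[OF lim_1_over_n]])
    show "\<forall>\<^sub>F n in sequentially. (\<integral>x. norm (h x - g n x) \<partial>M) \<le> 1 / real (Suc n)"
      using g(3) by (intro always_eventually) (auto intro: less_imp_le)
  qed auto
  then obtain r :: "nat \<Rightarrow> nat" where r: "AE x in M. (\<lambda>n. h x - g (r n) x) \<longlonglongrightarrow> 0"
    using tendsto_L1_AE_subseq[of M "\<lambda>n x. h x - g n x"] h g(2) by auto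
  define g' where "g' n x = max (- R) (min R (g (r n) x))" for n x
  show thesis
  proof (rule that[of g' "\<lambda>n. L (r n)"])
    show "\<bar>g' n x - g' n y\<bar> \<le> L (r n) * dist x y" for n x y
      using g(1)[of "r n" x y] by (auto simp: g'_def max_def min_def)
    show "\<bar>g' n x\<bar> \<le> R" for n x using R by (auto simp: g'_def)
    have "g n \<in> borel_measurable borel" for n
      using borel_measurable_integrable[OF g(2)] by (simp cong: measurable_cong_sets)
    then show "g' n \<in> borel_measurable borel" for n unfolding g'_def by measurable
    show "AE x in M. (\<lambda>n. g' n x) \<longlonglongrightarrow> h x"
      using r
    proof eventually_elim
      case (elim x)
      then have "(\<lambda>n. g (r n) x) \<longlonglongrightarrow> h x"
        using tendsto_diff[OF tendsto_const[of "h x"] elim] by simp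
      then have "(\<lambda>n. g' n x) \<longlonglongrightarrow> max (- R) (min R (h x))"
        unfolding g'_def by (intro tendsto_intros)
      also have "max (- R) (min R (h x)) = h x" using bd[of x] by auto
      finally show ?case .
    qed
  qed
qed

section \<open>Growth and continuity estimates\<close>

lemma powr_le_one_plus_powr:
  fixes t :: real
  assumes "0 \<le> t" "0 \<le> s" "s \<le> p"
  shows "t powr s \<le> 1 + t powr p"
proof (cases "t \<le> 1")
  case True
  then have "t powr s \<le> 1" using assms by (intro powr_le1) auto
  then show ?thesis by (simp add: add_increasing2)
next
  case False
  then have "t powr s \<le> t powr p" using assms by (intro powr_mono) auto
  then show ?thesis by simp
qed

lemma mult_le_powr_add_powr:
  fixes a b p q :: real
  assumes "p > 1" "q > 1" "1 / p + 1 / q = 1" "0 \<le> a" "0 \<le> b"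
  shows "a * b \<le> a powr p + b powr q"
proof -
  have "a * b \<le> a powr p / p + b powr q / q"
    using assms by (intro Youngs_inequality) auto
  also have "\<dots> \<le> a powr p / 1 + b powr q / 1"
    using assms by (intro add_mono divide_left_mono) auto
  finally show ?thesis by simp
qed

lemma pnorm_powr: "p > 0 \<Longrightarrow> pnorm p x powr p = (\<Sum>i\<in>UNIV. \<bar>x $ i\<bar> powr p)"
  unfolding pnorm_on_def by (simp add: powr_powr sum_nonneg)

lemma abs_nth_le_pnorm:
  fixes x :: "'n::finite pts"
  assumes "p > 0" shows "\<bar>x $ i\<bar> \<le> pnorm p x"
proof -
  have "\<bar>x $ i\<bar> powr p \<le> (\<Sum>i\<in>UNIV. \<bar>x $ i\<bar> powr p)"
    by (rule member_le_sum) auto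
  then have "(\<bar>x $ i\<bar> powr p) powr (1 / p) \<le> pnorm p x"
    unfolding pnorm_on_def using assms by (intro powr_mono2) auto
  then show ?thesis using assms by (simp add: powr_powr)
qed

lemma norm_le_card_pnorm:
  fixes x :: "'n::finite pts"
  assumes "p > 0" shows "norm x \<le> CARD('n) * pnorm p x"
proof -
  have "norm x \<le> (\<Sum>i\<in>UNIV. \<bar>x $ i\<bar>)" by (rule norm_le_l1_cart)
  also have "\<dots> \<le> (\<Sum>i\<in>(UNIV::'n set). pnorm p x)" using assms by (intro sum_mono abs_nth_le_pnorm)
  finally show ?thesis by simp
qed

lemma norm_powr_le_sum:
  fixes x :: "'n::finite pts"
  assumes "p > 0" shows "norm x powr p \<le> CARD('n) powr p * (\<Sum>i\<in>UNIV. \<bar>x $ i\<bar> powr p)"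
proof -
  have "norm x powr p \<le> (CARD('n) * pnorm p x) powr p"
    using assms norm_le_card_pnorm[OF assms, of x] by (intro powr_mono2) auto
  then show ?thesis
    using assms by (simp add: powr_mult pnorm_powr pnorm_on_def[of UNIV] powr_powr sum_nonneg)
qed

lemma pnorm_le_norm:
  fixes x :: "'n::finite pts"
  assumes "p > 0" shows "pnorm p x \<le> CARD('n) powr (1 / p) * norm x"
proof -
  have "(\<Sum>i\<in>UNIV. \<bar>x $ i\<bar> powr p) \<le> (\<Sum>i\<in>(UNIV::'n set). norm x powr p)"
    using assms by (intro sum_mono powr_mono2) (auto simp: component_le_norm_cart)
  then have "pnorm p x \<le> (CARD('n) * norm x powr p) powr (1 / p)"
    unfolding pnorm_on_def using assms by (intro powr_mono2) (auto intro: sum_nonneg)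
  then show ?thesis using assms by (simp add: powr_mult powr_powr)
qed

lemma compact_cube:
  assumes "compact K" shows "compact (cube K :: ('n::finite) pts set)"
proof -
  have "closed (cube K :: 'n pts set)"
  proof -
    have "cube K = (\<Inter>i. (\<lambda>a::'n pts. a $ i) -` K)" by (auto simp: cube_def)
    moreover have "closed ((\<lambda>a::'n pts. a $ i) -` K)" for i
      using compact_imp_closed[OF assms]
      by (intro continuous_closed_vimage) (auto intro!: continuous_intros)
    ultimately show ?thesis by auto
  qed
  moreover obtain B where B: "\<And>v. v \<in> K \<Longrightarrow> \<bar>v\<bar> \<le> B"
    using compact_imp_bounded[OF assms] by (auto simp: bounded_iff)
  have "bounded (cube K :: 'n pts set)"
    unfolding bounded_iff
  proof (intro exI ballI)
    fix a :: "'n pts" assume a: "a \<in> cube K"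
    have "norm a \<le> (\<Sum>i\<in>UNIV. \<bar>a $ i\<bar>)" by (rule norm_le_l1_cart)
    also have "\<dots> \<le> (\<Sum>i\<in>(UNIV::'n set). B)" using a B by (intro sum_mono) (auto simp: cube_def)
    finally show "norm a \<le> (\<Sum>i\<in>(UNIV::'n set). B)" .
  qed
  ultimately show ?thesis by (simp add: compact_eq_bounded_closed)
qed

text \<open>Meant for \<open>f\<close> and its gradient, whose continuity is available only on
  admissible controls.\<close>

lemma continuous_on_compose_measurable:
  fixes F :: "'a::topological_space \<Rightarrow> 'b::topological_space"
  assumes "continuous_on S F" "g \<in> M \<rightarrow>\<^sub>M borel" "\<And>z. z \<in> space M \<Longrightarrow> g z \<in> S"
  shows "(\<lambda>z. F (g z)) \<in> M \<rightarrow>\<^sub>M borel"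
proof -
  have "g \<in> M \<rightarrow>\<^sub>M restrict_space borel S"
    using assms by (intro measurable_restrict_space2) auto
  from measurable_compose[OF this borel_measurable_continuous_on_restrict[OF assms(1)]]
  show ?thesis .
qed

lemma gderiv_mean_value:
  fixes F :: "'a::real_inner \<Rightarrow> real"
  assumes "\<And>x. GDERIV F x :> D x"
  obtains \<xi> where "norm (\<xi> - x) \<le> norm (y - x)" "F y - F x = D \<xi> \<bullet> (y - x)"
    "norm \<xi> \<le> max (norm x) (norm y)"
proof -
  define \<phi> where "\<phi> s = F (x + s *\<^sub>R (y - x))" for s
  have "(\<phi> has_real_derivative D (x + s *\<^sub>R (y - x)) \<bullet> (y - x)) (at s)" for s
  proof -
    have "(F has_derivative (\<lambda>h. h \<bullet> D (x + s *\<^sub>R (y - x)))) (at (x + s *\<^sub>R (y - x)))"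
      using assms by (simp add: gderiv_def)
    moreover have "((\<lambda>s. x + s *\<^sub>R (y - x)) has_derivative (\<lambda>h. h *\<^sub>R (y - x))) (at s)"
      by (auto intro!: derivative_eq_intros)
    ultimately have "(\<phi> has_derivative (\<lambda>h. (h *\<^sub>R (y - x)) \<bullet> D (x + s *\<^sub>R (y - x)))) (at s)"
      unfolding \<phi>_def by (rule has_derivative_compose[rotated])
    then show ?thesis
      unfolding has_field_derivative_def by (simp add: inner_commute mult_commute_abs)
  qed
  then obtain s where s: "0 < s" "s < 1" "\<phi> 1 - \<phi> 0 = (1 - 0) * (D (x + s *\<^sub>R (y - x)) \<bullet> (y - x))"
    using MVT2[of 0 1 \<phi> "\<lambda>s. D (x + s *\<^sub>R (y - x)) \<bullet> (y - x)"] by auto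
  have "norm (x + s *\<^sub>R (y - x)) = norm ((1 - s) *\<^sub>R x + s *\<^sub>R y)" by (simp add: algebra_simps)
  also have "\<dots> \<le> (1 - s) * norm x + s * norm y"
    using s by (intro norm_triangle_le) auto
  also have "\<dots> \<le> (1 - s) * max (norm x) (norm y) + s * max (norm x) (norm y)"
    using s by (intro add_mono mult_left_mono) auto
  also have "\<dots> = max (norm x) (norm y)" by (simp add: algebra_simps)
  finally show thesis
    using s by (intro that[of "x + s *\<^sub>R (y - x)"]) (auto simp: \<phi>_def mult_left_le_one_le)
qed

text \<open>Subcritical growth, \<open>r * q < p\<close>, is what makes this uniform in
  \<open>x\<close>. On a large ball, small increments are handled by uniform continuity on a compact
  set. Far out, the growth bound is absorbed by \<open>\<epsilon> * (1 + norm x powr p)\<close>,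
  because the exponent \<open>s = r * q\<close> lies strictly below \<open>p\<close>. Increments
  that are not small are paid for by the term with factor \<open>L\<close>.\<close>

lemma growth_modulus:
  fixes D :: "'a::euclidean_space \<Rightarrow> 'b::metric_space \<Rightarrow> 'c::real_normed_vector"
  assumes A: "compact A" and cont: "continuous_on (UNIV \<times> A) (\<lambda>(x, a). D x a)"
    and growth: "\<And>x a. a \<in> A \<Longrightarrow> norm (D x a) \<le> B * (1 + norm x powr r)"
    and r: "0 < r" "r * q < p" and q: "q > 0" and \<epsilon>: "\<epsilon> > 0"
  obtains L where "L \<ge> 0" "\<And>x y a. a \<in> A \<Longrightarrow>
    norm (D y a - D x a) powr q \<le> \<epsilon> * (1 + norm x powr p) + L * norm (y - x) powr p"
proof (cases "A = {}")
  case True then show ?thesis by (intro that[of 0]) auto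
next
  case ne: False
  then obtain a0 where "a0 \<in> A" by auto
  then have B: "B \<ge> 0"
    using order_trans[OF norm_ge_zero growth[of a0 0]] r by simp
  define s where "s = r * q"
  have s: "0 < s" "s < p" using r q by (auto simp: s_def)
  define B' where "B' = (B * (3 + 2 powr r)) powr q"
  have B': "0 \<le> B'" by (simp add: B'_def)
  have step1: "norm (D y a - D x a) powr q \<le> B' * (1 + norm x powr s + norm (y - x) powr s)"
    if "a \<in> A" for x y a
  proof -
    define m where "m = max 1 (max (norm x) (norm (y - x)))"
    have m: "1 \<le> m" "norm x \<le> m" "norm (y - x) \<le> m" by (auto simp: m_def)
    have y: "norm y \<le> 2 * m" using norm_triangle_ineq[of x "y - x"] m by simp
    have "norm (D y a - D x a) \<le> B * (1 + norm y powr r) + B * (1 + norm x powr r)"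
      using growth[OF that, of x] growth[OF that, of y] norm_triangle_ineq4[of "D y a" "D x a"] by linarith
    also have "\<dots> \<le> B * (1 + (2 * m) powr r) + B * (1 + m powr r)"
      using B r m y by (intro add_mono mult_left_mono powr_mono2) auto
    also have "\<dots> = B * (2 + (1 + 2 powr r) * m powr r)"
      using m by (simp add: powr_mult algebra_simps)
    also have "\<dots> \<le> B * (3 + 2 powr r) * m powr r"
    proof -
      have "1 \<le> m powr r" using m r by (intro ge_one_powr_ge_zero) auto
      then have "B * (2 + (1 + 2 powr r) * m powr r) \<le> B * (2 * m powr r + (1 + 2 powr r) * m powr r)"
        using B by (intro mult_left_mono) auto
      then show ?thesis by (simp add: algebra_simps)
    qed
    finally have "norm (D y a - D x a) powr q \<le> (B * (3 + 2 powr r) * m powr r) powr q"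
      using q by (intro powr_mono2) auto
    also have "\<dots> = B' * m powr s"
      using B m by (simp add: powr_mult powr_powr s_def B'_def)
    also have "\<dots> \<le> B' * (1 + norm x powr s + norm (y - x) powr s)"
      using B' by (intro mult_left_mono) (auto simp: m_def max_def)
    finally show ?thesis .
  qed
  \<comment> \<open>For \<open>t \<ge> R\<close> this gives
    \<open>3 * B' * t powr s \<le> \<epsilon> * t powr p\<close>; the factor 3 covers
    \<open>2 + t powr s\<close>, as \<open>1 \<le> t powr s\<close>.\<close>
  define R where "R = max 1 ((3 * B' / \<epsilon>) powr (1 / (p - s)))"
  have R: "1 \<le> R" by (simp add: R_def)
  have step2: "B' * (2 + t powr s) \<le> \<epsilon> * (1 + t powr p)" if "R \<le> t" for t
  proof -
    have t: "1 \<le> t" using R that by simp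
    have "3 * B' / \<epsilon> = ((3 * B' / \<epsilon>) powr (1 / (p - s))) powr (p - s)"
      using s B' \<epsilon> by (simp add: powr_powr)
    also have "\<dots> \<le> t powr (p - s)"
      using that s by (intro powr_mono2) (auto simp: R_def)
    finally have "3 * B' \<le> \<epsilon> * t powr (p - s)" using \<epsilon> by (simp add: field_simps)
    then have "3 * B' * t powr s \<le> \<epsilon> * t powr (p - s) * t powr s"
      by (intro mult_right_mono) auto
    also have "\<dots> = \<epsilon> * t powr p" by (simp add: mult.assoc flip: powr_add)
    finally have 1: "3 * B' * t powr s \<le> \<epsilon> * t powr p" .
    have "1 \<le> t powr s" using t s by (intro ge_one_powr_ge_zero) auto
    then have "B' * (2 + t powr s) \<le> B' * (3 * t powr s)" using B' by (intro mult_left_mono) auto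
    then show ?thesis using 1 \<epsilon> by (simp add: algebra_simps)
  qed
  have "uniformly_continuous_on (cball 0 (R + 1) \<times> A) (\<lambda>(x, a). D x a)"
    by (intro compact_uniformly_continuous continuous_on_subset[OF cont] compact_Times A) auto
  moreover have "0 < \<epsilon> powr (1 / q)" using \<epsilon> by simp
  ultimately obtain d0 where d0: "0 < d0" and unif: "\<And>z z'. z \<in> cball 0 (R + 1) \<times> A \<Longrightarrow>
      z' \<in> cball 0 (R + 1) \<times> A \<Longrightarrow> dist z' z < d0 \<Longrightarrow>
      dist (case z' of (x, a) \<Rightarrow> D x a) (case z of (x, a) \<Rightarrow> D x a) < \<epsilon> powr (1 / q)"
    unfolding uniformly_continuous_on_def by meson
  define \<eta> where "\<eta> = min 1 d0"
  have \<eta>: "0 < \<eta>" "\<eta> \<le> 1" "\<eta> \<le> d0" using d0 by (auto simp: \<eta>_def)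
  \<comment> \<open>For \<open>norm x \<le> R\<close> and \<open>\<eta> \<le> d\<close> the ratio
    \<open>d / \<eta>\<close> is at least 1, so all lower powers can be raised to
    \<open>(d / \<eta>) powr p\<close>; this yields the constant. Since also
    \<open>B' \<le> L\<close>, it covers increments larger than 1 at far points.\<close>
  define L where "L = B' * (2 + R powr s) * (1 / \<eta>) powr p"
  have big: "1 \<le> (1 / \<eta>) powr p" using \<eta> s by (intro ge_one_powr_ge_zero) auto
  have "B' * 1 \<le> B' * ((2 + R powr s) * (1 / \<eta>) powr p)"
    using B' big mult_mono[of 1 "2 + R powr s" 1 "(1 / \<eta>) powr p"]
    by (intro mult_left_mono) (auto simp: add_increasing2)
  then have L: "B' \<le> L" by (simp add: L_def mult.assoc)
  show thesis
  proof (rule that[of L])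
    show "0 \<le> L" using L B' by simp
    fix x y :: 'a and a :: 'b assume a: "a \<in> A"
    define d where "d = norm (y - x)"
    have d: "0 \<le> d" by (simp add: d_def)
    consider "norm x \<le> R" "d < \<eta>" | "norm x \<le> R" "\<eta> \<le> d" | "R < norm x" "d \<le> 1" | "R < norm x" "1 < d"
      by linarith
    then show "norm (D y a - D x a) powr q \<le> \<epsilon> * (1 + norm x powr p) + L * norm (y - x) powr p"
    proof cases
      case 1
      have "norm y \<le> R + 1"
        using norm_triangle_ineq[of x "y - x"] 1 \<eta> by (simp add: d_def)
      moreover have "dist (y, a) (x, a) < d0"
        using 1 \<eta> by (simp add: dist_Pair_Pair d_def dist_norm)
      ultimately have "norm (D y a - D x a) < \<epsilon> powr (1 / q)"
        using unif[of "(x, a)" "(y, a)"] a 1 by (simp add: dist_norm)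
      then have "norm (D y a - D x a) powr q \<le> (\<epsilon> powr (1 / q)) powr q"
        using q by (intro powr_mono2) auto
      also have "\<dots> = \<epsilon>" using q \<epsilon> by (simp add: powr_powr)
      finally have "norm (D y a - D x a) powr q \<le> \<epsilon>" .
      moreover have "0 \<le> \<epsilon> * norm x powr p" "0 \<le> L * norm (y - x) powr p" using \<epsilon> L B' by auto
      ultimately show ?thesis by (simp add: algebra_simps)
    next
      case 2
      have d1: "1 \<le> d / \<eta>" using 2 \<eta> by simp
      have "norm x powr s \<le> R powr s" using 2 s by (intro powr_mono2) auto
      moreover have "d powr s \<le> (d / \<eta>) powr s"
        using d \<eta> s by (intro powr_mono2) (auto simp: pos_le_divide_eq mult_left_le)
      moreover have "(d / \<eta>) powr s \<le> (d / \<eta>) powr p" using d1 s by (intro powr_mono) auto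
      moreover have one: "1 \<le> (d / \<eta>) powr p" using d1 s by (intro ge_one_powr_ge_zero) auto
      moreover have "R powr s * 1 \<le> R powr s * (d / \<eta>) powr p" using one by (intro mult_left_mono) auto
      ultimately have "1 + norm x powr s + d powr s \<le> (2 + R powr s) * (d / \<eta>) powr p"
        by (simp add: algebra_simps)
      then have "B' * (1 + norm x powr s + d powr s) \<le> B' * ((2 + R powr s) * (d / \<eta>) powr p)"
        using B' by (rule mult_left_mono)
      also have "\<dots> = L * d powr p" using d \<eta> by (simp add: L_def powr_divide powr_mult)
      finally have "norm (D y a - D x a) powr q \<le> L * d powr p"
        using step1[OF a, of y x] by (simp add: d_def)
      then show ?thesis using \<epsilon> by (simp add: d_def add_increasing)
    next
      case 3
      have "d powr s \<le> 1" using 3 d s by (intro powr_le1) auto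
      then have "B' * (1 + norm x powr s + d powr s) \<le> B' * (2 + norm x powr s)"
        using B' by (intro mult_left_mono) auto
      also have "\<dots> \<le> \<epsilon> * (1 + norm x powr p)" using 3 by (intro step2) auto
      finally have "norm (D y a - D x a) powr q \<le> \<epsilon> * (1 + norm x powr p)"
        using step1[OF a, of y x] by (simp add: d_def)
      then show ?thesis using L B' by (simp add: add_increasing2)
    next
      case 4
      have "B' * (1 + norm x powr s) \<le> B' * (2 + norm x powr s)"
        using B' by (intro mult_left_mono) auto
      also have "\<dots> \<le> \<epsilon> * (1 + norm x powr p)" using 4 by (intro step2) auto
      finally have 1: "B' * (1 + norm x powr s) \<le> \<epsilon> * (1 + norm x powr p)" .
      have "d powr s \<le> d powr p" using 4 s by (intro powr_mono) auto
      then have "B' * d powr s \<le> L * d powr p" using B' L by (intro mult_mono) auto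
      then show ?thesis using 1 step1[OF a, of y x] by (simp add: d_def algebra_simps)
    qed
  qed
qed

text \<open>By the fundamental theorem of calculus along the segment from \<open>x0\<close> to
  \<open>x\<close>, \<open>f x a\<close> is \<open>f x0 a\<close> plus the integral of a jointly
  continuous integrand. Continuity in \<open>a\<close> is therefore needed at the single point
  \<open>x0\<close>.\<close>

lemma continuous_on_gderiv_parametric:
  fixes f :: "'a::real_inner \<Rightarrow> 'b::metric_space \<Rightarrow> real"
  assumes "\<And>x a. a \<in> A \<Longrightarrow> GDERIV (\<lambda>x. f x a) x :> D x a"
    and cont: "continuous_on (UNIV \<times> A) (\<lambda>(x, a). D x a)" and f0: "continuous_on A (f x0)"
  shows "continuous_on (UNIV \<times> A) (\<lambda>(x, a). f x a)"
proof -
  define G where "G z s = D (x0 + s *\<^sub>R (fst z - x0)) (snd z) \<bullet> (fst z - x0)" for z s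
  have G: "continuous_on ((UNIV \<times> A) \<times> cbox 0 1) (\<lambda>(z, s). G z s)"
  proof -
    have "continuous_on ((UNIV \<times> A) \<times> cbox 0 (1::real))
        (\<lambda>w. (\<lambda>(x, a). D x a) (x0 + snd w *\<^sub>R (fst (fst w) - x0), snd (fst w)))"
      by (rule continuous_on_compose2[OF cont]) (auto intro!: continuous_intros)
    then show ?thesis
      unfolding G_def split_beta by (intro continuous_intros) auto
  qed
  have int: "(G z has_integral f (fst z) (snd z) - f x0 (snd z)) (cbox 0 1)" if "z \<in> UNIV \<times> A" for z
  proof -
    have a: "snd z \<in> A" using that by auto
    define \<phi> where "\<phi> s = f (x0 + s *\<^sub>R (fst z - x0)) (snd z)" for s
    have "(\<phi> has_vector_derivative G z s) (at s within {0..1})" for s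
    proof -
      have "((\<lambda>x. f x (snd z)) has_derivative (\<lambda>h. h \<bullet> D (x0 + s *\<^sub>R (fst z - x0)) (snd z)))
          (at (x0 + s *\<^sub>R (fst z - x0)))"
        using assms(1)[OF a] by (simp add: gderiv_def)
      moreover have "((\<lambda>s. x0 + s *\<^sub>R (fst z - x0)) has_derivative (\<lambda>h. h *\<^sub>R (fst z - x0))) (at s within {0..1})"
        by (auto intro!: derivative_eq_intros)
      ultimately have "(\<phi> has_derivative
          (\<lambda>h. (h *\<^sub>R (fst z - x0)) \<bullet> D (x0 + s *\<^sub>R (fst z - x0)) (snd z))) (at s within {0..1})"
        unfolding \<phi>_def by (rule has_derivative_compose[rotated])
      then show ?thesis
        unfolding has_vector_derivative_def G_def by (simp add: inner_commute)
    qed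
    then have "(G z has_integral \<phi> 1 - \<phi> 0) {0..1}"
      by (intro fundamental_theorem_of_calculus) auto
    then show ?thesis by (simp add: \<phi>_def)
  qed
  have "continuous_on (UNIV \<times> A) (\<lambda>z. f x0 (snd z) + integral (cbox 0 1) (G z))"
    by (intro continuous_intros integral_continuous_on_param G continuous_on_compose2[OF f0]) auto
  then show ?thesis
    by (rule continuous_on_eq) (use integral_unique[OF int] in \<open>auto simp: split_beta\<close>)
qed

section \<open>The unperturbed problem\<close>

text \<open>By second countability the complement of the support is covered by countably many basic
  open null sets.\<close>

lemma AE_spt:
  fixes M :: "'a::second_countable_topology measure"
  assumes "sets M = sets borel"
  shows "AE x in M. x \<in> spt M"
proof -
  obtain B :: "'a set set" where B: "countable B" "topological_basis B"
    using ex_countable_basis by blast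
  define N where "N = {U \<in> B. emeasure M U = 0}"
  have null: "\<Union>N \<in> null_sets M"
  proof -
    have "U \<in> null_sets M" if "U \<in> N" for U
      using that topological_basis_open[OF B(2)] assms by (auto simp: N_def null_sets_def)
    moreover have "countable N" using B by (auto simp: N_def intro: countable_subset)
    ultimately show ?thesis using null_sets_UN'[of N "\<lambda>U. U" M] by simp
  qed
  moreover have "{x \<in> space M. x \<notin> spt M} \<subseteq> \<Union>N"
  proof
    fix x assume "x \<in> {x \<in> space M. x \<notin> spt M}"
    then obtain U where U: "open U" "x \<in> U" "emeasure M U = 0" by (auto simp: spt_def)
    obtain W where W: "W \<in> B" "x \<in> W" "W \<subseteq> U" using topological_basisE[OF B(2) U(1,2)] by blast
    have "emeasure M W \<le> emeasure M U" using W U assms by (intro emeasure_mono) auto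
    then show "x \<in> \<Union>N" using W U by (auto simp: N_def)
  qed
  ultimately show ?thesis by (rule AE_I')
qed

lemma summable_norm_diff_convergent:
  fixes u :: "nat \<Rightarrow> 'a::banach"
  assumes "summable (\<lambda>n. norm (u (Suc n) - u n))"
  shows "convergent u"
proof -
  have "convergent (\<lambda>n. \<Sum>k<n. u (Suc k) - u k)"
    using summable_norm_cancel[OF assms] by (simp add: summable_iff_convergent)
  then have "convergent (\<lambda>n. (u n - u 0) + u 0)"
    unfolding sum_lessThan_telescope by (intro convergent_add convergent_const)
  then show ?thesis by simp
qed

text \<open>Empty \<open>K\<close> is kept out: there would be no controls, and the real infimum
  \<open>v0\<close> would be meaningless. That case is settled separately in the final
  theorem.\<close>

locale robust_setting =
  fixes p q C e :: real
    and K :: "real set"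
    and \<mu> :: "('n::{finite,linorder}) pts measure"
    and \<kappa> :: "'n \<Rightarrow> 'n pts \<Rightarrow> real measure"
    and f :: "'n pts \<Rightarrow> 'n pts \<Rightarrow> real"
    and Df :: "'n pts \<Rightarrow> 'n pts \<Rightarrow> 'n pts"
    and eps :: "'n pts \<Rightarrow> real"
  assumes p_gt_1: "p > 1" and q_def: "q = p / (p - 1)"
    and compact_K: "compact K" and K_ne: "K \<noteq> {}"
    and \<mu>_moment: "\<mu> \<in> moment_probs p (pnorm p)"
    and \<mu>_disint: "disintegration \<mu> \<kappa>"
    and gderiv_f: "\<And>x a. a \<in> cube K \<Longrightarrow> GDERIV (\<lambda>x. f x a) x :> Df x a"
    and continuous_Df: "continuous_on (UNIV \<times> cube K) (\<lambda>(x, a). Df x a)"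
    and e_pos: "e > 0" and C_pos: "C > 0"
    and pnorm_Df_le: "\<And>x a. a \<in> cube K \<Longrightarrow> pnorm p (Df x a) \<le> C * (1 + pnorm p x powr (p - 1 - e))"
    and strongly_convex_f: "\<And>x. x \<in> spt \<mu> \<Longrightarrow> strongly_convex_on p (cube K) (f x) (eps x)"
    and eps_pos: "AE x in \<mu>. eps x > 0"

sublocale robust_setting \<subseteq> M: kernel_chain set_coord \<kappa> same_pts
  using \<mu>_disint by (intro kernel_chain_pts) (simp add: disintegration_def)

context robust_setting
begin

section \<open>Growth, continuity and Taylor estimates for the cost function\<close>

lemma q_gt_1: "q > 1" and pq: "1 / p + 1 / q = 1" and qp: "(q - 1) * p = q" and pq': "q * (p - 1) = p"
  using p_gt_1 by (auto simp: q_def field_simps)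

lemma \<mu>_law: "\<mu> = M.law UNIV 0"
  using \<mu>_disint by (simp add: disintegration_def M.law_def)

lemma sets_\<mu>[simp, measurable_cong]: "sets \<mu> = sets borel" and space_\<mu>[simp]: "space \<mu> = UNIV"
  and prob_\<mu>: "prob_space \<mu>"
  unfolding \<mu>_law by (auto intro: M.law_prob)

interpretation mu: prob_space \<mu> by (rule prob_\<mu>)

abbreviation "A \<equiv> cube K :: 'n pts set"

lemma compact_A: "compact A"
  using compact_K by (rule compact_cube)

lemma integrable_moment: "integrable \<mu> (\<lambda>x. norm x powr p)"
proof (rule Bochner_Integration.integrable_bound)
  show "integrable \<mu> (\<lambda>x. real CARD('n) powr p * pnorm p x powr p)"
    using \<mu>_moment by (auto simp: moment_probs_def)
  show "AE x in \<mu>. norm (norm x powr p) \<le> norm (real CARD('n) powr p * pnorm p x powr p)"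
    using p_gt_1 norm_powr_le_sum[of p "_ :: 'n pts"] pnorm_powr[of p "_ :: 'n pts"]
    by (intro AE_I2) (simp add: sum_nonneg)
  show "(\<lambda>x. norm x powr p) \<in> borel_measurable \<mu>" by measurable
qed

lemma spt_nonempty: obtains x0 where "x0 \<in> spt \<mu>"
  using AE_spt[OF sets_\<mu>] mu.AE_False by (metis (mono_tags, lifting) eventually_mono)

lemma convex_A: "convex A"
  by (rule spt_nonempty) (auto dest!: strongly_convex_f simp: strongly_convex_on_def)

text \<open>Strong convexity contains differentiability in the control, though only on the support.
  One support point is enough, since the continuous gradient in \<open>x\<close> carries continuity
  over to all other points.\<close>

lemma continuous_f: "continuous_on (UNIV \<times> A) (\<lambda>(x, a). f x a)"
proof -
  obtain x0 where x0: "x0 \<in> spt \<mu>" by (rule spt_nonempty)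
  have "continuous_on A (f x0)"
    unfolding continuous_on_eq_continuous_within
    using strongly_convex_f[OF x0] by (auto simp: strongly_convex_on_def dest!: bspec has_derivative_continuous)
  with continuous_Df show ?thesis
    by (rule continuous_on_gderiv_parametric[rotated]) (rule gderiv_f)
qed

lemma continuous_f2: "continuous_on A (f x)"
proof -
  have "continuous_on A (\<lambda>a. (\<lambda>(x, a). f x a) (x, a))"
    by (rule continuous_on_compose2[OF continuous_f]) (auto intro!: continuous_intros)
  then show ?thesis by simp
qed

lemma continuous_Df2: "continuous_on A (Df x)"
proof -
  have "continuous_on A (\<lambda>a. (\<lambda>(x, a). Df x a) (x, a))"
    by (rule continuous_on_compose2[OF continuous_Df]) (auto intro!: continuous_intros)
  then show ?thesis by simp
qed

lemma f_measurable[measurable (raw)]: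
  assumes "X \<in> M \<rightarrow>\<^sub>M borel" "\<alpha> \<in> M \<rightarrow>\<^sub>M borel" "\<And>z. \<alpha> z \<in> A"
  shows "(\<lambda>z. f (X z) (\<alpha> z)) \<in> borel_measurable M"
  using continuous_on_compose_measurable[OF continuous_f, of "\<lambda>z. (X z, \<alpha> z)"] assms by simp

lemma Df_measurable[measurable (raw)]:
  assumes "X \<in> M \<rightarrow>\<^sub>M borel" "\<alpha> \<in> M \<rightarrow>\<^sub>M borel" "\<And>z. \<alpha> z \<in> A"
  shows "(\<lambda>z. Df (X z) (\<alpha> z)) \<in> M \<rightarrow>\<^sub>M borel"
  using continuous_on_compose_measurable[OF continuous_Df, of "\<lambda>z. (X z, \<alpha> z)"] assms by simp

text \<open>Replaces the exponent \<open>p - 1 - e\<close>, which may be zero or negative, by some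
  \<open>r\<close> strictly between 0 and \<open>p - 1\<close>, and \<open>pnorm\<close> by the
  Euclidean norm. Near the origin, where a negative power is large, compactness provides the bound
  instead.\<close>

lemma Df_growth:
  obtains B r where "0 < r" "r < p - 1" "0 \<le> B"
    "\<And>x a. a \<in> A \<Longrightarrow> norm (Df x a) \<le> B * (1 + norm x powr r)"
proof -
  define r where "r = max ((p - 1) / 2) (p - 1 - e)"
  \<comment> \<open>Also the radius of the ball treated by compactness:
    \<open>norm x \<le> n * pnorm p x\<close>, so outside the ball \<open>pnorm p x\<close> exceeds
    1 and its powers increase with the exponent.\<close>
  define n where "n = real CARD('n)"
  have r: "0 < r" "r < p - 1" "p - 1 - e \<le> r" using p_gt_1 e_pos by (auto simp: r_def less_max_iff_disj)
  have "compact ((\<lambda>(x, a). Df x a) ` (cball 0 n \<times> A))"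
    by (intro compact_continuous_image continuous_on_subset[OF continuous_Df] compact_Times compact_A) auto
  then obtain B0 where B0: "\<And>x a. norm x \<le> n \<Longrightarrow> a \<in> A \<Longrightarrow> norm (Df x a) \<le> B0"
    by (force dest!: compact_imp_bounded simp: bounded_iff)
  define B1 where "B1 = n * (C * (1 + (n powr (1 / p)) powr r))"
  have B1: "0 \<le> B1" using C_pos by (simp add: B1_def n_def)
  show thesis
  proof (rule that[of r "max 0 B0 + B1"])
    fix x a :: "'n pts" assume a: "a \<in> A"
    have x0: "0 \<le> norm x powr r" by simp
    show "norm (Df x a) \<le> (max 0 B0 + B1) * (1 + norm x powr r)"
    proof (cases "norm x \<le> n")
      case True
      then have "norm (Df x a) \<le> max 0 B0" using B0[OF True a] by simp
      also have "\<dots> \<le> (max 0 B0 + B1) * (1 + norm x powr r)"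
        using B1 mult_mono[of "max 0 B0" "max 0 B0 + B1" 1 "1 + norm x powr r"] by simp
      finally show ?thesis .
    next
      case False
      have "norm x \<le> n * pnorm p x" using p_gt_1 norm_le_card_pnorm[of p x] by (simp add: n_def)
      then have "n * 1 < n * pnorm p x" using False by simp
      then have t: "1 \<le> pnorm p x" by (simp add: n_def)
      have "pnorm p x powr (p - 1 - e) \<le> pnorm p x powr r" using r t by (intro powr_mono) auto
      also have "\<dots> \<le> (n powr (1 / p) * norm x) powr r"
        using r t p_gt_1 pnorm_le_norm[of p x] by (intro powr_mono2) (auto simp: n_def)
      also have "\<dots> = (n powr (1 / p)) powr r * norm x powr r" by (simp add: powr_mult)
      finally have "1 + pnorm p x powr (p - 1 - e) \<le> 1 + (n powr (1 / p)) powr r * norm x powr r" by simp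
      also have "\<dots> \<le> (1 + (n powr (1 / p)) powr r) * (1 + norm x powr r)"
        by (simp add: algebra_simps)
      finally have "C * (1 + pnorm p x powr (p - 1 - e))
          \<le> C * ((1 + (n powr (1 / p)) powr r) * (1 + norm x powr r))"
        using C_pos by (intro mult_left_mono) auto
      then have "pnorm p (Df x a) \<le> C * ((1 + (n powr (1 / p)) powr r) * (1 + norm x powr r))"
        using pnorm_Df_le[OF a, of x] by linarith
      moreover have "norm (Df x a) \<le> n * pnorm p (Df x a)"
        using p_gt_1 norm_le_card_pnorm[of p "Df x a"] by (simp add: n_def)
      ultimately have "norm (Df x a) \<le> n * (C * ((1 + (n powr (1 / p)) powr r) * (1 + norm x powr r)))"
        by (smt (verit) mult_left_mono n_def of_nat_0_le_iff)
      also have "\<dots> = B1 * (1 + norm x powr r)" by (simp add: B1_def mult.assoc)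
      also have "\<dots> \<le> (max 0 B0 + B1) * (1 + norm x powr r)"
        by (intro mult_right_mono) (auto simp: add_nonneg_nonneg)
      finally show ?thesis .
    qed
  qed (use r B1 in auto)
qed

lemma Df_powr_growth:
  obtains B where "0 \<le> B" "\<And>x a. a \<in> A \<Longrightarrow> norm (Df x a) powr q \<le> B * (1 + norm x powr p)"
proof -
  obtain B r where r: "0 < r" "r < p - 1" "0 \<le> B"
    and B: "\<And>x a. a \<in> A \<Longrightarrow> norm (Df x a) \<le> B * (1 + norm x powr r)" using Df_growth by metis
  have rq: "r * q \<le> p" using mult_strict_left_mono[OF r(2), of q] q_gt_1 pq' by (simp add: mult.commute)
  show thesis
  proof (rule that[of "(2 * B) powr q"])
    fix x a :: "'n pts" assume a: "a \<in> A"
    define m where "m = max 1 (norm x)"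
    have m: "1 \<le> m" "norm x \<le> m" by (auto simp: m_def)
    have "1 + norm x powr r \<le> m powr r + m powr r"
      using m r by (intro add_mono ge_one_powr_ge_zero powr_mono2) auto
    then have "B * (1 + norm x powr r) \<le> B * (2 * m powr r)" using r by (intro mult_left_mono) auto
    then have "norm (Df x a) \<le> 2 * B * m powr r" using B[OF a, of x] by linarith
    then have "norm (Df x a) powr q \<le> (2 * B * m powr r) powr q"
      using q_gt_1 by (intro powr_mono2) auto
    also have "\<dots> = (2 * B) powr q * m powr (r * q)" using r m by (simp add: powr_mult powr_powr)
    also have "\<dots> \<le> (2 * B) powr q * m powr p" using m rq by (intro mult_left_mono powr_mono) auto
    also have "\<dots> \<le> (2 * B) powr q * (1 + norm x powr p)"
      by (intro mult_left_mono) (auto simp: m_def max_def)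
    finally show "norm (Df x a) powr q \<le> (2 * B) powr q * (1 + norm x powr p)" .
  qed simp
qed

lemma f_growth:
  obtains B where "0 \<le> B" "\<And>x a. a \<in> A \<Longrightarrow> \<bar>f x a\<bar> \<le> B * (1 + norm x powr p)"
proof -
  obtain B where B0: "0 \<le> B" and B: "\<And>x a. a \<in> A \<Longrightarrow> norm (Df x a) powr q \<le> B * (1 + norm x powr p)"
    using Df_powr_growth by metis
  have "compact (f 0 ` A)" by (intro compact_continuous_image continuous_f2 compact_A)
  then obtain c where c: "\<And>a. a \<in> A \<Longrightarrow> \<bar>f 0 a\<bar> \<le> c"
    by (force dest!: compact_imp_bounded simp: bounded_iff)
  show thesis
  proof (rule that[of "max 0 c + B + 1"])
    fix x a :: "'n pts" assume a: "a \<in> A"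
    obtain \<xi> where \<xi>: "norm (\<xi> - 0) \<le> norm (x - 0)" "f x a - f 0 a = Df \<xi> a \<bullet> (x - 0)"
      using gderiv_mean_value[of "\<lambda>x. f x a" "\<lambda>x. Df x a" 0 x] gderiv_f[OF a] by metis
    have "\<bar>f x a - f 0 a\<bar> \<le> norm (Df \<xi> a) * norm x"
      using \<xi> Cauchy_Schwarz_ineq2[of "Df \<xi> a" x] by simp
    also have "\<dots> \<le> norm (Df \<xi> a) powr q + norm x powr p"
      using p_gt_1 q_gt_1 pq by (intro mult_le_powr_add_powr) auto
    also have "\<dots> \<le> B * (1 + norm \<xi> powr p) + norm x powr p" using B[OF a, of \<xi>] by simp
    also have "\<dots> \<le> B * (1 + norm x powr p) + norm x powr p"
      using \<xi> p_gt_1 B0 by (intro add_mono mult_left_mono powr_mono2) auto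
    finally have "\<bar>f x a\<bar> \<le> max 0 c + (B * (1 + norm x powr p) + norm x powr p)"
      using c[OF a] by linarith
    also have "\<dots> \<le> (max 0 c + B + 1) * (1 + norm x powr p)"
      by (simp add: algebra_simps)
    finally show "\<bar>f x a\<bar> \<le> (max 0 c + B + 1) * (1 + norm x powr p)" .
  qed (use B0 in auto)
qed

text \<open>The remainder is split by Young's inequality with the increment measured in units of
  \<open>\<delta>\<close>, so that it only has to be integrated against couplings of cost at most \<open>\<delta>\<close>.\<close>

lemma taylor:
  assumes "0 < \<eta>"
  obtains \<delta>0 where "0 < \<delta>0" "\<And>\<delta> x y a. 0 < \<delta> \<Longrightarrow> \<delta> < \<delta>0 \<Longrightarrow> a \<in> A \<Longrightarrow>
    \<bar>f y a - f x a - Df x a \<bullet> (y - x)\<bar> \<le> \<delta> * \<eta> * (1 + norm x powr p + (norm (y - x) / \<delta>) powr p)"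
proof -
  obtain B r where r: "0 < r" "r < p - 1" "0 \<le> B"
    and B: "\<And>x a. a \<in> A \<Longrightarrow> norm (Df x a) \<le> B * (1 + norm x powr r)" using Df_growth by metis
  have rq: "r * q < p" using mult_strict_left_mono[OF r(2), of q] q_gt_1 pq' by (simp add: mult.commute)
  \<comment> \<open>The weight in Young's inequality. With \<open>l powr p = \<eta> / 2\<close> the
    increment takes half of the budget for \<open>(d / \<delta>) powr p\<close>; the other half is
    left for the term with \<open>L\<close>. The factor \<open>l powr q\<close> in
    \<open>\<epsilon>\<close> cancels the division by \<open>l powr q\<close> of the gradient
    term.\<close>
  define l where "l = (\<eta> / 2) powr (1 / p)"
  have l: "0 < l" "l powr p = \<eta> / 2" using assms p_gt_1 by (auto simp: l_def powr_powr)
  define \<epsilon> where "\<epsilon> = \<eta> * l powr q"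
  have \<epsilon>: "0 < \<epsilon>" using assms l by (simp add: \<epsilon>_def)
  obtain L where L: "0 \<le> L" and mod: "\<And>x y a. a \<in> A \<Longrightarrow>
      norm (Df y a - Df x a) powr q \<le> \<epsilon> * (1 + norm x powr p) + L * norm (y - x) powr p"
    using growth_modulus[OF compact_A continuous_Df B r(1) rq _ \<epsilon>] q_gt_1 by auto
  \<comment> \<open>Makes \<open>L * \<delta> powr p\<close> at most
    \<open>\<eta> / 2 * l powr q\<close> for smaller \<delta>, as \<open>L * d powr p\<close> turns
    into \<open>L * \<delta> powr p * (d / \<delta>) powr p\<close>. The summand 1 guards against
    \<open>L = 0\<close>.\<close>
  define \<delta>0 where "\<delta>0 = (\<eta> / 2 * l powr q / (L + 1)) powr (1 / p)"
  have \<delta>0: "0 < \<delta>0" "L * \<delta>0 powr p \<le> \<eta> / 2 * l powr q"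
  proof -
    show "0 < \<delta>0" using assms l L by (simp add: \<delta>0_def)
    have "\<delta>0 powr p = \<eta> / 2 * l powr q / (L + 1)"
      using assms l L p_gt_1 by (simp add: \<delta>0_def powr_powr)
    then have "L * \<delta>0 powr p = (L / (L + 1)) * (\<eta> / 2 * l powr q)" using L by (simp add: field_simps)
    also have "\<dots> \<le> 1 * (\<eta> / 2 * l powr q)"
      using L assms l by (intro mult_right_mono) (auto simp: field_simps)
    finally show "L * \<delta>0 powr p \<le> \<eta> / 2 * l powr q" by simp
  qed
  show thesis
  proof (rule that[OF \<delta>0(1)])
    fix \<delta> :: real and x y a :: "'n pts"
    assume \<delta>: "0 < \<delta>" "\<delta> < \<delta>0" and a: "a \<in> A"
    obtain \<xi> where \<xi>: "norm (\<xi> - x) \<le> norm (y - x)" "f y a - f x a = Df \<xi> a \<bullet> (y - x)"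
      using gderiv_mean_value[of "\<lambda>x. f x a" "\<lambda>x. Df x a" x y] gderiv_f[OF a] by metis
    define d where "d = norm (y - x)"
    define u where "u = norm (Df \<xi> a - Df x a)"
    have "\<bar>f y a - f x a - Df x a \<bullet> (y - x)\<bar> = \<bar>(Df \<xi> a - Df x a) \<bullet> (y - x)\<bar>"
      using \<xi> by (simp add: inner_diff_left)
    also have "\<dots> \<le> u * d" unfolding u_def d_def by (rule Cauchy_Schwarz_ineq2)
    also have "\<dots> = \<delta> * ((u / l) * (l * (d / \<delta>)))" using l \<delta> by simp
    also have "\<dots> \<le> \<delta> * ((u / l) powr q + (l * (d / \<delta>)) powr p)"
      using p_gt_1 q_gt_1 pq l \<delta> by (intro mult_left_mono mult_le_powr_add_powr) (auto simp: u_def d_def)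
    also have "\<dots> = \<delta> * (u powr q / l powr q + \<eta> / 2 * (d / \<delta>) powr p)"
      using l(1) \<delta> by (simp add: powr_divide powr_mult u_def d_def l(2))
    also have "\<dots> \<le> \<delta> * (\<eta> * (1 + norm x powr p) + \<eta> / 2 * (d / \<delta>) powr p + \<eta> / 2 * (d / \<delta>) powr p)"
    proof -
      have "L * d powr p = L * \<delta> powr p * (d / \<delta>) powr p"
        using \<delta> by (simp add: powr_divide d_def)
      also have "\<dots> \<le> (\<eta> / 2 * l powr q) * (d / \<delta>) powr p"
      proof (intro mult_right_mono order_trans[OF _ \<delta>0(2)] mult_left_mono L)
        show "\<delta> powr p \<le> \<delta>0 powr p" using \<delta> p_gt_1 by (intro powr_mono2) auto
      qed simp
      finally have Ld: "L * d powr p \<le> (\<eta> / 2 * l powr q) * (d / \<delta>) powr p" .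
      have "norm (\<xi> - x) powr p \<le> d powr p" using \<xi> p_gt_1 by (intro powr_mono2) (auto simp: d_def)
      then have "L * norm (\<xi> - x) powr p \<le> L * d powr p" using L by (intro mult_left_mono) auto
      then have "u powr q \<le> \<epsilon> * (1 + norm x powr p) + (\<eta> / 2 * l powr q) * (d / \<delta>) powr p"
        using mod[OF a, of \<xi> x] Ld by (simp add: u_def)
      then have "u powr q / l powr q
          \<le> (\<epsilon> * (1 + norm x powr p) + (\<eta> / 2 * l powr q) * (d / \<delta>) powr p) / l powr q"
        by (intro divide_right_mono) auto
      also have "\<dots> = \<eta> * (1 + norm x powr p) + \<eta> / 2 * (d / \<delta>) powr p"
        using l by (simp add: \<epsilon>_def add_divide_distrib)
      finally show ?thesis using \<delta> by (intro mult_left_mono) auto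
    qed
    also have "\<dots> = \<delta> * \<eta> * (1 + norm x powr p + (norm (y - x) / \<delta>) powr p)"
      by (simp add: d_def algebra_simps)
    finally show "\<bar>f y a - f x a - Df x a \<bullet> (y - x)\<bar>
        \<le> \<delta> * \<eta> * (1 + norm x powr p + (norm (y - x) / \<delta>) powr p)" .
  qed
qed

text \<open>The strong convexity inequalities based at the midpoint \<open>m\<close> are added for
  \<open>a\<close> and \<open>b\<close>; the linear terms cancel because
  \<open>b - m = - (a - m)\<close>. One quadratic term is dropped. The other satisfies
  \<open>pnorm p (a - m) \<ge> norm (a - b) / (2 * n)\<close> with \<open>n\<close> the dimension,
  whence the constant 8 and the squared dimension.\<close>

lemma midpoint_gap:
  "AE x in \<mu>. eps x > 0 \<and> (\<forall>a\<in>A. \<forall>b\<in>A.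
    eps x / (8 * (real CARD('n))\<^sup>2) * (norm (a - b))\<^sup>2 \<le> f x a + f x b - 2 * f x (midpoint a b))"
  using eps_pos AE_spt[OF sets_\<mu>]
proof eventually_elim
  case (elim x)
  define n where "n = real CARD('n)"
  have n: "n > 0" by (simp add: n_def)
  have "eps x / (8 * n\<^sup>2) * (norm (a - b))\<^sup>2 \<le> f x a + f x b - 2 * f x (midpoint a b)"
    if ab: "a \<in> A" "b \<in> A" for a b
  proof -
    define m where "m = midpoint a b"
    have m: "m \<in> A"
      using convexD[OF convex_A ab, of "1/2" "1/2"] by (simp add: m_def midpoint_def scaleR_add_right)
    obtain D where D: "\<And>b. b \<in> A \<Longrightarrow> f x b - f x m \<ge> D \<bullet> (b - m) + eps x / 2 * (pnorm p (b - m))\<^sup>2"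
      using strongly_convex_f[OF elim(2)] m unfolding strongly_convex_on_def by blast
    have am: "a - m = (1/2) *\<^sub>R (a - b)" and bm: "b - m = - (a - m)"
      by (auto simp: m_def midpoint_def algebra_simps scaleR_add_left[symmetric] simp flip: scaleR_2)
    have "norm (a - b) / (2 * n) \<le> pnorm p (a - m)"
    proof -
      have "norm (a - m) = norm (a - b) / 2" unfolding am by simp
      then have "norm (a - b) / 2 \<le> n * pnorm p (a - m)"
        using norm_le_card_pnorm[of p "a - m"] p_gt_1 by (simp add: n_def)
      then show ?thesis using n by (simp add: field_simps)
    qed
    then have "(norm (a - b) / (2 * n))\<^sup>2 \<le> (pnorm p (a - m))\<^sup>2"
      using n by (intro power_mono) auto
    then have "eps x / 2 * (norm (a - b) / (2 * n))\<^sup>2 \<le> eps x / 2 * (pnorm p (a - m))\<^sup>2"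
      using elim by (intro mult_left_mono) auto
    moreover have "D \<bullet> (b - m) = - (D \<bullet> (a - m))" unfolding bm by (rule inner_minus_right)
    moreover have "0 \<le> eps x / 2 * (pnorm p (b - m))\<^sup>2" using elim by simp
    ultimately have "eps x / 2 * (norm (a - b) / (2 * n))\<^sup>2 \<le> f x a + f x b - 2 * f x m"
      using D[OF ab(1)] D[OF ab(2)] by linarith
    then show ?thesis by (simp add: m_def power_divide power_mult_distrib field_simps)
  qed
  then show ?case using elim by (simp add: n_def)
qed

section \<open>Minimizing controls: existence and convergence\<close>

definition J :: "('n pts \<Rightarrow> 'n pts) \<Rightarrow> real" where
  "J \<alpha> = (\<integral>x. f x (\<alpha> x) \<partial>\<mu>)"

lemma controlsD:
  assumes "\<alpha> \<in> controls K"
  shows "\<alpha> \<in> borel_measurable borel" "\<alpha> x \<in> A"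
    "(\<And>s. s < t \<Longrightarrow> x $ s = x' $ s) \<Longrightarrow> \<alpha> x $ t = \<alpha> x' $ t"
  using assms by (auto simp: controls_def agree_before_def)

lemma const_control: obtains k where "k \<in> K" "(\<lambda>_. \<chi> i. k) \<in> (controls K :: ('n pts \<Rightarrow> 'n pts) set)"
proof -
  obtain k where "k \<in> K" using K_ne by auto
  then show thesis by (intro that[of k]) (auto simp: controls_def cube_def)
qed

lemma integrable_f_control:
  assumes "\<alpha> \<in> controls K" shows "integrable \<mu> (\<lambda>x. f x (\<alpha> x))"
proof -
  note [measurable] = controlsD(1)[OF assms] and controlsD(2)[OF assms, simp]
  obtain B where B: "0 \<le> B" "\<And>x a. a \<in> A \<Longrightarrow> \<bar>f x a\<bar> \<le> B * (1 + norm x powr p)" using f_growth by metis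
  show ?thesis
  proof (rule Bochner_Integration.integrable_bound)
    show "integrable \<mu> (\<lambda>x. B * (1 + norm x powr p))" using integrable_moment by auto
    show "AE x in \<mu>. norm (f x (\<alpha> x)) \<le> norm (B * (1 + norm x powr p))"
      using B by (intro AE_I2) (auto simp: abs_mult)
  qed measurable
qed

lemma midpoint_control:
  fixes \<alpha> :: "'n pts \<Rightarrow> 'n pts"
  assumes "\<alpha> \<in> controls K" "\<beta> \<in> controls K"
  shows "(\<lambda>x. midpoint (\<alpha> x) (\<beta> x)) \<in> controls K"
proof -
  note [measurable] = controlsD(1)[OF assms(1)] controlsD(1)[OF assms(2)]
  have "midpoint (\<alpha> x) (\<beta> x) \<in> A" for x
    using convexD[OF convex_A controlsD(2)[OF assms(1)] controlsD(2)[OF assms(2)], of "1/2" "1/2"]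
    by (simp add: midpoint_def scaleR_add_right)
  moreover have "(\<lambda>x. midpoint (\<alpha> x) (\<beta> x)) \<in> borel_measurable borel"
    unfolding midpoint_def by measurable
  moreover have "midpoint (\<alpha> x) (\<beta> x) $ t = midpoint (\<alpha> x') (\<beta> x') $ t"
    if "agree_before t x x'" for t x x'
  proof -
    have "\<alpha> x $ t = \<alpha> x' $ t" "\<beta> x $ t = \<beta> x' $ t"
      using that assms by (auto simp: controls_def)
    then show ?thesis by (simp add: midpoint_def)
  qed
  ultimately show ?thesis
    unfolding controls_def by blast
qed

definition v0 :: real where "v0 = (INF \<alpha>\<in>controls K. J \<alpha>)"

lemma J_bdd_below: "bdd_below (J ` controls K)"
proof -
  obtain B where B: "0 \<le> B" "\<And>x a. a \<in> A \<Longrightarrow> \<bar>f x a\<bar> \<le> B * (1 + norm x powr p)" using f_growth by metis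
  have "- (\<integral>x. B * (1 + norm x powr p) \<partial>\<mu>) \<le> J \<alpha>" if \<alpha>: "\<alpha> \<in> controls K" for \<alpha>
    unfolding J_def Bochner_Integration.integral_minus[symmetric]
  proof (rule integral_mono[OF _ integrable_f_control[OF \<alpha>]])
    show "- (B * (1 + norm x powr p)) \<le> f x (\<alpha> x)" for x
      using B(2)[OF controlsD(2)[OF \<alpha>, of x], of x] by linarith
  qed (use integrable_moment in auto)
  then show ?thesis by (auto simp: bdd_below_def)
qed

lemma v0_le: "\<alpha> \<in> controls K \<Longrightarrow> v0 \<le> J \<alpha>"
  unfolding v0_def by (rule cINF_lower[OF J_bdd_below])

lemma v0_approx: assumes "0 < \<eta>" obtains \<alpha> where "\<alpha> \<in> controls K" "J \<alpha> < v0 + \<eta>"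
proof -
  have "\<exists>\<alpha>\<in>controls K. J \<alpha> < v0 + \<eta>"
  proof (rule ccontr)
    assume "\<not> ?thesis"
    moreover have "controls K \<noteq> ({} :: ('n pts \<Rightarrow> 'n pts) set)" by (rule const_control) blast
    ultimately have "v0 + \<eta> \<le> v0"
      unfolding v0_def[symmetric] by (subst (2) v0_def) (intro cINF_greatest, auto simp: not_less)
    then show False using assms by simp
  qed
  then show thesis using that by blast
qed

lemma V_zero_eq: "V_zero \<mu> f K = ereal v0"
proof -
  have "V_zero \<mu> f K = (INF \<alpha>\<in>controls K. ereal (J \<alpha>))" by (simp add: V_zero_def J_def)
  also have "\<dots> = ereal v0"
  proof (rule antisym)
    show "(INF \<alpha>\<in>controls K. ereal (J \<alpha>)) \<le> ereal v0"
    proof (rule ereal_le_epsilon2)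
      fix \<eta> :: real assume "0 < \<eta>"
      then obtain \<alpha> where "\<alpha> \<in> controls K" "J \<alpha> < v0 + \<eta>" by (rule v0_approx)
      then show "(INF \<alpha>\<in>controls K. ereal (J \<alpha>)) \<le> ereal v0 + ereal \<eta>"
        by (intro INF_lower2[of \<alpha>]) auto
    qed
  qed (auto intro!: INF_greatest v0_le)
  finally show ?thesis .
qed

lemma optimal_iff: "\<alpha> \<in> optimal_controls \<mu> f K \<longleftrightarrow> \<alpha> \<in> controls K \<and> J \<alpha> = v0"
proof
  assume "\<alpha> \<in> optimal_controls \<mu> f K"
  then have \<alpha>: "\<alpha> \<in> controls K" "\<And>\<beta>. \<beta> \<in> controls K \<Longrightarrow> J \<alpha> \<le> J \<beta>"
    by (auto simp: optimal_controls_def is_arg_min_def J_def not_less)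
  have "J \<alpha> \<le> v0" unfolding v0_def using \<alpha>(1) by (intro cINF_greatest \<alpha>(2)) blast
  then show "\<alpha> \<in> controls K \<and> J \<alpha> = v0" using \<alpha> v0_le[of \<alpha>] by auto
next
  assume "\<alpha> \<in> controls K \<and> J \<alpha> = v0"
  then show "\<alpha> \<in> optimal_controls \<mu> f K"
    using v0_le unfolding optimal_controls_def is_arg_min_def J_def[symmetric]
    by (simp add: not_less)
qed

text \<open>Twice the convexity defect at the midpoint. Pointwise it dominates the squared distance
  of the two controls up to a factor depending on \<open>x\<close>, while its integral is at most
  the sum of their excess costs, the midpoint being again a control.\<close>

definition gap :: "('n pts \<Rightarrow> 'n pts) \<Rightarrow> ('n pts \<Rightarrow> 'n pts) \<Rightarrow> 'n pts \<Rightarrow> real" where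
  "gap \<alpha> \<beta> x = f x (\<alpha> x) + f x (\<beta> x) - 2 * f x (midpoint (\<alpha> x) (\<beta> x))"

lemma
  assumes "\<alpha> \<in> controls K" "\<beta> \<in> controls K"
  shows integrable_gap: "integrable \<mu> (gap \<alpha> \<beta>)"
    and integral_gap_le: "(\<integral>x. gap \<alpha> \<beta> x \<partial>\<mu>) \<le> (J \<alpha> - v0) + (J \<beta> - v0)"
    and gap_nonneg: "AE x in \<mu>. 0 \<le> gap \<alpha> \<beta> x"
proof -
  note i = integrable_f_control[OF assms(1)] integrable_f_control[OF assms(2)]
    integrable_f_control[OF midpoint_control[OF assms]]
  show "integrable \<mu> (gap \<alpha> \<beta>)" unfolding gap_def[abs_def] using i by auto
  have "(\<integral>x. gap \<alpha> \<beta> x \<partial>\<mu>) = J \<alpha> + J \<beta> - 2 * J (\<lambda>x. midpoint (\<alpha> x) (\<beta> x))"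
    unfolding gap_def J_def using i by simp
  then show "(\<integral>x. gap \<alpha> \<beta> x \<partial>\<mu>) \<le> (J \<alpha> - v0) + (J \<beta> - v0)"
    using v0_le[OF midpoint_control[OF assms]] by simp
  show "AE x in \<mu>. 0 \<le> gap \<alpha> \<beta> x"
    using midpoint_gap
  proof eventually_elim
    case (elim x)
    then have "0 \<le> eps x / (8 * (real CARD('n))\<^sup>2) * (norm (\<alpha> x - \<beta> x))\<^sup>2" by simp
    also have "\<dots> \<le> gap \<alpha> \<beta> x"
      using elim controlsD(2)[OF assms(1)] controlsD(2)[OF assms(2)] by (auto simp: gap_def)
    finally show ?case .
  qed
qed

text \<open>The exceptional null set and the factor \<open>c\<close> do not depend on the controls,
  because \<open>midpoint_gap\<close> quantifies over points of the cube. So it may be applied to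
  whole sequences of controls at once.\<close>

lemma norm_le_sqrt_gap:
  "AE x in \<mu>. \<exists>c. \<forall>\<alpha>\<in>controls K. \<forall>\<beta>\<in>controls K. norm (\<alpha> x - \<beta> x) \<le> c * sqrt (gap \<alpha> \<beta> x)"
  using midpoint_gap
proof eventually_elim
  case (elim x)
  define c where "c = eps x / (8 * (real CARD('n))\<^sup>2)"
  have c: "0 < c" using elim by (simp add: c_def)
  have "norm (\<alpha> x - \<beta> x) \<le> 1 / sqrt c * sqrt (gap \<alpha> \<beta> x)"
    if "\<alpha> \<in> controls K" "\<beta> \<in> controls K" for \<alpha> \<beta>
  proof -
    have "c * (norm (\<alpha> x - \<beta> x))\<^sup>2 \<le> gap \<alpha> \<beta> x"
      using elim that controlsD(2) unfolding gap_def c_def by blast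
    then have "sqrt (c * (norm (\<alpha> x - \<beta> x))\<^sup>2) \<le> sqrt (gap \<alpha> \<beta> x)" by simp
    then show ?thesis using c by (simp add: real_sqrt_mult field_simps)
  qed
  then show ?case by blast
qed

lemma J_tendsto:
  assumes "\<And>n. \<beta> n \<in> controls K" "\<alpha> \<in> controls K" "AE x in \<mu>. (\<lambda>n. \<beta> n x) \<longlonglongrightarrow> \<alpha> x"
  shows "(\<lambda>n. J (\<beta> n)) \<longlonglongrightarrow> J \<alpha>"
proof -
  note m[measurable] = controlsD(1)[OF assms(1)] controlsD(1)[OF assms(2)]
  note s[simp] = controlsD(2)[OF assms(1)] controlsD(2)[OF assms(2)]
  obtain B where B: "0 \<le> B" "\<And>x a. a \<in> A \<Longrightarrow> \<bar>f x a\<bar> \<le> B * (1 + norm x powr p)" using f_growth by metis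
  show ?thesis
    unfolding J_def
  proof (rule integral_dominated_convergence[where w="\<lambda>x. B * (1 + norm x powr p)"])
    show "AE x in \<mu>. (\<lambda>n. f x (\<beta> n x)) \<longlonglongrightarrow> f x (\<alpha> x)"
      using assms(3)
    proof eventually_elim
      case (elim x)
      show ?case by (rule continuous_on_tendsto_compose[OF continuous_f2 elim]) auto
    qed
  qed (use integrable_moment B in auto)
qed

text \<open>The excess cost bounds the integral of the gap to \<alpha>, so the gap tends to 0 in
  mean, and almost surely along a subsequence. It then controls the distance pointwise; as the
  factor varies with \<open>x\<close>, no rate results.\<close>

lemma minimizing_subseq:
  assumes \<beta>: "\<And>n. \<beta> n \<in> controls K" and \<alpha>: "\<alpha> \<in> optimal_controls \<mu> f K" and lim: "(\<lambda>n. J (\<beta> n)) \<longlonglongrightarrow> v0"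
  obtains r :: "nat \<Rightarrow> nat" where "strict_mono r" "AE x in \<mu>. (\<lambda>n. \<beta> (r n) x) \<longlonglongrightarrow> \<alpha> x"
proof -
  have \<alpha>': "\<alpha> \<in> controls K" "J \<alpha> = v0" using \<alpha> by (auto simp: optimal_iff)
  have "(\<lambda>n. \<integral>x. norm (gap (\<beta> n) \<alpha> x) \<partial>\<mu>) \<longlonglongrightarrow> 0"
  proof (rule tendsto_sandwich[OF _ _ tendsto_const])
    have "(\<integral>x. norm (gap (\<beta> n) \<alpha> x) \<partial>\<mu>) = (\<integral>x. gap (\<beta> n) \<alpha> x \<partial>\<mu>)" for n
    proof (rule integral_cong_AE)
      show "AE x in \<mu>. norm (gap (\<beta> n) \<alpha> x) = gap (\<beta> n) \<alpha> x"
        using gap_nonneg[OF \<beta> \<alpha>'(1), of n] by eventually_elim simp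
    qed (use borel_measurable_integrable[OF integrable_gap[OF \<beta> \<alpha>'(1)]] in auto)
    then show "\<forall>\<^sub>F n in sequentially. (\<integral>x. norm (gap (\<beta> n) \<alpha> x) \<partial>\<mu>) \<le> J (\<beta> n) - v0"
      using integral_gap_le[OF \<beta> \<alpha>'(1)] \<alpha>'(2) by simp
    show "(\<lambda>n. J (\<beta> n) - v0) \<longlonglongrightarrow> 0" using tendsto_diff[OF lim tendsto_const[of v0]] by simp
  qed simp
  from tendsto_L1_AE_subseq[OF integrable_gap[OF \<beta> \<alpha>'(1)] this]
  obtain r where r: "strict_mono r" "AE x in \<mu>. (\<lambda>n. gap (\<beta> (r n)) \<alpha> x) \<longlonglongrightarrow> 0" by auto
  have "AE x in \<mu>. (\<lambda>n. \<beta> (r n) x) \<longlonglongrightarrow> \<alpha> x"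
    using r(2) norm_le_sqrt_gap
  proof eventually_elim
    case (elim x)
    from elim(2) obtain c where "\<forall>\<alpha>\<in>controls K. \<forall>\<beta>\<in>controls K.
        norm (\<alpha> x - \<beta> x) \<le> c * sqrt (gap \<alpha> \<beta> x)" ..
    then have c: "norm (\<beta> (r n) x - \<alpha> x) \<le> c * sqrt (gap (\<beta> (r n)) \<alpha> x)" for n
      using \<beta>[of "r n"] \<alpha>'(1) by simp
    have lim: "(\<lambda>n. c * sqrt (gap (\<beta> (r n)) \<alpha> x)) \<longlonglongrightarrow> c * sqrt 0"
      by (rule tendsto_mult[OF tendsto_const tendsto_real_sqrt[OF elim(1)]])
    have "(\<lambda>n. \<beta> (r n) x - \<alpha> x) \<longlonglongrightarrow> 0"
    proof (rule Lim_null_comparison)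
      show "\<forall>\<^sub>F n in sequentially. norm (\<beta> (r n) x - \<alpha> x) \<le> c * sqrt (gap (\<beta> (r n)) \<alpha> x)"
        by (rule always_eventually) (rule allI, rule c)
      show "(\<lambda>n. c * sqrt (gap (\<beta> (r n)) \<alpha> x)) \<longlonglongrightarrow> 0" using lim by simp
    qed
    then show ?case by (rule LIM_zero_cancel)
  qed
  with r(1) show thesis by (rule that)
qed

text \<open>A Cauchy argument instead of compactness. With excess costs below
  \<open>(1/4)^n\<close>, the gap \<open>h n\<close> of consecutive controls has integral at most
  \<open>2 * (1/4)^n\<close>, so even the sum of \<open>2^n * h n\<close> is finite almost surely.
  By the inequality of means, \<open>sqrt (h n x) \<le> (1/2)^n + 2^n * h n x\<close>, hence the
  increments of the sequence are summable at almost every point.\<close>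

lemma optimal_exists: obtains \<alpha> where "\<alpha> \<in> optimal_controls \<mu> f K"
proof -
  have "\<exists>\<beta>. \<forall>n::nat. \<beta> n \<in> controls K \<and> J (\<beta> n) < v0 + (1/4)^n"
    by (intro choice allI) (metis v0_approx zero_less_power zero_less_divide_1_iff zero_less_numeral)
  then obtain \<beta> where \<beta>: "\<And>n. \<beta> n \<in> controls K" and J\<beta>: "\<And>n. J (\<beta> n) < v0 + (1/4)^n" by auto
  note [measurable] = controlsD(1)[OF \<beta>]
  define h where "h n x = gap (\<beta> (Suc n)) (\<beta> n) x" for n x
  have h: "integrable \<mu> (h n)" "AE x in \<mu>. 0 \<le> h n x" for n
    unfolding h_def using integrable_gap[OF \<beta> \<beta>] gap_nonneg[OF \<beta> \<beta>] by auto
  have hi: "(\<integral>x. h n x \<partial>\<mu>) \<le> 2 * (1/4)^n" for n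
  proof -
    have "0 \<le> (1/4::real)^n" "(1/4::real)^Suc n = (1/4)^n / 4" by simp_all
    with integral_gap_le[OF \<beta> \<beta>, of "Suc n" n] J\<beta>[of n] J\<beta>[of "Suc n"] show ?thesis
      unfolding h_def by linarith
  qed
  have "(\<integral>\<^sup>+x. (\<Sum>n. ennreal (2^n * h n x)) \<partial>\<mu>) = (\<Sum>n. \<integral>\<^sup>+x. ennreal (2^n * h n x) \<partial>\<mu>)"
    using h by (intro nn_integral_suminf) auto
  also have "\<dots> \<le> (\<Sum>n. ennreal (2 * (1/2)^n))"
  proof (intro suminf_le allI summableI)
    fix n :: nat
    have "(\<integral>\<^sup>+x. ennreal (2^n * h n x) \<partial>\<mu>) = ennreal (\<integral>x. 2^n * h n x \<partial>\<mu>)"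
    proof (rule nn_integral_eq_integral)
      show "AE x in \<mu>. 0 \<le> 2^n * h n x" using h(2)[of n] by eventually_elim simp
    qed (use h in auto)
    also have "\<dots> \<le> ennreal (2 * (1/2)^n)"
    proof (intro ennreal_leI)
      have "(\<integral>x. 2^n * h n x \<partial>\<mu>) \<le> 2^n * (2 * (1/4)^n)"
        using hi[of n] by simp
      also have "\<dots> = 2 * (2 * (1/4))^n" by (simp only: power_mult_distrib mult.left_commute)
      also have "\<dots> = 2 * (1/2)^n" by simp
      finally show "(\<integral>x. 2^n * h n x \<partial>\<mu>) \<le> 2 * (1/2)^n" .
    qed
    finally show "(\<integral>\<^sup>+x. ennreal (2^n * h n x) \<partial>\<mu>) \<le> ennreal (2 * (1/2)^n)" .
  qed
  also have "\<dots> < \<infinity>"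
    by (subst suminf_ennreal2) (auto intro!: summable_mult summable_geometric)
  finally have "(\<integral>\<^sup>+x. (\<Sum>n. ennreal (2^n * h n x)) \<partial>\<mu>) \<noteq> \<infinity>" by simp
  then have "AE x in \<mu>. (\<Sum>n. ennreal (2^n * h n x)) \<noteq> \<infinity>"
    using h by (intro nn_integral_PInf_AE) auto
  moreover have "AE x in \<mu>. \<forall>n. 0 \<le> h n x" using h(2) by (simp add: AE_all_countable)
  ultimately have conv: "AE x in \<mu>. convergent (\<lambda>n. \<beta> n x)"
    using norm_le_sqrt_gap
  proof eventually_elim
    case (elim x)
    have sm: "summable (\<lambda>n. 2^n * h n x)"
      using elim by (intro summable_suminf_not_top) auto
    from elim(3) obtain c where "\<forall>\<alpha>\<in>controls K. \<forall>\<beta>\<in>controls K.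
        norm (\<alpha> x - \<beta> x) \<le> c * sqrt (gap \<alpha> \<beta> x)" ..
    then have c: "norm (\<beta> (Suc n) x - \<beta> n x) \<le> c * sqrt (h n x)" for n
      using \<beta>[of "Suc n"] \<beta>[of n] unfolding h_def by simp
    have "sqrt (h n x) \<le> (1/2)^n + 2^n * h n x" for n
    proof -
      have "sqrt (h n x) = sqrt ((1/2)^n * (2^n * h n x))"
        by (simp flip: power_mult_distrib mult.assoc)
      also have "\<dots> \<le> ((1/2)^n + 2^n * h n x) / 2"
        using elim(2) by (intro arith_geo_mean_sqrt) auto
      also have "\<dots> \<le> (1/2)^n + 2^n * h n x" using elim(2) by simp
      finally show ?thesis .
    qed
    moreover have "summable (\<lambda>n. (1/2)^n + 2^n * h n x)"
      by (rule summable_add[OF summable_geometric sm]) simp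
    ultimately have "summable (\<lambda>n. sqrt (h n x))"
      using elim(2) by (intro summable_comparison_test'[where N=0 and f="\<lambda>n. sqrt (h n x)"]) auto
    then have "summable (\<lambda>n. c * sqrt (h n x))" by (rule summable_mult)
    then have "summable (\<lambda>n. norm (\<beta> (Suc n) x - \<beta> n x))"
      by (rule summable_comparison_test'[where N=0]) (simp add: c)
    then show ?case by (rule summable_norm_diff_convergent)
  qed
  obtain k where k: "k \<in> K" by (rule const_control)
  \<comment> \<open>Limits are taken per coordinate and without reference to the exceptional null
    set, so \<alpha> is predictable at every point: where the sequences agree, so do the values of
    \<open>lim\<close>, even the unspecified ones. The default \<open>k\<close> keeps the values in
    \<open>K\<close>.\<close>
  define \<alpha> :: "'n pts \<Rightarrow> 'n pts" where
    "\<alpha> x = (\<chi> t. if lim (\<lambda>n. \<beta> n x $ t) \<in> K then lim (\<lambda>n. \<beta> n x $ t) else k)" for x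
  have "\<alpha> \<in> controls K"
    unfolding controls_def
  proof (intro CollectI conjI allI impI)
    have [measurable]: "K \<in> sets borel" using compact_K by (rule borel_compact)
    show "\<alpha> \<in> borel_measurable borel" unfolding \<alpha>_def by measurable
    show "\<alpha> x \<in> A" for x using k by (auto simp: \<alpha>_def cube_def)
    fix t :: 'n and x x' :: "'n pts" assume "agree_before t x x'"
    then have "\<beta> n x $ t = \<beta> n x' $ t" for n
      using \<beta>[of n] unfolding controls_def by blast
    then show "\<alpha> x $ t = \<alpha> x' $ t" by (simp add: \<alpha>_def)
  qed
  moreover have "AE x in \<mu>. (\<lambda>n. \<beta> n x) \<longlonglongrightarrow> \<alpha> x"
    using conv
  proof eventually_elim
    case (elim x)
    then obtain l where l: "(\<lambda>n. \<beta> n x) \<longlonglongrightarrow> l" by (auto simp: convergent_def)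
    have "l \<in> A"
      using compact_imp_closed[OF compact_A] l controlsD(2)[OF \<beta>]
      by (intro Lim_in_closed_set[of A "\<lambda>n. \<beta> n x"]) auto
    moreover have "lim (\<lambda>n. \<beta> n x $ t) = l $ t" for t
      using l by (intro limI tendsto_vec_nth)
    ultimately have "\<alpha> x = l" by (auto simp: \<alpha>_def vec_eq_iff cube_def)
    with l show ?case by simp
  qed
  ultimately have "(\<lambda>n. J (\<beta> n)) \<longlonglongrightarrow> J \<alpha>" by (intro J_tendsto \<beta>)
  moreover have "(\<lambda>n. J (\<beta> n)) \<longlonglongrightarrow> v0"
  proof (rule tendsto_sandwich[OF _ _ tendsto_const])
    show "\<forall>\<^sub>F n in sequentially. J (\<beta> n) \<le> v0 + (1/4)^n"
      by (rule always_eventually) (rule allI, rule less_imp_le[OF J\<beta>])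
    have "(\<lambda>n. v0 + (1/4)^n) \<longlonglongrightarrow> v0 + 0" by (intro tendsto_intros) auto
    then show "(\<lambda>n. v0 + (1/4)^n) \<longlonglongrightarrow> v0" by simp
  qed (use v0_le \<beta> in auto)
  ultimately have "J \<alpha> = v0" by (rule LIMSEQ_unique)
  with \<open>\<alpha> \<in> controls K\<close> show thesis by (intro that[of \<alpha>]) (simp add: optimal_iff)
qed

end

section \<open>Conditional Hoelder estimates\<close>

text \<open>Young's inequality after division by the two norms. If one of them vanishes, the product
  is zero almost everywhere.\<close>

lemma
  fixes u v :: "'a \<Rightarrow> real" and p q :: real
  assumes pq: "p > 1" "q > 1" "1 / p + 1 / q = 1"
    and m[measurable]: "u \<in> borel_measurable N" "v \<in> borel_measurable N"
    and u: "integrable N (\<lambda>x. \<bar>u x\<bar> powr q)" and v: "integrable N (\<lambda>x. \<bar>v x\<bar> powr p)"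
  shows holder_integrable: "integrable N (\<lambda>x. u x * v x)"
    and holder_integral: "\<bar>\<integral>x. u x * v x \<partial>N\<bar> \<le> (\<integral>x. \<bar>u x\<bar> powr q \<partial>N) powr (1 / q) * (\<integral>x. \<bar>v x\<bar> powr p \<partial>N) powr (1 / p)"
proof -
  show i: "integrable N (\<lambda>x. u x * v x)"
  proof (rule Bochner_Integration.integrable_bound[OF Bochner_Integration.integrable_add[OF v u]])
    show "AE x in N. norm (u x * v x) \<le> norm (\<bar>v x\<bar> powr p + \<bar>u x\<bar> powr q)"
      using mult_le_powr_add_powr[OF pq, of "\<bar>v _\<bar>" "\<bar>u _\<bar>"]
      by (intro AE_I2) (simp add: abs_mult mult.commute)
  qed measurable
  define U where "U = (\<integral>x. \<bar>u x\<bar> powr q \<partial>N)"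
  define V where "V = (\<integral>x. \<bar>v x\<bar> powr p \<partial>N)"
  have nn: "0 \<le> U" "0 \<le> V" by (auto simp: U_def V_def)
  have zero: "(\<integral>x. u x * v x \<partial>N) = 0" if "U = 0 \<or> V = 0"
  proof -
    have "AE x in N. u x * v x = 0"
      using that
    proof
      assume "U = 0"
      then have "AE x in N. \<bar>u x\<bar> powr q = 0"
        using integral_nonneg_eq_0_iff_AE[OF u] by (simp add: U_def)
      then show ?thesis by eventually_elim simp
    next
      assume "V = 0"
      then have "AE x in N. \<bar>v x\<bar> powr p = 0"
        using integral_nonneg_eq_0_iff_AE[OF v] by (simp add: V_def)
      then show ?thesis by eventually_elim simp
    qed
    then show ?thesis by (rule integral_eq_zero_AE)
  qed
  have "\<bar>\<integral>x. u x * v x \<partial>N\<bar> \<le> U powr (1 / q) * V powr (1 / p)"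
  proof (cases "U = 0 \<or> V = 0")
    case True
    then show ?thesis using zero by simp
  next
    case False
    then have pos: "0 < U" "0 < V" using nn by auto
    define U' where "U' = U powr (1 / q)"
    define V' where "V' = V powr (1 / p)"
    have UV: "0 < U'" "0 < V'" "U' powr q = U" "V' powr p = V"
      using pos pq by (auto simp: U'_def V'_def powr_powr)
    have "\<bar>\<integral>x. u x * v x \<partial>N\<bar> \<le> (\<integral>x. \<bar>u x * v x\<bar> \<partial>N)" by (rule integral_abs_bound)
    also have "\<dots> \<le> (\<integral>x. U' * V' * (\<bar>v x\<bar> powr p / V / p + \<bar>u x\<bar> powr q / U / q) \<partial>N)"
    proof (rule integral_mono)
      fix x
      have "(\<bar>v x\<bar> / V') * (\<bar>u x\<bar> / U') \<le> (\<bar>v x\<bar> / V') powr p / p + (\<bar>u x\<bar> / U') powr q / q"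
        using UV by (intro Youngs_inequality pq) auto
      also have "\<dots> = \<bar>v x\<bar> powr p / V / p + \<bar>u x\<bar> powr q / U / q"
        using UV by (simp add: powr_divide)
      finally have "U' * V' * ((\<bar>v x\<bar> / V') * (\<bar>u x\<bar> / U'))
          \<le> U' * V' * (\<bar>v x\<bar> powr p / V / p + \<bar>u x\<bar> powr q / U / q)"
        using UV by (intro mult_left_mono) auto
      then show "\<bar>u x * v x\<bar> \<le> U' * V' * (\<bar>v x\<bar> powr p / V / p + \<bar>u x\<bar> powr q / U / q)"
        using UV by (simp add: abs_mult mult.commute)
    qed (use i u v in auto)
    also have "\<dots> = U' * V' * (V / V / p + U / U / q)"
      using u v by (simp add: U_def V_def)
    also have "\<dots> = U' * V'" using pos pq by simp
    finally show ?thesis by (simp add: U'_def V'_def)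
  qed
  then show "\<bar>\<integral>x. u x * v x \<partial>N\<bar> \<le> (\<integral>x. \<bar>u x\<bar> powr q \<partial>N) powr (1 / q) * (\<integral>x. \<bar>v x\<bar> powr p \<partial>N) powr (1 / p)"
    by (simp add: U_def V_def)
qed

text \<open>A cost below a real bound excludes the infinite branch of \<open>cost\<close>, which
  yields integrability.\<close>

lemma near_couplingsD:
  assumes "\<pi> \<in> near_couplings p \<delta> \<eta>" "0 < p"
  shows "prob_space \<pi>" "sets \<pi> = sets borel" "distr \<pi> borel fst = \<eta>"
    "integrable \<pi> (\<lambda>w. \<bar>snd w - fst w\<bar> powr p)"
    "(\<integral>w. \<bar>snd w - fst w\<bar> powr p \<partial>\<pi>) powr (1 / p) \<le> \<delta>"
    "(\<integral>w. \<bar>snd w - fst w\<bar> powr p \<partial>\<pi>) \<le> \<delta> powr p"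
proof -
  show "prob_space \<pi>" "sets \<pi> = sets borel" "distr \<pi> borel fst = \<eta>"
    using assms by (auto simp: near_couplings_def space_prob_algebra)
  have eq: "(\<lambda>(x, y). \<bar>x - y\<bar> powr p) = (\<lambda>w::real \<times> real. \<bar>snd w - fst w\<bar> powr p)"
    by (auto simp: fun_eq_iff abs_minus_commute)
  have c: "cost p \<pi> < ereal \<delta>" using assms by (auto simp: near_couplings_def)
  show "integrable \<pi> (\<lambda>w. \<bar>snd w - fst w\<bar> powr p)"
    using c unfolding cost_def eq by (auto split: if_splits)
  with c show 1: "(\<integral>w. \<bar>snd w - fst w\<bar> powr p \<partial>\<pi>) powr (1 / p) \<le> \<delta>"
    unfolding cost_def eq by (auto split: if_splits)
  have "((\<integral>w. \<bar>snd w - fst w\<bar> powr p \<partial>\<pi>) powr (1 / p)) powr p \<le> \<delta> powr p"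
    using 1 assms by (intro powr_mono2) auto
  then show "(\<integral>w. \<bar>snd w - fst w\<bar> powr p \<partial>\<pi>) \<le> \<delta> powr p"
    using assms by (simp add: powr_powr)
qed

context robust_setting
begin

interpretation mu: prob_space \<mu> by (rule prob_\<mu>)

text \<open>The first factor compares the Euclidean norm with the sum of \<open>p\<close>-th powers
  of the coordinates; the second counts the coordinates, each of which contributes at most
  \<open>\<delta> powr p\<close>.\<close>

definition card_const :: real where "card_const = real CARD('n) powr p * real CARD('n)"

lemma future_law_eq: "future_law \<kappa> t x = M.law {t<..} x"
  by (simp add: future_law_def M.law_def)

text \<open>The conditional expectation of the \<open>t\<close>-th partial derivative given the
  coordinates up to \<open>t\<close>.\<close>

definition cond_Df :: "('n pts \<Rightarrow> 'n pts) \<Rightarrow> 'n \<Rightarrow> 'n pts \<Rightarrow> real" where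
  "cond_Df \<alpha> t x = (\<integral>z. Df z (\<alpha> z) $ t \<partial>future_law \<kappa> t x)"

text \<open>The conditional L^q norm given the strict past of \<open>t\<close>. Coordinate
  \<open>t\<close> of \<open>x\<close> is overwritten, so for adapted \<open>F\<close> the value
  depends only on earlier times.\<close>

definition cond_norm :: "'n \<Rightarrow> ('n pts \<Rightarrow> real) \<Rightarrow> 'n pts \<Rightarrow> real" where
  "cond_norm t F x = Lnorm q (\<kappa> t x) (\<lambda>v. F (set_coord x t v))"

lemma sensitivity_eq: "sensitivity q \<mu> \<kappa> Df \<alpha> = (\<Sum>t\<in>UNIV. \<integral>x. cond_norm t (cond_Df \<alpha> t) x \<partial>\<mu>)"
  by (simp add: sensitivity_def cond_norm_def cond_Df_def)

lemma integrable_powr_Df: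
  assumes "\<alpha> \<in> borel_measurable borel" "\<And>x. \<alpha> x \<in> A"
  shows "integrable \<mu> (\<lambda>x. \<bar>Df x (\<alpha> x) $ t\<bar> powr q)"
proof -
  note [measurable] = assms(1) and assms(2)[simp]
  obtain B where B: "0 \<le> B" "\<And>x a. a \<in> A \<Longrightarrow> norm (Df x a) powr q \<le> B * (1 + norm x powr p)"
    using Df_powr_growth by metis
  show ?thesis
  proof (rule Bochner_Integration.integrable_bound)
    show "integrable \<mu> (\<lambda>x. B * (1 + norm x powr p))" using integrable_moment by auto
    show "AE x in \<mu>. norm (\<bar>Df x (\<alpha> x) $ t\<bar> powr q) \<le> norm (B * (1 + norm x powr p))"
    proof (rule AE_I2)
      fix x
      have "\<bar>Df x (\<alpha> x) $ t\<bar> powr q \<le> norm (Df x (\<alpha> x)) powr q"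
        using q_gt_1 by (intro powr_mono2) (auto simp: component_le_norm_cart)
      also have "\<dots> \<le> B * (1 + norm x powr p)" by (rule B) simp
      finally show "norm (\<bar>Df x (\<alpha> x) $ t\<bar> powr q) \<le> norm (B * (1 + norm x powr p))"
        using B by simp
    qed
  qed measurable
qed

context
  fixes \<alpha> :: "'n pts \<Rightarrow> 'n pts"
  assumes \<alpha>: "\<alpha> \<in> controls K"
begin

lemma Df_control_measurable[measurable]: "(\<lambda>x. Df x (\<alpha> x) $ t) \<in> borel_measurable borel"
proof -
  note [measurable] = controlsD(1)[OF \<alpha>] and controlsD(2)[OF \<alpha>, simp]
  show ?thesis by measurable
qed

lemma integrable_powr_Df_control: "integrable \<mu> (\<lambda>x. \<bar>Df x (\<alpha> x) $ t\<bar> powr q)"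
  using controlsD(1,2)[OF \<alpha>] by (rule integrable_powr_Df)

lemma integrable_Df_control: "integrable \<mu> (\<lambda>x. Df x (\<alpha> x) $ t)"
  using holder_integrable[of p q "\<lambda>x. Df x (\<alpha> x) $ t" \<mu> "\<lambda>_. 1"] p_gt_1 q_gt_1 pq
    integrable_powr_Df_control[of t] by simp

lemma cond_Df_measurable[measurable]: "cond_Df \<alpha> t \<in> borel_measurable borel"
  unfolding cond_Df_def future_law_eq
  by (rule measurable_compose[OF M.law_measurable' integral_measurable_subprob_algebra]) measurable

lemma cond_Df_adapted: "M.adapted t (cond_Df \<alpha> t)"
  unfolding M.adapted_def cond_Df_def future_law_eq
proof (intro allI impI)
  fix x x' :: "'n pts" assume "same_pts {..t} x x'"
  then have "M.law {t<..} x = M.law {t<..} x'"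
    by (intro M.law_cong[of "{..t}"]) auto
  then show "(\<integral>z. Df z (\<alpha> z) $ t \<partial>M.law {t<..} x) = (\<integral>z. Df z (\<alpha> z) $ t \<partial>M.law {t<..} x')" by simp
qed

text \<open>Conditional Jensen inequality, obtained from Hoelder's inequality against the constant
  1.\<close>

lemma integrable_powr_cond_Df: "integrable \<mu> (\<lambda>x. \<bar>cond_Df \<alpha> t x\<bar> powr q)"
proof (rule Bochner_Integration.integrable_bound)
  show "integrable \<mu> (\<lambda>x. \<integral>z. \<bar>Df z (\<alpha> z) $ t\<bar> powr q \<partial>M.law {t<..} x)"
    by (rule M.integrable_future[OF \<mu>_law integrable_powr_Df_control])
  show "AE x in \<mu>. norm (\<bar>cond_Df \<alpha> t x\<bar> powr q) \<le> norm (\<integral>z. \<bar>Df z (\<alpha> z) $ t\<bar> powr q \<partial>M.law {t<..} x)"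
    using M.AE_integrable_future[OF \<mu>_law integrable_powr_Df_control, of t t]
  proof eventually_elim
    case (elim x)
    interpret L: prob_space "M.law {t<..} x" by (rule M.law_prob)
    have m: "(\<lambda>z. Df z (\<alpha> z) $ t) \<in> borel_measurable (M.law {t<..} x)" by measurable
    have "\<bar>cond_Df \<alpha> t x\<bar> \<le> (\<integral>z. \<bar>Df z (\<alpha> z) $ t\<bar> powr q \<partial>M.law {t<..} x) powr (1 / q)"
      using holder_integral[OF p_gt_1 q_gt_1 pq m, of "\<lambda>_. 1"] elim
      by (simp add: cond_Df_def future_law_eq L.prob_space[simplified])
    then have "\<bar>cond_Df \<alpha> t x\<bar> powr q \<le> ((\<integral>z. \<bar>Df z (\<alpha> z) $ t\<bar> powr q \<partial>M.law {t<..} x) powr (1 / q)) powr q"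
      using q_gt_1 by (intro powr_mono2) auto
    then show ?case using q_gt_1 by (simp add: powr_powr)
  qed
qed measurable

end

lemma cond_norm_nonneg: "0 \<le> cond_norm t F x"
  by (simp add: cond_norm_def Lnorm_def)

lemma cond_norm_measurable[measurable]:
  assumes [measurable]: "F \<in> borel_measurable borel"
  shows "cond_norm t F \<in> borel_measurable borel"
proof -
  have k: "\<kappa> t \<in> borel \<rightarrow>\<^sub>M subprob_algebra borel"
    by (rule measurable_prob_algebraD) measurable
  have "M.step t \<in> borel \<rightarrow>\<^sub>M subprob_algebra borel" by measurable
  then have "(\<lambda>x. \<integral>z. \<bar>F z\<bar> powr q \<partial>M.step t x) \<in> borel_measurable borel"
    by (rule measurable_compose[OF _ integral_measurable_subprob_algebra]) measurable
  moreover have "(\<integral>z. \<bar>F z\<bar> powr q \<partial>M.step t x) = (\<integral>v. \<bar>F (set_coord x t v)\<bar> powr q \<partial>\<kappa> t x)" for x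
    unfolding M.step_def by (subst integral_distr) auto
  ultimately have [measurable]: "(\<lambda>x. \<integral>v. \<bar>F (set_coord x t v)\<bar> powr q \<partial>\<kappa> t x) \<in> borel_measurable borel"
    by simp
  show ?thesis unfolding cond_norm_def[abs_def] Lnorm_def by measurable
qed

lemma
  assumes F[measurable]: "F \<in> borel_measurable borel" and a: "M.adapted t F"
    and i: "integrable \<mu> (\<lambda>x. \<bar>F x\<bar> powr q)"
  shows AE_integrable_cond: "AE x in \<mu>. integrable (\<kappa> t x) (\<lambda>v. \<bar>F (set_coord x t v)\<bar> powr q)"
    and integrable_cond_norm: "integrable \<mu> (cond_norm t F)"
proof -
  have a': "M.adapted t (\<lambda>x. \<bar>F x\<bar> powr q)"
    unfolding M.adapted_def
  proof (intro allI impI)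
    fix z z' :: "'n pts" assume "same_pts {..t} z z'"
    then have "F z = F z'" using a unfolding M.adapted_def by blast
    then show "\<bar>F z\<bar> powr q = \<bar>F z'\<bar> powr q" by simp
  qed
  show "AE x in \<mu>. integrable (\<kappa> t x) (\<lambda>v. \<bar>F (set_coord x t v)\<bar> powr q)"
    by (rule M.AE_integrable_adapted[OF \<mu>_law a' i])
  \<comment> \<open>The conditional norm is a \<open>q\<close>-th root, and with
    \<open>q > 1\<close> the root of a nonnegative number is at most 1 plus that number.\<close>
  have "integrable \<mu> (\<lambda>x. 1 + (\<integral>v. \<bar>F (set_coord x t v)\<bar> powr q \<partial>\<kappa> t x))"
    using M.integrable_adapted[OF \<mu>_law a' i] by simp
  then show "integrable \<mu> (cond_norm t F)"
  proof (rule Bochner_Integration.integrable_bound)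
    show "AE x in \<mu>. norm (cond_norm t F x) \<le> norm (1 + (\<integral>v. \<bar>F (set_coord x t v)\<bar> powr q \<partial>\<kappa> t x))"
    proof (rule AE_I2)
      fix x
      have "cond_norm t F x \<le> 1 + (\<integral>v. \<bar>F (set_coord x t v)\<bar> powr q \<partial>\<kappa> t x) powr 1"
        unfolding cond_norm_def Lnorm_def using q_gt_1 by (intro powr_le_one_plus_powr) auto
      then show "norm (cond_norm t F x) \<le> norm (1 + (\<integral>v. \<bar>F (set_coord x t v)\<bar> powr q \<partial>\<kappa> t x))"
        by (simp add: cond_norm_nonneg)
    qed
  qed measurable
qed

end

section \<open>Couplings whose conditional costs stay below \<delta>\<close>

lemma fst_measurable_borel[measurable]:
  "(fst :: ('a::second_countable_topology \<times> 'b::second_countable_topology) \<Rightarrow> 'a) \<in> borel \<rightarrow>\<^sub>M borel"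
  "(snd :: ('a \<times> 'b) \<Rightarrow> 'b) \<in> borel \<rightarrow>\<^sub>M borel"
  by (auto intro!: borel_measurable_continuous_onI continuous_intros)

locale near_coupling_setting = robust_setting p q C e K \<mu> \<kappa> f Df eps
  for p q C e K and \<mu> :: "('n::{finite,linorder}) pts measure" and \<kappa> f Df eps +
  fixes \<delta> :: real and \<gamma> :: "('n pts \<times> 'n pts) measure"
    and g :: "'n \<Rightarrow> 'n pts \<times> 'n pts \<Rightarrow> (real \<times> real) measure"
  assumes \<delta>_pos: "0 < \<delta>" and \<gamma>_disint: "pair_disintegration \<gamma> g"
    and g_near: "\<And>t x y. g t (x, y) \<in> near_couplings p \<delta> (\<kappa> t x)"

sublocale near_coupling_setting \<subseteq> G: kernel_chain set_coords g same_pairs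
  using \<gamma>_disint by (intro kernel_chain_pairs) (simp add: pair_disintegration_def)

context near_coupling_setting
begin

lemma \<gamma>_law: "\<gamma> = G.law UNIV 0"
  using \<gamma>_disint by (simp add: pair_disintegration_def G.law_def)

lemma sets_\<gamma>[simp, measurable_cong]: "sets \<gamma> = sets borel" and space_\<gamma>[simp]: "space \<gamma> = UNIV"
  and prob_\<gamma>: "prob_space \<gamma>"
  unfolding \<gamma>_law by (auto intro: G.law_prob)

interpretation ga: prob_space \<gamma> by (rule prob_\<gamma>)
interpretation mu: prob_space \<mu> by (rule prob_\<mu>)

lemmas gD = near_couplingsD[OF g_near[of _ "fst z" "snd z" for z], unfolded prod.collapse]

lemma p_pos: "0 < p" using p_gt_1 by simp

text \<open>Causality: the first marginal of \<open>g t z\<close> is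
  \<open>\<kappa> t (fst z)\<close>, whatever the second path has been, so the first components are
  drawn from the kernels of \<mu>.\<close>

lemma law_fst:
  assumes "\<And>s t. s \<in> T \<Longrightarrow> s \<le> t \<Longrightarrow> t \<in> T"
  shows "distr (G.law T z) borel fst = M.law T (fst z)"
  unfolding G.law_eq_chain M.law_eq_chain
proof (rule chain_intertwine[OF G.kernel_chain_axioms M.kernel_chain_axioms, where \<psi>="\<lambda>_ _. fst"])
  show "\<kappa> t (fst z) = distr (g t z) borel fst" for t z
    using gD(3)[OF p_pos] by simp
qed (use assms in \<open>auto simp: same_pts_def set_coords_def\<close>)

lemma distr_fst: "distr \<gamma> borel fst = \<mu>"
  unfolding \<gamma>_law \<mu>_law using law_fst[of UNIV 0] by (simp add: zero_prod_def)

lemma integrable_fst: "integrable \<mu> h \<Longrightarrow> integrable \<gamma> (\<lambda>z. h (fst z))" for h :: "'n pts \<Rightarrow> real"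
  unfolding distr_fst[symmetric] by (rule integrable_distr) measurable

lemma integral_fst: "h \<in> borel_measurable borel \<Longrightarrow> (\<integral>z. h (fst z) \<partial>\<gamma>) = (\<integral>x. h x \<partial>\<mu>)" for h :: "'n pts \<Rightarrow> real"
  unfolding distr_fst[symmetric] by (subst integral_distr) auto

lemma AE_fst: "AE x in \<mu>. P x \<Longrightarrow> AE z in \<gamma>. P (fst z)"
  unfolding distr_fst[symmetric] by (rule AE_distrD) measurable

text \<open>Nonnegative integrals are used first because integrability is part of the claim; the
  conditional cost is bounded at every past, so conditioning on the past suffices.\<close>

lemma
  shows integrable_coord_diff: "integrable \<gamma> (\<lambda>z. \<bar>snd z $ t - fst z $ t\<bar> powr p)"
    and integral_coord_diff: "(\<integral>z. \<bar>snd z $ t - fst z $ t\<bar> powr p \<partial>\<gamma>) \<le> \<delta> powr p"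
proof -
  let ?h = "\<lambda>z::'n pts \<times> 'n pts. ennreal (\<bar>snd z $ t - fst z $ t\<bar> powr p)"
  have a: "G.adapted t ?h" by (auto simp: G.adapted_def same_pairs_def same_pts_def)
  have "(\<integral>\<^sup>+z. ?h z \<partial>\<gamma>) = (\<integral>\<^sup>+z. \<integral>\<^sup>+a. ?h (set_coords z t a) \<partial>g t z \<partial>\<gamma>)"
    by (rule G.nn_integral_adapted[OF \<gamma>_law _ a, symmetric]) measurable
  also have "\<dots> \<le> (\<integral>\<^sup>+z. ennreal (\<delta> powr p) \<partial>\<gamma>)"
  proof (rule nn_integral_mono)
    fix z
    have "(\<integral>\<^sup>+a. ?h (set_coords z t a) \<partial>g t z) = ennreal (\<integral>a. \<bar>snd a - fst a\<bar> powr p \<partial>g t z)"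
      using gD(4)[OF p_pos, of t z] by (subst nn_integral_eq_integral[symmetric]) (auto simp: set_coords_def)
    also have "\<dots> \<le> ennreal (\<delta> powr p)" using gD(6)[OF p_pos, of t z] by (rule ennreal_leI)
    finally show "(\<integral>\<^sup>+a. ?h (set_coords z t a) \<partial>g t z) \<le> ennreal (\<delta> powr p)" .
  qed
  also have "\<dots> = ennreal (\<delta> powr p)" using ga.emeasure_space_1 by simp
  finally have le: "(\<integral>\<^sup>+z. ?h z \<partial>\<gamma>) \<le> ennreal (\<delta> powr p)" .
  show i: "integrable \<gamma> (\<lambda>z. \<bar>snd z $ t - fst z $ t\<bar> powr p)"
  proof (rule integrableI_nonneg)
    show "(\<integral>\<^sup>+z. ?h z \<partial>\<gamma>) < \<infinity>" using le by (rule le_less_trans) simp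
  qed auto
  have "ennreal (\<integral>z. \<bar>snd z $ t - fst z $ t\<bar> powr p \<partial>\<gamma>) \<le> ennreal (\<delta> powr p)"
    using le i by (subst nn_integral_eq_integral[symmetric]) auto
  then show "(\<integral>z. \<bar>snd z $ t - fst z $ t\<bar> powr p \<partial>\<gamma>) \<le> \<delta> powr p"
    by (subst (asm) ennreal_le_iff) auto
qed

lemma
  shows integrable_diff: "integrable \<gamma> (\<lambda>z. norm (snd z - fst z) powr p)"
    and integral_diff: "(\<integral>z. norm (snd z - fst z) powr p \<partial>\<gamma>) \<le> card_const * \<delta> powr p"
proof -
  let ?s = "\<lambda>z::'n pts \<times> 'n pts. real CARD('n) powr p * (\<Sum>i\<in>UNIV. \<bar>snd z $ i - fst z $ i\<bar> powr p)"
  have isum: "integrable \<gamma> ?s" using integrable_coord_diff by auto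
  have le: "norm (snd z - fst z) powr p \<le> ?s z" for z :: "'n pts \<times> 'n pts"
    using norm_powr_le_sum[OF p_pos, of "snd z - fst z"] by simp
  show i: "integrable \<gamma> (\<lambda>z. norm (snd z - fst z) powr p)"
  proof (rule Bochner_Integration.integrable_bound[OF isum])
    show "AE z in \<gamma>. norm (norm (snd z - fst z) powr p) \<le> norm (?s z)"
      using le by (intro AE_I2) (auto simp: abs_of_nonneg sum_nonneg)
  qed measurable
  have "(\<integral>z. norm (snd z - fst z) powr p \<partial>\<gamma>) \<le> (\<integral>z. ?s z \<partial>\<gamma>)"
    using i isum le by (rule integral_mono)
  also have "\<dots> = real CARD('n) powr p * (\<Sum>i\<in>UNIV. \<integral>z. \<bar>snd z $ i - fst z $ i\<bar> powr p \<partial>\<gamma>)"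
    using integrable_coord_diff by simp
  also have "\<dots> \<le> real CARD('n) powr p * (\<Sum>i\<in>(UNIV::'n set). \<delta> powr p)"
    by (intro mult_left_mono sum_mono integral_coord_diff) auto
  also have "\<dots> = card_const * \<delta> powr p" by (simp add: card_const_def)
  finally show "(\<integral>z. norm (snd z - fst z) powr p \<partial>\<gamma>) \<le> card_const * \<delta> powr p" .
qed

lemma integrable_Df_coord:
  assumes a[measurable]: "a \<in> borel_measurable borel" and a2[simp]: "\<And>z. a z \<in> A"
  shows "integrable \<gamma> (\<lambda>z. Df (fst z) (a z) $ t * (snd z $ t - fst z $ t))"
proof (rule holder_integrable[OF p_gt_1 q_gt_1 pq])
  obtain B where B: "0 \<le> B" "\<And>x a. a \<in> A \<Longrightarrow> norm (Df x a) powr q \<le> B * (1 + norm x powr p)"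
    using Df_powr_growth by metis
  show "integrable \<gamma> (\<lambda>z. \<bar>Df (fst z) (a z) $ t\<bar> powr q)"
  proof (rule Bochner_Integration.integrable_bound)
    show "integrable \<gamma> (\<lambda>z. B * (1 + norm (fst z) powr p))"
      by (rule integrable_fst) (use integrable_moment in auto)
    show "AE z in \<gamma>. norm (\<bar>Df (fst z) (a z) $ t\<bar> powr q) \<le> norm (B * (1 + norm (fst z) powr p))"
    proof (rule AE_I2)
      fix z :: "'n pts \<times> 'n pts"
      have "\<bar>Df (fst z) (a z) $ t\<bar> powr q \<le> norm (Df (fst z) (a z)) powr q"
        using q_gt_1 by (intro powr_mono2) (auto simp: component_le_norm_cart)
      also have "\<dots> \<le> B * (1 + norm (fst z) powr p)" by (rule B) simp
      finally show "norm (\<bar>Df (fst z) (a z) $ t\<bar> powr q) \<le> norm (B * (1 + norm (fst z) powr p))"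
        using B by simp
    qed
  qed measurable
qed (use integrable_coord_diff in auto)

lemma inner_diff_eq_sum: "Df x a \<bullet> (y - x) = (\<Sum>t\<in>UNIV. Df x a $ t * (y $ t - x $ t))"
  by (simp add: inner_vec_def)

text \<open>Conditioning first on the coordinates up to \<open>t\<close> replaces the gradient by its conditional
  expectation under the first marginal (causality); Hoelder's inequality is then applied
  conditionally on the past.\<close>

lemma integral_Df_coord_le:
  assumes \<alpha>: "\<alpha> \<in> controls K"
  shows "(\<integral>z. Df (fst z) (\<alpha> (fst z)) $ t * (snd z $ t - fst z $ t) \<partial>\<gamma>)
    \<le> \<delta> * (\<integral>x. cond_norm t (cond_Df \<alpha> t) x \<partial>\<mu>)"
proof -
  note [measurable] = controlsD(1)[OF \<alpha>] cond_Df_measurable[OF \<alpha>]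
    Df_control_measurable[OF \<alpha>]
  note [simp] = controlsD(2)[OF \<alpha>]
  define F where "F = cond_Df \<alpha> t"
  have [measurable]: "F \<in> borel_measurable borel" unfolding F_def by measurable
  define h where "h z = Df (fst z) (\<alpha> (fst z)) $ t * (snd z $ t - fst z $ t)" for z
  have h: "integrable \<gamma> h" unfolding h_def by (rule integrable_Df_coord) auto
  define h2 where "h2 z = F (fst z) * (snd z $ t - fst z $ t)" for z
  \<comment> \<open>Given the pair up to \<open>t\<close>, the increment of coordinate
    \<open>t\<close> is fixed, and \<open>law_fst\<close> lets the first path continue with its own
    kernels; this turns the gradient into \<open>cond_Df\<close>.\<close>
  have inner: "(\<integral>z'. h z' \<partial>G.law {t<..} z) = h2 z" for z
  proof -
    have "(\<integral>z'. h z' \<partial>G.law {t<..} z)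
        = (\<integral>z'. Df (fst z') (\<alpha> (fst z')) $ t * (snd z $ t - fst z $ t) \<partial>G.law {t<..} z)"
    proof (rule integral_cong_AE)
      have "AE z' in G.law {t<..} z. same_pairs {..t} z z'" by (rule G.law_same) auto
      then show "AE z' in G.law {t<..} z. h z' = Df (fst z') (\<alpha> (fst z')) $ t * (snd z $ t - fst z $ t)"
        by eventually_elim (auto simp: h_def same_pairs_def same_pts_def)
    qed (auto simp: h_def[abs_def])
    also have "\<dots> = (\<integral>z'. Df (fst z') (\<alpha> (fst z')) $ t \<partial>G.law {t<..} z) * (snd z $ t - fst z $ t)"
      by simp
    also have "(\<integral>z'. Df (fst z') (\<alpha> (fst z')) $ t \<partial>G.law {t<..} z)
        = (\<integral>x. Df x (\<alpha> x) $ t \<partial>distr (G.law {t<..} z) borel fst)"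
      by (subst integral_distr) auto
    also have "\<dots> = F (fst z)"
      by (subst law_fst) (auto simp: F_def cond_Df_def future_law_eq)
    finally show ?thesis by (simp add: h2_def)
  qed
  have h2: "integrable \<gamma> h2" "(\<integral>z. h2 z \<partial>\<gamma>) = (\<integral>z. h z \<partial>\<gamma>)"
    using G.integrable_future[OF \<gamma>_law h, of t] G.integral_future[OF \<gamma>_law h, of t]
    unfolding inner by (simp_all add: eta_contract_eq)
  have ad: "G.adapted t h2"
    unfolding G.adapted_def
  proof (intro allI impI)
    fix z z' :: "'n pts \<times> 'n pts" assume s: "same_pairs {..t} z z'"
    then have "F (fst z) = F (fst z')"
      using cond_Df_adapted[OF \<alpha>, of t] unfolding M.adapted_def F_def same_pairs_def by blast
    then show "h2 z = h2 z'" using s by (simp add: h2_def same_pairs_def same_pts_def)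
  qed
  have iW: "integrable \<mu> (cond_norm t F)"
    unfolding F_def by (rule integrable_cond_norm[OF cond_Df_measurable cond_Df_adapted
          integrable_powr_cond_Df]; fact)
  have "AE x in \<mu>. integrable (\<kappa> t x) (\<lambda>v. \<bar>F (set_coord x t v)\<bar> powr q)"
    unfolding F_def by (rule AE_integrable_cond[OF cond_Df_measurable cond_Df_adapted
          integrable_powr_cond_Df]; fact)
  then have ae: "AE z in \<gamma>. integrable (\<kappa> t (fst z)) (\<lambda>v. \<bar>F (set_coord (fst z) t v)\<bar> powr q)"
    by (rule AE_fst)
  have "(\<integral>z. h z \<partial>\<gamma>) = (\<integral>z. \<integral>a. h2 (set_coords z t a) \<partial>g t z \<partial>\<gamma>)"
    using G.integral_adapted[OF \<gamma>_law ad h2(1)] h2(2) by simp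
  also have "\<dots> \<le> (\<integral>z. \<delta> * cond_norm t F (fst z) \<partial>\<gamma>)"
  proof (rule integral_mono_AE)
    show "integrable \<gamma> (\<lambda>z. \<integral>a. h2 (set_coords z t a) \<partial>g t z)"
      by (rule G.integrable_adapted[OF \<gamma>_law ad h2(1)])
    show "integrable \<gamma> (\<lambda>z. \<delta> * cond_norm t F (fst z))"
      using integrable_fst[OF iW] by simp
    show "AE z in \<gamma>. (\<integral>a. h2 (set_coords z t a) \<partial>g t z) \<le> \<delta> * cond_norm t F (fst z)"
      using ae
    proof eventually_elim
      case (elim z)
      have fst_g: "distr (g t z) borel fst = \<kappa> t (fst z)" by (rule gD(3)[OF p_pos])
      have iF: "integrable (g t z) (\<lambda>a. \<bar>F (set_coord (fst z) t (fst a))\<bar> powr q)"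
        using elim unfolding fst_g[symmetric] by (subst (asm) integrable_distr_eq) auto
      have eF: "(\<integral>a. \<bar>F (set_coord (fst z) t (fst a))\<bar> powr q \<partial>g t z) powr (1 / q) = cond_norm t F (fst z)"
        unfolding cond_norm_def Lnorm_def fst_g[symmetric] by (subst integral_distr) auto
      have "(\<integral>a. h2 (set_coords z t a) \<partial>g t z)
          = (\<integral>a. F (set_coord (fst z) t (fst a)) * (snd a - fst a) \<partial>g t z)"
        by (simp add: h2_def set_coords_def)
      also have "\<dots> \<le> cond_norm t F (fst z) * (\<integral>a. \<bar>snd a - fst a\<bar> powr p \<partial>g t z) powr (1 / p)"
        unfolding eF[symmetric] using gD(4)[OF p_pos, of t z] iF
        by (intro order_trans[OF abs_ge_self holder_integral[OF p_gt_1 q_gt_1 pq]]) auto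
      also have "\<dots> \<le> cond_norm t F (fst z) * \<delta>"
        by (intro mult_left_mono gD(5)[OF p_pos] cond_norm_nonneg)
      finally show ?case by (simp add: mult.commute)
    qed
  qed
  also have "\<dots> = \<delta> * (\<integral>x. cond_norm t F x \<partial>\<mu>)" by (simp add: integral_fst)
  finally show ?thesis by (simp add: h_def F_def)
qed

end

section \<open>Triangular transport maps\<close>

context near_coupling_setting
begin

interpretation ga: prob_space \<gamma> by (rule prob_\<gamma>)
interpretation mu: prob_space \<mu> by (rule prob_\<mu>)

text \<open>Measured in units of \<delta>, the increment has \<open>p\<close>-th moment at most
  \<open>card_const\<close> under every admissible coupling, so the error is uniform in the
  coupling. The control may read both paths: the upper bound uses one that reads only the first, the
  lower bound an arbitrary near-optimal one.\<close>

lemma expansion: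
  assumes a[measurable]: "a \<in> borel_measurable borel" and a2[simp]: "\<And>z. a z \<in> A" and \<eta>: "0 \<le> \<eta>"
    and T: "\<And>x y a. a \<in> A \<Longrightarrow>
      \<bar>f y a - f x a - Df x a \<bullet> (y - x)\<bar> \<le> \<delta> * \<eta> * (1 + norm x powr p + (norm (y - x) / \<delta>) powr p)"
  shows "\<bar>(\<integral>z. f (snd z) (a z) \<partial>\<gamma>) - (\<integral>z. f (fst z) (a z) \<partial>\<gamma>)
        - (\<integral>z. Df (fst z) (a z) \<bullet> (snd z - fst z) \<partial>\<gamma>)\<bar>
      \<le> \<delta> * \<eta> * (1 + (\<integral>x. norm x powr p \<partial>\<mu>) + card_const)"
proof -
  obtain B where B: "0 \<le> B" "\<And>x a. a \<in> A \<Longrightarrow> \<bar>f x a\<bar> \<le> B * (1 + norm x powr p)" using f_growth by metis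
  have i1: "integrable \<gamma> (\<lambda>z. f (fst z) (a z))"
  proof (rule Bochner_Integration.integrable_bound)
    show "integrable \<gamma> (\<lambda>z. B * (1 + norm (fst z) powr p))"
      by (rule integrable_fst) (use integrable_moment in auto)
    show "AE z in \<gamma>. norm (f (fst z) (a z)) \<le> norm (B * (1 + norm (fst z) powr p))"
      using B by (intro AE_I2) (auto simp: abs_mult)
  qed measurable
  have i2: "integrable \<gamma> (\<lambda>z. Df (fst z) (a z) \<bullet> (snd z - fst z))"
    unfolding inner_diff_eq_sum by (intro Bochner_Integration.integrable_sum integrable_Df_coord a a2)
  define R where "R z = f (snd z) (a z) - f (fst z) (a z) - Df (fst z) (a z) \<bullet> (snd z - fst z)" for z
  define b where "b z = \<delta> * \<eta> * (1 + norm (fst z) powr p + (norm (snd z - fst z) / \<delta>) powr p)"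
    for z :: "'n pts \<times> 'n pts"
  have b_eq: "b = (\<lambda>z. \<delta> * \<eta> * (1 + norm (fst z) powr p + norm (snd z - fst z) powr p / \<delta> powr p))"
    using \<delta>_pos by (simp add: fun_eq_iff b_def powr_divide)
  have b: "integrable \<gamma> b"
    unfolding b_eq using integrable_diff integrable_fst[OF integrable_moment] by simp
  have Rb: "\<bar>R z\<bar> \<le> b z" for z unfolding R_def b_def by (rule T) simp
  have [measurable]: "R \<in> borel_measurable \<gamma>" unfolding R_def by measurable
  have R: "integrable \<gamma> R"
    by (rule Bochner_Integration.integrable_bound[OF b])
      (auto intro!: AE_I2 order_trans[OF Rb])
  \<comment> \<open>Integrability at the perturbed point is read off from the expansion
    itself.\<close>
  have "integrable \<gamma> (\<lambda>z. R z + f (fst z) (a z) + Df (fst z) (a z) \<bullet> (snd z - fst z))"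
    using R i1 i2 by simp
  then have i3: "integrable \<gamma> (\<lambda>z. f (snd z) (a z))" by (simp add: R_def)
  have "(\<integral>z. f (snd z) (a z) \<partial>\<gamma>) - (\<integral>z. f (fst z) (a z) \<partial>\<gamma>)
      - (\<integral>z. Df (fst z) (a z) \<bullet> (snd z - fst z) \<partial>\<gamma>) = (\<integral>z. R z \<partial>\<gamma>)"
    unfolding R_def using i1 i2 i3 by simp
  moreover have "\<bar>\<integral>z. R z \<partial>\<gamma>\<bar> \<le> (\<integral>z. b z \<partial>\<gamma>)"
    by (rule order_trans[OF integral_abs_bound])
      (intro integral_mono Rb integrable_abs R b)
  moreover have "(\<integral>z. b z \<partial>\<gamma>) \<le> \<delta> * \<eta> * (1 + (\<integral>x. norm x powr p \<partial>\<mu>) + card_const)"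
  proof -
    have "(\<integral>z. b z \<partial>\<gamma>) = \<delta> * \<eta> * (1 + (\<integral>z. norm (fst z) powr p \<partial>\<gamma>)
        + (\<integral>z. norm (snd z - fst z) powr p \<partial>\<gamma>) / \<delta> powr p)"
      unfolding b_eq using integrable_diff integrable_fst[OF integrable_moment] ga.prob_space by simp
    also have "(\<integral>z. norm (fst z) powr p \<partial>\<gamma>) = (\<integral>x. norm x powr p \<partial>\<mu>)"
      by (rule integral_fst) measurable
    also have "\<delta> * \<eta> * (1 + (\<integral>x. norm x powr p \<partial>\<mu>) + (\<integral>z. norm (snd z - fst z) powr p \<partial>\<gamma>) / \<delta> powr p)
        \<le> \<delta> * \<eta> * (1 + (\<integral>x. norm x powr p \<partial>\<mu>) + card_const)"
      using integral_diff \<delta>_pos \<eta> by (intro mult_left_mono add_left_mono) (auto simp: field_simps)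
    finally show ?thesis .
  qed
  ultimately show "\<bar>(\<integral>z. f (snd z) (a z) \<partial>\<gamma>) - (\<integral>z. f (fst z) (a z) \<partial>\<gamma>)
        - (\<integral>z. Df (fst z) (a z) \<bullet> (snd z - fst z) \<partial>\<gamma>)\<bar>
      \<le> \<delta> * \<eta> * (1 + (\<integral>x. norm x powr p \<partial>\<mu>) + card_const)" by simp
qed

lemma integral_inner_le:
  assumes \<alpha>: "\<alpha> \<in> controls K"
  shows "(\<integral>z. Df (fst z) (\<alpha> (fst z)) \<bullet> (snd z - fst z) \<partial>\<gamma>) \<le> \<delta> * sensitivity q \<mu> \<kappa> Df \<alpha>"
proof -
  note [measurable] = controlsD(1)[OF \<alpha>]
  have "integrable \<gamma> (\<lambda>z. Df (fst z) (\<alpha> (fst z)) $ t * (snd z $ t - fst z $ t))" for t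
    by (rule integrable_Df_coord) (auto simp: controlsD(2)[OF \<alpha>])
  then have "(\<integral>z. Df (fst z) (\<alpha> (fst z)) \<bullet> (snd z - fst z) \<partial>\<gamma>)
      = (\<Sum>t\<in>UNIV. \<integral>z. Df (fst z) (\<alpha> (fst z)) $ t * (snd z $ t - fst z $ t) \<partial>\<gamma>)"
    unfolding inner_diff_eq_sum by (rule Bochner_Integration.integral_sum)
  also have "\<dots> \<le> (\<Sum>t\<in>UNIV. \<delta> * (\<integral>x. cond_norm t (cond_Df \<alpha> t) x \<partial>\<mu>))"
    by (intro sum_mono integral_Df_coord_le[OF \<alpha>])
  also have "\<dots> = \<delta> * sensitivity q \<mu> \<kappa> Df \<alpha>"
    by (simp add: sensitivity_eq sum_distrib_left)
  finally show ?thesis .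
qed

end

context robust_setting
begin

definition expansion_const :: real where
  "expansion_const = 1 + (\<integral>x. norm x powr p \<partial>\<mu>) + card_const"

lemma expansion_const_pos: "0 < expansion_const"
proof -
  have "0 \<le> (\<integral>x. norm x powr p \<partial>\<mu>)" by simp
  then show ?thesis unfolding expansion_const_def card_const_def by (simp add: add_pos_nonneg)
qed

lemma upper_bound:
  assumes \<alpha>: "\<alpha> \<in> optimal_controls \<mu> f K" and \<eta>: "0 < \<eta>"
  obtains \<delta>0 where "0 < \<delta>0" "\<And>\<delta>. 0 < \<delta> \<Longrightarrow> \<delta> < \<delta>0 \<Longrightarrow>
    V_robust p \<kappa> f K \<delta> \<le> ereal (v0 + \<delta> * (sensitivity q \<mu> \<kappa> Df \<alpha> + \<eta>))"
proof -
  have \<alpha>': "\<alpha> \<in> controls K" "J \<alpha> = v0" using \<alpha> by (auto simp: optimal_iff)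
  \<comment> \<open>Cancels the constant of the remainder in \<open>expansion\<close>, which leaves
    an error of \<open>\<delta> * \<eta>\<close>.\<close>
  define \<eta>' where "\<eta>' = \<eta> / expansion_const"
  have \<eta>': "0 < \<eta>'" using \<eta> expansion_const_pos by (simp add: \<eta>'_def)
  from taylor[OF \<eta>'] obtain \<delta>0 where \<delta>0: "0 < \<delta>0" and T: "\<And>\<delta> x y a. 0 < \<delta> \<Longrightarrow> \<delta> < \<delta>0 \<Longrightarrow> a \<in> A \<Longrightarrow>
    \<bar>f y a - f x a - Df x a \<bullet> (y - x)\<bar> \<le> \<delta> * \<eta>' * (1 + norm x powr p + (norm (y - x) / \<delta>) powr p)"
    by metis
  show thesis
  proof (rule that[OF \<delta>0])
    fix \<delta> :: real assume \<delta>: "0 < \<delta>" "\<delta> < \<delta>0"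
    have m: "(\<lambda>z::'n pts \<times> 'n pts. \<alpha> (fst z)) \<in> borel_measurable borel"
      by (rule measurable_compose[OF fst_measurable_borel(1) controlsD(1)[OF \<alpha>'(1)]])
    then have ctrl: "(\<lambda>z. \<alpha> (fst z)) \<in> pair_controls K"
      using \<alpha>'(1) by (auto simp: controls_def pair_controls_def)
    have "V_robust p \<kappa> f K \<delta> \<le> (SUP \<gamma>\<in>Pi_bc p \<kappa> \<delta>. ereal (\<integral>z. f (snd z) (\<alpha> (fst z)) \<partial>\<gamma>))"
      unfolding V_robust_def by (rule INF_lower[OF ctrl])
    also have "\<dots> \<le> ereal (v0 + \<delta> * (sensitivity q \<mu> \<kappa> Df \<alpha> + \<eta>))"
    proof (rule SUP_least)
      fix \<gamma> :: "('n pts \<times> 'n pts) measure" assume "\<gamma> \<in> Pi_bc p \<kappa> \<delta>"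
      then obtain g where g: "pair_disintegration \<gamma> g" "\<And>t x y. g t (x, y) \<in> near_couplings p \<delta> (\<kappa> t x)"
        by (auto simp: Pi_bc_def Pi_near_def)
      interpret near_coupling_setting p q C e K \<mu> \<kappa> f Df eps \<delta> \<gamma> g
        using \<delta> g by unfold_locales auto
      have "(\<integral>z. f (snd z) (\<alpha> (fst z)) \<partial>\<gamma>) \<le> (\<integral>z. f (fst z) (\<alpha> (fst z)) \<partial>\<gamma>)
          + (\<integral>z. Df (fst z) (\<alpha> (fst z)) \<bullet> (snd z - fst z) \<partial>\<gamma>) + \<delta> * \<eta>' * expansion_const"
        using expansion[OF m controlsD(2)[OF \<alpha>'(1)] less_imp_le[OF \<eta>'] T[OF \<delta>]]
        unfolding expansion_const_def by linarith
      also have "(\<integral>z. f (fst z) (\<alpha> (fst z)) \<partial>\<gamma>) = v0"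
      proof -
        have "(\<lambda>x. f x (\<alpha> x)) \<in> borel_measurable borel"
          using borel_measurable_integrable[OF integrable_f_control[OF \<alpha>'(1)]] by simp
        from integral_fst[OF this] show ?thesis using \<alpha>'(2) by (simp add: J_def)
      qed
      also have "\<delta> * \<eta>' * expansion_const = \<delta> * \<eta>" using expansion_const_pos by (simp add: \<eta>'_def)
      finally have "(\<integral>z. f (snd z) (\<alpha> (fst z)) \<partial>\<gamma>) \<le> v0 + \<delta> * (sensitivity q \<mu> \<kappa> Df \<alpha> + \<eta>)"
        using integral_inner_le[OF \<alpha>'(1)] by (simp add: algebra_simps)
      then show "ereal (\<integral>z. f (snd z) (\<alpha> (fst z)) \<partial>\<gamma>) \<le> ereal (v0 + \<delta> * (sensitivity q \<mu> \<kappa> Df \<alpha> + \<eta>))"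
        by simp
    qed
    finally show "V_robust p \<kappa> f K \<delta> \<le> ereal (v0 + \<delta> * (sensitivity q \<mu> \<kappa> Df \<alpha> + \<eta>))" .
  qed
qed

end

section \<open>Triangular maps, their adapted inverses and their graphs as bicausal
  couplings\<close>

locale triangular_transport =
  fixes \<delta> L c p :: real and \<mu> :: "('n::{finite,linorder}) pts measure"
    and \<kappa> :: "'n \<Rightarrow> 'n pts \<Rightarrow> real measure" and \<Phi> :: "'n pts \<Rightarrow> 'n pts"
  assumes p_ge: "1 < p" and \<delta>_pos: "0 < \<delta>" and \<delta>_L: "\<delta> * L < 1" and c: "0 \<le> c" "c < 1"
    and disint: "disintegration \<mu> \<kappa>"
    and \<Phi>_measurable[measurable]: "\<Phi> \<in> borel_measurable borel"
    and \<Phi>_adapted: "\<And>t x x'. same_pts {..t} x x' \<Longrightarrow> \<Phi> x $ t = \<Phi> x' $ t"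
    and \<Phi>_lipschitz: "\<And>t x u v. \<bar>\<Phi> (set_coord x t u) $ t - \<Phi> (set_coord x t v) $ t\<bar> \<le> L * \<bar>u - v\<bar>"
    and \<Phi>_integrable: "\<And>t x. integrable (\<kappa> t x) (\<lambda>v. \<bar>\<Phi> (set_coord x t v) $ t\<bar> powr p)"
    and \<Phi>_norm: "\<And>t x. (\<integral>v. \<bar>\<Phi> (set_coord x t v) $ t\<bar> powr p \<partial>\<kappa> t x) powr (1 / p) \<le> c"

sublocale triangular_transport \<subseteq> M: kernel_chain set_coord \<kappa> same_pts
  using disint by (intro kernel_chain_pts) (simp add: disintegration_def)

context triangular_transport
begin

definition move :: "'n \<Rightarrow> 'n pts \<Rightarrow> real \<Rightarrow> real" where
  "move t x v = v + \<delta> * \<Phi> (set_coord x t v) $ t"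

definition transport :: "'n pts \<Rightarrow> 'n pts" where
  "transport x = x + \<delta> *\<^sub>R \<Phi> x"

text \<open>Reads the first path only; on the graph the second path is a function of the
  first.\<close>

definition pair_kernel :: "'n \<Rightarrow> 'n pts \<times> 'n pts \<Rightarrow> (real \<times> real) measure" where
  "pair_kernel t z = distr (\<kappa> t (fst z)) borel (\<lambda>v. (v, move t (fst z) v))"

lemma transport_measurable[measurable]: "transport \<in> borel_measurable borel"
  unfolding transport_def[abs_def] by measurable

lemma move_measurable[measurable]:
  assumes "X \<in> N \<rightarrow>\<^sub>M borel" "h \<in> N \<rightarrow>\<^sub>M borel"
  shows "(\<lambda>w. move t (X w) (h w)) \<in> N \<rightarrow>\<^sub>M borel"
  unfolding move_def using assms by measurable

lemma same_set_coord:
  fixes x :: "'n pts"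
  shows "same_pts {..<t} x x' \<Longrightarrow> same_pts {..t} (set_coord x t v) (set_coord x' t v)"
  by (auto simp: same_pts_def order.order_iff_strict)

lemma move_cong: "same_pts {..<t} x x' \<Longrightarrow> move t x v = move t x' v"
  unfolding move_def using \<Phi>_adapted[OF same_set_coord[of t x x' v]] by simp

lemma transport_eq_move: "transport x $ t = move t x (x $ t)"
  by (simp add: transport_def move_def)

text \<open>Agreement is limited to times up to \<open>t\<close>, since changing coordinate
  \<open>t\<close> of \<open>x\<close> also changes the displacement at later times. This is the
  agreement that \<open>chain_intertwine\<close> asks for.\<close>

lemma same_transport: "same_pts {..t} (set_coord (transport x) t (move t x v)) (transport (set_coord x t v))"
proof -
  have "transport x $ s = transport (set_coord x t v) $ s" if "s < t" for s
  proof -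
    have "same_pts {..s} x (set_coord x t v)" using that by (auto simp: same_pts_def)
    from \<Phi>_adapted[OF this] show ?thesis using that by (auto simp: transport_def)
  qed
  moreover have "move t x v = transport (set_coord x t v) $ t"
    by (simp add: transport_def move_def)
  ultimately show ?thesis by (auto simp: same_pts_def)
qed

lemma pair_kernels: "pair_kernels pair_kernel"
  unfolding pair_kernels_def
proof (intro allI conjI impI)
  fix t
  have k: "(\<lambda>z::'n pts \<times> 'n pts. \<kappa> t (fst z)) \<in> borel \<rightarrow>\<^sub>M prob_algebra borel"
    by (rule measurable_compose[OF fst_measurable_borel(1) M.kernel_measurable])
  have m: "(\<lambda>(z::'n pts \<times> 'n pts, v). (v, move t (fst z) v)) \<in> borel \<Otimes>\<^sub>M borel \<rightarrow>\<^sub>M borel"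
    unfolding borel_prod[symmetric, where 'a=real and 'b=real] split_beta by measurable
  show "pair_kernel t \<in> borel \<rightarrow>\<^sub>M prob_algebra borel"
    unfolding pair_kernel_def[abs_def] by (rule measurable_distr_prob_space2[OF k m])
  fix x x' y y' :: "'n pts" assume "agree_before t x x' \<and> agree_before t y y'"
  then have s: "same_pts {..<t} x x'" by (auto simp: agree_before_def same_pts_def)
  then show "pair_kernel t (x, y) = pair_kernel t (x', y')"
    unfolding pair_kernel_def by (simp add: M.kernel_cong[OF s] move_cong[OF s])
qed

sublocale G: kernel_chain set_coords pair_kernel same_pairs
  by (rule kernel_chain_pairs[OF pair_kernels])

definition graph_law :: "('n pts \<times> 'n pts) measure" where
  "graph_law = distr \<mu> borel (\<lambda>x. (x, transport x))"

lemma \<mu>_law: "\<mu> = M.law UNIV 0"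
  using disint by (simp add: disintegration_def M.law_def)

lemma sets_\<mu>[simp, measurable_cong]: "sets \<mu> = sets borel"
  unfolding \<mu>_law by simp

lemma graph_measurable[measurable]: "(\<lambda>x. (x, transport x)) \<in> borel \<rightarrow>\<^sub>M borel"
  unfolding borel_prod[symmetric] by measurable

lemma graph_law_eq: "graph_law = compose_kernels set_coords pair_kernel UNIV 0"
proof -
  have "graph_law = distr (M.law UNIV 0) borel (\<lambda>x. (x, transport x))"
    by (simp add: graph_law_def flip: \<mu>_law)
  also have "\<dots> = G.law UNIV (0, transport 0)"
    unfolding M.law_eq_chain G.law_eq_chain
  proof (rule chain_intertwine[OF M.kernel_chain_axioms G.kernel_chain_axioms graph_measurable,
        where \<psi>="\<lambda>t x v. (v, move t x v)"])
    show "same_pairs {..t} (set_coords (x, transport x) t (v, move t x v)) (set_coord x t v, transport (set_coord x t v))"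
      for t x v using same_transport by (auto simp: same_pairs_def set_coords_def same_pts_def)
  qed (auto simp: pair_kernel_def borel_prod[symmetric])
  finally show ?thesis using G.law_UNIV_const[of "(0, transport 0)" 0] by (simp add: G.law_def)
qed

lemma pair_disintegration: "pair_disintegration graph_law pair_kernel"
  unfolding pair_disintegration_def using pair_kernels graph_law_eq by simp

lemma pair_kernel_near: "pair_kernel t (x, y) \<in> near_couplings p \<delta> (\<kappa> t x)"
proof -
  have [measurable]: "(\<lambda>v. (v, move t x v)) \<in> borel \<rightarrow>\<^sub>M borel"
    unfolding borel_prod[symmetric] by measurable
  have pr: "pair_kernel t (x, y) \<in> borel_probs"
    using measurable_space[OF G.kernel_measurable] by simp
  have "distr (pair_kernel t (x, y)) borel fst = distr (\<kappa> t x) borel (\<lambda>v. v)"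
    unfolding pair_kernel_def by (subst distr_distr) (auto simp: comp_def)
  also have "\<dots> = \<kappa> t x" by (rule distr_id2) simp
  finally have 1: "distr (pair_kernel t (x, y)) borel fst = \<kappa> t x" .
  have eq: "\<bar>v - move t x v\<bar> powr p = \<delta> powr p * \<bar>\<Phi> (set_coord x t v) $ t\<bar> powr p" for v
    using \<delta>_pos by (simp add: move_def abs_mult powr_mult)
  have cm: "(\<lambda>(x::real, y). \<bar>x - y\<bar> powr p) \<in> borel_measurable borel"
    unfolding borel_prod[symmetric] by measurable
  have i: "integrable (pair_kernel t (x, y)) (\<lambda>(x, y). \<bar>x - y\<bar> powr p)"
    unfolding pair_kernel_def using \<Phi>_integrable cm by (subst integrable_distr_eq) (auto simp: eq)
  have I: "(\<integral>(x, y). \<bar>x - y\<bar> powr p \<partial>pair_kernel t (x, y))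
      = \<delta> powr p * (\<integral>v. \<bar>\<Phi> (set_coord x t v) $ t\<bar> powr p \<partial>\<kappa> t x)"
    unfolding pair_kernel_def using cm by (subst integral_distr) (auto simp: eq)
  have "(\<integral>(x, y). \<bar>x - y\<bar> powr p \<partial>pair_kernel t (x, y)) powr (1 / p)
      = \<delta> * (\<integral>v. \<bar>\<Phi> (set_coord x t v) $ t\<bar> powr p \<partial>\<kappa> t x) powr (1 / p)"
    unfolding I using \<delta>_pos p_ge by (simp add: powr_mult powr_powr)
  also have "\<dots> \<le> \<delta> * c" using \<delta>_pos \<Phi>_norm by (intro mult_left_mono) auto
  also have "\<dots> < \<delta>" using \<delta>_pos c by simp
  finally have "cost p (pair_kernel t (x, y)) < ereal \<delta>"
    unfolding cost_def using i by simp
  then show ?thesis using pr 1 by (simp add: near_couplings_def)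
qed

lemma move_strict_mono: assumes "u < v" shows "move t x u < move t x v"
proof -
  have "\<delta> * (\<Phi> (set_coord x t u) $ t - \<Phi> (set_coord x t v) $ t) \<le> \<delta> * (L * \<bar>u - v\<bar>)"
    using \<Phi>_lipschitz[of x t u v] \<delta>_pos by (intro mult_left_mono) auto
  also have "\<dots> = (\<delta> * L) * (v - u)" using assms by simp
  also have "\<dots> < 1 * (v - u)" using assms \<delta>_L by (intro mult_strict_right_mono) auto
  finally show ?thesis by (simp add: move_def algebra_simps)
qed

lemma L_nonneg: "0 \<le> L"
  using order_trans[OF abs_ge_zero \<Phi>_lipschitz[of 0 undefined 1 0]] by simp

text \<open>A preimage of \<open>w\<close> is a fixed point of \<open>h\<close>, a contraction with
  factor \<open>\<delta> * L\<close>.\<close>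

lemma move_surj: "\<exists>v. move t x v = w"
proof -
  define h where "h v = w - \<delta> * \<Phi> (set_coord x t v) $ t" for v
  have "\<exists>!v\<in>UNIV. h v = v"
  proof (rule Banach_fix)
    show "dist (h u) (h v) \<le> (\<delta> * L) * dist u v" for u v
    proof -
      have "dist (h u) (h v) = \<delta> * \<bar>\<Phi> (set_coord x t u) $ t - \<Phi> (set_coord x t v) $ t\<bar>"
      proof -
        have "h u - h v = (- \<delta>) * (\<Phi> (set_coord x t u) $ t - \<Phi> (set_coord x t v) $ t)"
          by (simp add: h_def algebra_simps)
        then show ?thesis using \<delta>_pos by (simp add: dist_real_def abs_mult)
      qed
      also have "\<dots> \<le> \<delta> * (L * \<bar>u - v\<bar>)" using \<delta>_pos \<Phi>_lipschitz by (intro mult_left_mono) auto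
      finally show "dist (h u) (h v) \<le> (\<delta> * L) * dist u v" by (simp add: dist_real_def)
    qed
  qed (use \<delta>_pos \<delta>_L L_nonneg in \<open>auto simp: complete_UNIV\<close>)
  then obtain v where "h v = v" by auto
  then show ?thesis by (intro exI[of _ v]) (simp add: h_def move_def)
qed

definition unmove :: "'n \<Rightarrow> 'n pts \<Rightarrow> real \<Rightarrow> real" where
  "unmove t x w = (THE v. move t x v = w)"

lemma unmove_move[simp]: "unmove t x (move t x v) = v"
  unfolding unmove_def
proof (rule the_equality)
  show "move t x u = move t x v \<Longrightarrow> u = v" for u
    using move_strict_mono[of u v t x] move_strict_mono[of v u t x] by (cases u v rule: linorder_cases) auto
qed simp

text \<open>For a strictly increasing bijection the sublevel sets of the inverse are described by
  the map itself. This gives joint measurability of \<open>unmove\<close> in the past and the value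
  at once.\<close>

lemma unmove_le_iff: "unmove t x w \<le> v \<longleftrightarrow> w \<le> move t x v"
proof -
  obtain u where u: "w = move t x u" using move_surj[of t x w] by blast
  show ?thesis
    unfolding u unmove_move
    using move_strict_mono[of u v t x] move_strict_mono[of v u t x]
    by (cases u v rule: linorder_cases) auto
qed

lemma unmove_measurable[measurable]:
  assumes [measurable]: "X \<in> N \<rightarrow>\<^sub>M borel" "h \<in> N \<rightarrow>\<^sub>M borel"
  shows "(\<lambda>w. unmove t (X w) (h w)) \<in> borel_measurable N"
  by (rule borel_measurableI_le) (simp add: unmove_le_iff)

lemma unmove_cong: "same_pts {..<t} x x' \<Longrightarrow> unmove t x w = unmove t x' w"
  unfolding unmove_def by (simp only: move_cong[of t x x'])

text \<open>Solves the triangular system in the order of time: when \<open>t\<close> is reached, the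
  earlier coordinates of the preimage are already in place, and \<open>unmove\<close> reads no
  others. The initial 0 is therefore immaterial.\<close>

definition invert_on :: "'n list \<Rightarrow> 'n pts \<Rightarrow> 'n pts" where
  "invert_on ts y = foldl (\<lambda>x t. set_coord x t (unmove t x (y $ t))) 0 ts"

definition invert :: "'n pts \<Rightarrow> 'n pts" where
  "invert = invert_on (sorted_list_of_set UNIV)"

lemma invert_on_snoc: "invert_on (ts @ [t]) y =
    set_coord (invert_on ts y) t (unmove t (invert_on ts y) (y $ t))"
  by (simp add: invert_on_def)

lemma invert_on_measurable[measurable]: "invert_on ts \<in> borel \<rightarrow>\<^sub>M borel"
proof (induction ts rule: rev_induct)
  case Nil
  show ?case by (simp add: invert_on_def[abs_def])
next
  case (snoc t ts)
  note [measurable] = snoc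
  show ?case unfolding invert_on_snoc[abs_def] by measurable
qed

lemma invert_measurable[measurable]: "invert \<in> borel \<rightarrow>\<^sub>M borel"
  unfolding invert_def by measurable

lemma invert_on_transport:
  assumes "sorted_wrt (<) ts" "\<And>s t. t \<in> set ts \<Longrightarrow> s \<le> t \<Longrightarrow> s \<in> set ts"
  shows "same_pts (set ts) (invert_on ts (transport x)) x"
  using assms
proof (induction ts rule: rev_induct)
  case Nil
  show ?case by (simp add: same_pts_def)
next
  case (snoc t ts)
  have sorted: "sorted_wrt (<) ts" "\<And>s. s \<in> set ts \<Longrightarrow> s < t"
    using snoc.prems(1) by (auto simp: sorted_wrt_append)
  have "r \<in> set ts" if "s \<in> set ts" "r \<le> s" for r s
    using snoc.prems(2)[of s r] that sorted(2)[of s] by auto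
  then have IH: "same_pts (set ts) (invert_on ts (transport x)) x"
    by (rule snoc.IH[OF sorted(1)])
  have "{..<t} \<subseteq> set ts"
    using snoc.prems(2)[of t] by (auto simp: order.order_iff_strict)
  then have "same_pts {..<t} (invert_on ts (transport x)) x"
    using IH by (auto simp: same_pts_def)
  then have "unmove t (invert_on ts (transport x)) (transport x $ t) = x $ t"
    unfolding transport_eq_move by (rule trans[OF unmove_cong unmove_move])
  then show ?case using IH by (auto simp: invert_on_snoc same_pts_def)
qed

lemma invert_transport: "invert (transport x) = x"
proof -
  have "same_pts (set (sorted_list_of_set UNIV)) (invert (transport x)) x"
    unfolding invert_def by (rule invert_on_transport) auto
  then show ?thesis by (simp add: same_pts_def vec_eq_iff)
qed

lemma invert_on_cong: "same_pts (set ts) y y' \<Longrightarrow> invert_on ts y = invert_on ts y'"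
  by (induction ts rule: rev_induct) (auto simp: invert_on_snoc same_pts_def, simp add: invert_on_def)

lemma invert_on_append: "T \<inter> set us = {} \<Longrightarrow> same_pts T (invert_on (ts @ us) y) (invert_on ts y)"
proof (induction us rule: rev_induct)
  case Nil
  show ?case by (simp add: same_pts_def)
next
  case (snoc u us)
  then have IH: "same_pts T (invert_on (ts @ us) y) (invert_on ts y)" by auto
  show ?case
    unfolding append_assoc[symmetric] invert_on_snoc using IH snoc.prems by (auto simp: same_pts_def)
qed

text \<open>The inverse is adapted, because times from \<open>t\<close> on are processed last and do
  not touch earlier coordinates. Thanks to this, kernels of \<open>x\<close> can be turned into
  kernels of \<open>y\<close>.\<close>

lemma invert_cong:
  assumes "same_pts {..<t} y y'" shows "same_pts {..<t} (invert y) (invert y')"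
proof -
  have "sorted_list_of_set ({..<t} \<union> {t..}) = sorted_list_of_set {..<t} @ sorted_list_of_set {t..}"
    by (rule sorted_list_of_set_Un) auto
  moreover have "{..<t} \<union> {t..} = UNIV" by auto
  ultimately have inv: "invert z = invert_on (sorted_list_of_set {..<t} @ sorted_list_of_set {t..}) z" for z
    by (simp add: invert_def)
  have s: "same_pts {..<t} (invert z) (invert_on (sorted_list_of_set {..<t}) z)" for z
    unfolding inv by (rule invert_on_append) auto
  have "invert_on (sorted_list_of_set {..<t}) y = invert_on (sorted_list_of_set {..<t}) y'"
    using assms by (intro invert_on_cong) simp
  then show ?thesis using s[of y] s[of y'] by (simp add: same_pts_def)
qed

text \<open>The conditional law of the second marginal given its own past: the past of
  \<open>x\<close> is recovered from that of \<open>y\<close>, which is the point of having an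
  adapted inverse.\<close>

definition image_kernel :: "'n \<Rightarrow> 'n pts \<Rightarrow> real measure" where
  "image_kernel t y = distr (\<kappa> t (invert y)) borel (move t (invert y))"

lemma image_kernels: "kernels image_kernel"
  unfolding kernels_def
proof (intro allI conjI impI)
  fix t
  have k: "(\<lambda>y. \<kappa> t (invert y)) \<in> borel \<rightarrow>\<^sub>M prob_algebra borel" by measurable
  have m: "(\<lambda>(y, v). move t (invert y) v) \<in> borel \<Otimes>\<^sub>M borel \<rightarrow>\<^sub>M borel"
    unfolding split_beta by measurable
  show "image_kernel t \<in> borel \<rightarrow>\<^sub>M prob_algebra borel"
    unfolding image_kernel_def[abs_def] by (rule measurable_distr_prob_space2[OF k m])
  fix y y' :: "'n pts" assume "agree_before t y y'"
  then have "same_pts {..<t} (invert y) (invert y')"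
    by (intro invert_cong) (auto simp: agree_before_def same_pts_def)
  then show "image_kernel t y = image_kernel t y'"
    unfolding image_kernel_def using M.kernel_cong move_cong by (metis ext)
qed

sublocale I: kernel_chain set_coord image_kernel same_pts
  by (rule kernel_chain_pts[OF image_kernels])

text \<open>The intertwining condition is required only at points \<open>transport z\<close>, and
  there \<open>invert\<close> returns \<open>z\<close>; hence a left inverse suffices.\<close>

lemma image_disintegration: "disintegration (distr graph_law borel snd) image_kernel"
proof -
  have "distr graph_law borel snd = distr \<mu> borel transport"
    unfolding graph_law_def using graph_measurable sets_\<mu> by (subst distr_distr) (auto simp: comp_def)
  also have "\<dots> = distr (M.law UNIV 0) borel transport"
    by (simp flip: \<mu>_law)
  also have "\<dots> = I.law UNIV (transport 0)"
    unfolding M.law_eq_chain I.law_eq_chain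
  proof (rule chain_intertwine[OF M.kernel_chain_axioms I.kernel_chain_axioms transport_measurable,
        where \<psi>=move])
    show "move t x \<in> borel \<rightarrow>\<^sub>M borel" for t x by measurable
  qed (auto simp: image_kernel_def invert_transport same_transport)
  also have "\<dots> = I.law UNIV 0" by (rule I.law_UNIV_const)
  finally show ?thesis
    using image_kernels by (simp add: disintegration_def I.law_def)
qed

lemma graph_law_Pi_bc: "graph_law \<in> Pi_bc p \<kappa> \<delta>"
proof -
  \<comment> \<open>On the graph the second path determines the first, so
    \<open>image_kernel\<close> at \<open>snd z\<close> is built from the actual past of
    \<open>fst z\<close> and is the second marginal of \<open>pair_kernel t z\<close>.\<close>
  have "AE z in graph_law. invert (snd z) = fst z"
  proof -
    have "{z \<in> space borel. invert (snd z) = fst z} \<in> sets (borel :: ('n pts \<times> 'n pts) measure)"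
      by measurable
    then show ?thesis
      unfolding graph_law_def by (subst AE_distr_iff) (auto simp: invert_transport)
  qed
  then have "AE z in graph_law. pair_kernel t z \<in> couplings (\<kappa> t (fst z)) (image_kernel t (snd z))" for t
  proof eventually_elim
    case (elim z)
    have [measurable]: "(\<lambda>v. (v, move t (fst z) v)) \<in> borel \<rightarrow>\<^sub>M borel"
      unfolding borel_prod[symmetric] by measurable
    have "distr (pair_kernel t z) borel snd = image_kernel t (snd z)"
      unfolding pair_kernel_def image_kernel_def elim by (subst distr_distr) (auto simp: comp_def)
    moreover have "pair_kernel t z \<in> borel_probs" "distr (pair_kernel t z) borel fst = \<kappa> t (fst z)"
      using pair_kernel_near[of t "fst z" "snd z"] by (auto simp: near_couplings_def)
    ultimately show ?case by (simp add: couplings_def)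
  qed
  then have "bicausal \<kappa> graph_law"
    unfolding bicausal_def using pair_disintegration image_disintegration by blast
  moreover have "graph_law \<in> Pi_near p \<kappa> \<delta>"
    unfolding Pi_near_def using pair_disintegration pair_kernel_near by blast
  ultimately show ?thesis by (simp add: Pi_bc_def)
qed

end

section \<open>Almost extremal directions\<close>

lemma set_coord_set_coord[simp]: "set_coord (set_coord x t u) t v = set_coord x t v"
  by (simp add: vec_eq_iff)

text \<open>A canonical representative among the paths that agree up to \<open>t\<close>; composing
  any function with it makes the function adapted.\<close>

definition past :: "'n::{finite,linorder} \<Rightarrow> 'n pts \<Rightarrow> 'n pts" where
  "past t x = (\<chi> i. if i \<le> t then x $ i else 0)"

lemma same_past: "same_pts {..t} x x' \<Longrightarrow> past t x = past t x'"
  by (simp add: past_def same_pts_def vec_eq_iff)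

lemma same_pts_past: "same_pts {..t} x (past t x)"
  by (simp add: past_def same_pts_def)

lemma past_measurable[measurable]: "past t \<in> borel \<rightarrow>\<^sub>M borel"
  unfolding past_def
proof (rule vec_lambda_measurable)
  show "(\<lambda>x. if i \<le> t then x $ i else 0) \<in> borel_measurable (borel :: 'a pts measure)" for i
    by (cases "i \<le> t") auto
qed

lemma dist_past_set_coord: "dist (past t (set_coord x t u)) (past t (set_coord x t v)) = \<bar>u - v\<bar>"
proof -
  have "past t (set_coord x t u) - past t (set_coord x t v) = axis t (u - v)"
    by (simp add: past_def vec_eq_iff axis_def)
  then show ?thesis by (simp add: dist_norm norm_eq_sqrt_inner inner_axis_axis)
qed

context robust_setting
begin

interpretation mu: prob_space \<mu> by (rule prob_\<mu>)

lemma integral_kernel_measurable: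
  assumes [measurable]: "h \<in> borel_measurable borel"
  shows "(\<lambda>x. \<integral>v. h (set_coord x t v) \<partial>\<kappa> t x :: real) \<in> borel_measurable borel"
proof -
  have "M.step t \<in> borel \<rightarrow>\<^sub>M subprob_algebra borel" by measurable
  then have "(\<lambda>x. \<integral>z. h z \<partial>M.step t x) \<in> borel_measurable borel"
    by (rule measurable_compose[OF _ integral_measurable_subprob_algebra]) measurable
  moreover have "(\<integral>z. h z \<partial>M.step t x) = (\<integral>v. h (set_coord x t v) \<partial>\<kappa> t x)" for x
    unfolding M.step_def by (subst integral_distr) auto
  ultimately show ?thesis by simp
qed

lemma kernel_cong_lessThan:
  assumes "same_pts {..<t} x x'" "M.adapted t h"
  shows "\<kappa> t x = \<kappa> t x'" "h (set_coord x t v) = h (set_coord x' t v)"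
proof -
  show "\<kappa> t x = \<kappa> t x'" using assms(1) by (rule M.kernel_cong)
  have "same_pts {..t} (set_coord x t v) (set_coord x' t v)"
    using assms(1) by (auto simp: same_pts_def order.order_iff_strict)
  then show "h (set_coord x t v) = h (set_coord x' t v)"
    using assms(2) unfolding M.adapted_def by blast
qed

lemma integral_kernel_cong:
  assumes "same_pts {..<t} x x'" "M.adapted t h"
  shows "(\<integral>v. G (h (set_coord x t v)) \<partial>\<kappa> t x) = (\<integral>v. G (h (set_coord x' t v)) \<partial>\<kappa> t x')"
  unfolding kernel_cong_lessThan[OF assms] ..

lemma same_lessThan_set_coord: "same_pts {..<t} (set_coord x t v) (x :: 'n pts)"
  by (simp add: same_pts_def)

lemma adapted_past: "M.adapted t (\<lambda>x. h (past t x))"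
  unfolding M.adapted_def
proof (intro allI impI)
  fix x x' :: "'n pts" assume "same_pts {..t} x x'"
  then have "past t x = past t x'" by (rule same_past)
  then show "h (past t x) = h (past t x')" by simp
qed

lemma adapted_eq_past: "M.adapted t h \<Longrightarrow> h (past t x) = h x"
  unfolding M.adapted_def using same_pts_past[of t x] by simp

lemma adapted_binop:
  assumes "M.adapted t h" "M.adapted t h'" shows "M.adapted t (\<lambda>x. G (h x) (h' x))"
  unfolding M.adapted_def
proof (intro allI impI)
  fix x x' :: "'n pts" assume "same_pts {..t} x x'"
  then have "h x = h x'" "h' x = h' x'" using assms unfolding M.adapted_def by blast+
  then show "G (h x) (h' x) = G (h x') (h' x')" by simp
qed

text \<open>The equality case of the conditional Hoelder inequality, i.e. the dual element of
  \<open>F\<close> in L^p. If the conditional norm vanishes, division by zero makes it 0.\<close>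

definition extremal :: "'n \<Rightarrow> ('n pts \<Rightarrow> real) \<Rightarrow> 'n pts \<Rightarrow> real" where
  "extremal t F x = sgn (F x) * \<bar>F x\<bar> powr (q - 1) / cond_norm t F x powr (q - 1)"

context
  fixes t :: 'n and F :: "'n pts \<Rightarrow> real"
  assumes F[measurable]: "F \<in> borel_measurable borel" and F_adapted: "M.adapted t F"
    and F_int: "integrable \<mu> (\<lambda>x. \<bar>F x\<bar> powr q)"
begin

lemma cond_norm_cong: "same_pts {..<t} x x' \<Longrightarrow> cond_norm t F x = cond_norm t F x'"
  unfolding cond_norm_def Lnorm_def using integral_kernel_cong[OF _ F_adapted, of x x' "\<lambda>r. \<bar>r\<bar> powr q"] by simp

lemma extremal_measurable: "extremal t F \<in> borel_measurable borel"
  unfolding extremal_def[abs_def] by measurable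

lemma extremal_adapted: "M.adapted t (extremal t F)"
proof -
  have "M.adapted t (cond_norm t F)"
    unfolding M.adapted_def by (auto intro!: cond_norm_cong simp: same_pts_def)
  from adapted_binop[OF F_adapted this, of "\<lambda>a b. sgn a * \<bar>a\<bar> powr (q - 1) / b powr (q - 1)"]
  show ?thesis unfolding extremal_def .
qed

lemma extremal_powr: "\<bar>extremal t F x\<bar> powr p = \<bar>F x\<bar> powr q / cond_norm t F x powr q"
proof (cases "F x = 0")
  case True
  then show ?thesis by (simp add: extremal_def)
next
  case False
  then have "\<bar>extremal t F x\<bar> powr p = (\<bar>F x\<bar> powr (q - 1)) powr p / (cond_norm t F x powr (q - 1)) powr p"
    by (simp add: extremal_def abs_mult powr_divide abs_sgn_eq)
  then show ?thesis by (simp add: powr_powr qp)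
qed

lemma mult_extremal: "F x * extremal t F x = \<bar>F x\<bar> powr q / cond_norm t F x powr (q - 1)"
proof (cases "F x = 0")
  case False
  have "F x * sgn (F x) = \<bar>F x\<bar>" by (simp add: abs_sgn mult.commute)
  then have "F x * extremal t F x = \<bar>F x\<bar> * \<bar>F x\<bar> powr (q - 1) / cond_norm t F x powr (q - 1)"
    by (simp add: extremal_def mult.assoc[symmetric])
  also have "\<bar>F x\<bar> * \<bar>F x\<bar> powr (q - 1) = \<bar>F x\<bar> powr q"
    using False powr_add[of "\<bar>F x\<bar>" 1 "q - 1"] by simp
  finally show ?thesis .
qed (simp add: extremal_def)

text \<open>By \<open>(q - 1) * p = q\<close> the conditional norm of the extremal function is 1,
  except at pasts where that of \<open>F\<close> vanishes and both are 0; hence an inequality in the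
  first claim and an identity in the second.\<close>

lemma
  shows AE_extremal_norm: "AE x in \<mu>. (\<integral>v. \<bar>extremal t F (set_coord x t v)\<bar> powr p \<partial>\<kappa> t x) \<le> 1
      \<and> integrable (\<kappa> t x) (\<lambda>v. \<bar>extremal t F (set_coord x t v)\<bar> powr p)"
    and AE_extremal_integral: "AE x in \<mu>. integrable (\<kappa> t x) (\<lambda>v. F (set_coord x t v) * extremal t F (set_coord x t v))
      \<and> (\<integral>v. F (set_coord x t v) * extremal t F (set_coord x t v) \<partial>\<kappa> t x) = cond_norm t F x"
proof -
  have N: "cond_norm t F (set_coord x t v) = cond_norm t F x" for x v
    by (rule cond_norm_cong[OF same_lessThan_set_coord])
  have Nq: "cond_norm t F x powr q = (\<integral>v. \<bar>F (set_coord x t v)\<bar> powr q \<partial>\<kappa> t x)" for x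
    unfolding cond_norm_def Lnorm_def using q_gt_1 by (simp add: powr_powr)
  have Nq1: "cond_norm t F x powr q / cond_norm t F x powr (q - 1) = cond_norm t F x" for x
    using cond_norm_nonneg[of t F x] by (cases "cond_norm t F x = 0") (simp_all flip: powr_diff)
  note ae = AE_integrable_cond[OF F F_adapted F_int]
  from ae show "AE x in \<mu>. (\<integral>v. \<bar>extremal t F (set_coord x t v)\<bar> powr p \<partial>\<kappa> t x) \<le> 1
      \<and> integrable (\<kappa> t x) (\<lambda>v. \<bar>extremal t F (set_coord x t v)\<bar> powr p)"
    by eventually_elim (simp add: extremal_powr N Nq[symmetric])
  from ae show "AE x in \<mu>. integrable (\<kappa> t x) (\<lambda>v. F (set_coord x t v) * extremal t F (set_coord x t v))
      \<and> (\<integral>v. F (set_coord x t v) * extremal t F (set_coord x t v) \<partial>\<kappa> t x) = cond_norm t F x"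
    by eventually_elim (simp add: mult_extremal N Nq[symmetric] Nq1)
qed

text \<open>The product is nonnegative, so it can be disintegrated before its integrability is
  known.\<close>

lemma
  shows integrable_mult_extremal: "integrable \<mu> (\<lambda>x. F x * extremal t F x)"
    and integral_mult_extremal: "(\<integral>x. F x * extremal t F x \<partial>\<mu>) = (\<integral>x. cond_norm t F x \<partial>\<mu>)"
proof -
  note [measurable] = extremal_measurable
  have nn: "0 \<le> F x * extremal t F x" for x by (simp add: mult_extremal)
  have a: "M.adapted t (\<lambda>x. ennreal (F x * extremal t F x))"
    by (rule adapted_binop[OF F_adapted extremal_adapted, of "\<lambda>a b. ennreal (a * b)"])
  have "(\<integral>\<^sup>+x. ennreal (F x * extremal t F x) \<partial>\<mu>)
      = (\<integral>\<^sup>+x. \<integral>\<^sup>+v. ennreal (F (set_coord x t v) * extremal t F (set_coord x t v)) \<partial>\<kappa> t x \<partial>\<mu>)"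
    by (rule M.nn_integral_adapted[OF \<mu>_law _ a, symmetric]) measurable
  also have "\<dots> = (\<integral>\<^sup>+x. ennreal (cond_norm t F x) \<partial>\<mu>)"
  proof (rule nn_integral_cong_AE)
    show "AE x in \<mu>. (\<integral>\<^sup>+v. ennreal (F (set_coord x t v) * extremal t F (set_coord x t v)) \<partial>\<kappa> t x)
        = ennreal (cond_norm t F x)"
      using AE_extremal_integral
      by eventually_elim (simp add: nn_integral_eq_integral nn)
  qed
  also have "\<dots> = ennreal (\<integral>x. cond_norm t F x \<partial>\<mu>)"
    using integrable_cond_norm[OF F F_adapted F_int] cond_norm_nonneg by (intro nn_integral_eq_integral) auto
  finally have eq: "(\<integral>\<^sup>+x. ennreal (F x * extremal t F x) \<partial>\<mu>) = ennreal (\<integral>x. cond_norm t F x \<partial>\<mu>)" .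
  then show "integrable \<mu> (\<lambda>x. F x * extremal t F x)"
    using nn by (intro integrableI_nonneg) auto
  show "(\<integral>x. F x * extremal t F x \<partial>\<mu>) = (\<integral>x. cond_norm t F x \<partial>\<mu>)"
  proof -
    have "0 \<le> (\<integral>x. cond_norm t F x \<partial>\<mu>)" by (simp add: cond_norm_nonneg)
    then show ?thesis using nn eq by (subst integral_eq_nn_integral) auto
  qed
qed

text \<open>Clamping preserves the sign and shrinks the absolute value, so the nonnegative function
  \<open>F x * extremal t F x\<close> dominates all truncated products.\<close>

lemma truncated_extremal:
  assumes \<eta>: "0 < \<eta>"
  obtains R where "0 < R" "(\<integral>x. F x * max (- R) (min R (extremal t F x)) \<partial>\<mu>) > (\<integral>x. cond_norm t F x \<partial>\<mu>) - \<eta>"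
proof -
  note [measurable] = extremal_measurable
  define \<psi> where "\<psi> n x = max (- real n) (min (real n) (extremal t F x))" for n :: nat and x
  have "(\<lambda>n. \<integral>x. F x * \<psi> n x \<partial>\<mu>) \<longlonglongrightarrow> (\<integral>x. F x * extremal t F x \<partial>\<mu>)"
  proof (rule integral_dominated_convergence[where w="\<lambda>x. F x * extremal t F x"])
    show "AE x in \<mu>. (\<lambda>n. F x * \<psi> n x) \<longlonglongrightarrow> F x * extremal t F x"
    proof (intro AE_I2 tendsto_mult tendsto_const)
      fix x
      obtain n0 where n0: "\<bar>extremal t F x\<bar> \<le> real n0" using real_arch_simple by blast
      show "(\<lambda>n. \<psi> n x) \<longlonglongrightarrow> extremal t F x"
      proof (rule tendsto_eventually)
        show "\<forall>\<^sub>F n in sequentially. \<psi> n x = extremal t F x"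
          using eventually_ge_at_top[of n0]
        proof eventually_elim
          case (elim n)
          then have "\<bar>extremal t F x\<bar> \<le> real n" using n0 by linarith
          then show ?case by (auto simp: \<psi>_def)
        qed
      qed
    qed
    show "AE x in \<mu>. norm (F x * \<psi> n x) \<le> F x * extremal t F x" for n
    proof (rule AE_I2)
      fix x
      have "0 \<le> F x * extremal t F x" by (simp add: mult_extremal)
      then have "F x * extremal t F x = \<bar>F x\<bar> * \<bar>extremal t F x\<bar>" by (simp flip: abs_mult)
      moreover have "\<bar>\<psi> n x\<bar> \<le> \<bar>extremal t F x\<bar>" by (auto simp: \<psi>_def)
      ultimately show "norm (F x * \<psi> n x) \<le> F x * extremal t F x"
        by (simp add: abs_mult mult_left_mono)
    qed
  qed (auto simp: \<psi>_def[abs_def] integrable_mult_extremal)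
  then have "\<forall>\<^sub>F n in sequentially. (\<integral>x. F x * \<psi> n x \<partial>\<mu>) > (\<integral>x. cond_norm t F x \<partial>\<mu>) - \<eta>"
    using \<eta> by (intro order_tendstoD(1)) (auto simp: integral_mult_extremal)
  then have "\<forall>\<^sub>F n in sequentially. (\<integral>x. F x * \<psi> n x \<partial>\<mu>) > (\<integral>x. cond_norm t F x \<partial>\<mu>) - \<eta> \<and> 0 < n"
    using eventually_gt_at_top[of "0::nat"] by eventually_elim simp
  then obtain n where "(\<integral>x. F x * \<psi> n x \<partial>\<mu>) > (\<integral>x. cond_norm t F x \<partial>\<mu>) - \<eta>" "0 < n"
    by (auto simp: eventually_sequentially)
  then show thesis by (intro that[of "real n"]) (auto simp: \<psi>_def)
qed

text \<open>The extremal function is truncated, approximated by functions that are Lipschitz in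
  the coordinates up to \<open>t\<close>, and renormalised so that the norm constraint holds for every past;
  the normalising factor does not depend on coordinate \<open>t\<close>, hence keeps the Lipschitz bound.\<close>

lemma lipschitz_almost_extremal:
  assumes \<eta>: "0 < \<eta>"
  obtains \<phi> R L where "\<phi> \<in> borel_measurable borel" "M.adapted t \<phi>" "\<And>x. \<bar>\<phi> x\<bar> \<le> R" "0 \<le> L"
    "\<And>x u v. \<bar>\<phi> (set_coord x t u) - \<phi> (set_coord x t v)\<bar> \<le> L * \<bar>u - v\<bar>"
    "\<And>x. (\<integral>v. \<bar>\<phi> (set_coord x t v)\<bar> powr p \<partial>\<kappa> t x) powr (1 / p) \<le> 1"
    "(\<integral>x. F x * \<phi> x \<partial>\<mu>) > (\<integral>x. cond_norm t F x \<partial>\<mu>) - \<eta>"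
proof -
  note [measurable] = extremal_measurable
  obtain R where R: "0 < R"
    "(\<integral>x. F x * max (- R) (min R (extremal t F x)) \<partial>\<mu>) > (\<integral>x. cond_norm t F x \<partial>\<mu>) - \<eta> / 2"
    using truncated_extremal[of "\<eta> / 2"] \<eta> by auto
  define \<psi> where "\<psi> x = max (- R) (min R (extremal t F x))" for x
  have \<psi>m[measurable]: "\<psi> \<in> borel_measurable borel" unfolding \<psi>_def[abs_def] by measurable
  have \<psi>R: "\<bar>\<psi> x\<bar> \<le> R" for x using R by (auto simp: \<psi>_def)
  have \<psi>_adapted: "M.adapted t \<psi>"
    unfolding \<psi>_def by (rule adapted_binop[OF extremal_adapted extremal_adapted, of "\<lambda>a _. max (- R) (min R a)"])
  \<comment> \<open>The approximation takes place under the law of \<open>past t\<close>, so that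
    composing the approximants with \<open>past t\<close> makes them adapted; by
    \<open>dist_past_set_coord\<close> they are then Lipschitz in coordinate \<open>t\<close> with
    the same constant.\<close>
  interpret pm: prob_space "distr \<mu> borel (past t)" by (rule mu.prob_space_distr) measurable
  obtain g L where g: "\<And>n x y. \<bar>g n x - g n y\<bar> \<le> L n * dist x y" "\<And>n x. \<bar>g n x\<bar> \<le> R"
    and gm[measurable]: "\<And>n. g n \<in> borel_measurable borel"
    and glim: "AE x in distr \<mu> borel (past t). (\<lambda>n. g n x) \<longlonglongrightarrow> \<psi> x"
    by (rule lipschitz_approx_AE[OF pm.finite_measure_axioms sets_distr \<psi>m \<psi>R]) (rule that; assumption)
  define G where "G n x = g n (past t x)" for n x
  have Gm[measurable]: "G n \<in> borel_measurable borel" for n unfolding G_def[abs_def] by measurable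
  have GR: "\<bar>G n x\<bar> \<le> R" for n x unfolding G_def by (rule g)
  have G_adapted: "M.adapted t (G n)" for n unfolding G_def[abs_def] by (rule adapted_past)
  have G_lip: "\<bar>G n (set_coord x t u) - G n (set_coord x t v)\<bar> \<le> \<bar>L n\<bar> * \<bar>u - v\<bar>" for n x u v
    using g(1)[of n "past t (set_coord x t u)" "past t (set_coord x t v)"]
      mult_right_mono[OF abs_ge_self[of "L n"], of "\<bar>u - v\<bar>"]
    unfolding G_def dist_past_set_coord by simp
  have "AE x in \<mu>. (\<lambda>n. g n (past t x)) \<longlonglongrightarrow> \<psi> (past t x)"
    using AE_distrD[OF _ glim] by simp
  then have Glim: "AE x in \<mu>. (\<lambda>n. G n x) \<longlonglongrightarrow> \<psi> x"
    unfolding G_def adapted_eq_past[OF \<psi>_adapted] .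
  \<comment> \<open>Convergence in countable quantifiers, which makes it a measurable adapted
    predicate, as required for conditioning on the past.\<close>
  define P where "P x \<longleftrightarrow> (\<forall>k::nat. \<exists>N. \<forall>n\<ge>N. \<bar>G n x - \<psi> x\<bar> < 1 / Suc k)" for x
  have P_iff: "P x \<longleftrightarrow> (\<lambda>n. G n x) \<longlonglongrightarrow> \<psi> x" for x
  proof
    assume P: "P x"
    show "(\<lambda>n. G n x) \<longlonglongrightarrow> \<psi> x"
    proof (rule LIMSEQ_I)
      fix r :: real assume "0 < r"
      then obtain k :: nat where "1 / Suc k < r" using nat_approx_posE by auto
      moreover obtain N where "\<forall>n\<ge>N. \<bar>G n x - \<psi> x\<bar> < 1 / Suc k" using P unfolding P_def by blast
      ultimately show "\<exists>no. \<forall>n\<ge>no. norm (G n x - \<psi> x) < r" by (metis order_less_trans real_norm_def)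
    qed
  next
    assume lim: "(\<lambda>n. G n x) \<longlonglongrightarrow> \<psi> x"
    show "P x"
      unfolding P_def
    proof
      fix k :: nat
      have "0 < 1 / real (Suc k)" by simp
      from LIMSEQ_D[OF lim this] show "\<exists>N. \<forall>n\<ge>N. \<bar>G n x - \<psi> x\<bar> < 1 / Suc k" by simp
    qed
  qed
  have "AE x in \<mu>. AE v in \<kappa> t x. P (set_coord x t v)"
  proof (rule M.AE_adapted[OF \<mu>_law])
    show "Measurable.pred borel P" unfolding P_def by measurable
    show "M.adapted t P"
      unfolding M.adapted_def
    proof (intro allI impI)
      fix x x' :: "'n pts" assume s: "same_pts {..t} x x'"
      have "G n x = G n x'" for n using G_adapted[of n] s unfolding M.adapted_def by blast
      moreover have "\<psi> x = \<psi> x'" using \<psi>_adapted s unfolding M.adapted_def by blast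
      ultimately show "P x = P x'" by (simp add: P_def)
    qed
    show "AE x in \<mu>. P x" unfolding P_iff by (rule Glim)
  qed
  then have Glim2: "AE x in \<mu>. AE v in \<kappa> t x. (\<lambda>n. G n (set_coord x t v)) \<longlonglongrightarrow> \<psi> (set_coord x t v)"
    unfolding P_iff .
  define a where "a n x = (\<integral>v. \<bar>G n (set_coord x t v)\<bar> powr p \<partial>\<kappa> t x)" for n x
  \<comment> \<open>With the maximum, the normalisation only ever shrinks \<open>G\<close>. It tends
    to 1, because the conditional norm of \<open>G\<close> tends to that of the truncated extremal
    function, which is at most 1; so the limit is not disturbed.\<close>
  define m where "m n x = max 1 (a n x powr (1 / p))" for n x
  have [measurable]: "a n \<in> borel_measurable borel" for n
    unfolding a_def[abs_def] by (rule integral_kernel_measurable) measurable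
  have mm[measurable]: "m n \<in> borel_measurable borel" for n
    unfolding m_def[abs_def] by measurable
  have m1: "1 \<le> m n x" for n x by (simp add: m_def)
  then have m0: "0 < m n x" and m_abs: "\<bar>m n x\<bar> = m n x" for n x
    by (smt (verit))+
  have m_cong: "m n x = m n x'" if "same_pts {..<t} x x'" for n x x'
    unfolding m_def a_def using integral_kernel_cong[OF that G_adapted, of "\<lambda>r. \<bar>r\<bar> powr p" n] by simp
  have m_set: "m n (set_coord x t v) = m n x" for n x v
    by (rule m_cong[OF same_lessThan_set_coord])
  define \<phi> where "\<phi> n x = G n x / m n x" for n x
  have \<phi>m[measurable]: "\<phi> n \<in> borel_measurable borel" for n unfolding \<phi>_def[abs_def] by measurable
  have \<phi>G: "\<bar>\<phi> n x\<bar> \<le> \<bar>G n x\<bar>" for n x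
    using m0[of n x] mult_left_mono[OF m1[of n x], of "\<bar>G n x\<bar>"]
    by (simp add: \<phi>_def abs_divide m_abs divide_le_eq)
  have \<phi>R: "\<bar>\<phi> n x\<bar> \<le> R" for n x by (rule order_trans[OF \<phi>G GR])
  have \<phi>_adapted: "M.adapted t (\<phi> n)" for n
  proof -
    have "M.adapted t (m n)"
      unfolding M.adapted_def by (auto intro!: m_cong simp: same_pts_def)
    from adapted_binop[OF G_adapted this, of "(/)" n] show ?thesis unfolding \<phi>_def[abs_def] .
  qed
  have \<phi>_lip: "\<bar>\<phi> n (set_coord x t u) - \<phi> n (set_coord x t v)\<bar> \<le> \<bar>L n\<bar> * \<bar>u - v\<bar>" for n x u v
  proof -
    have "\<bar>\<phi> n (set_coord x t u) - \<phi> n (set_coord x t v)\<bar>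
        = \<bar>G n (set_coord x t u) - G n (set_coord x t v)\<bar> / m n x"
      by (simp add: \<phi>_def m_set m_abs flip: diff_divide_distrib)
    also have "\<dots> \<le> \<bar>G n (set_coord x t u) - G n (set_coord x t v)\<bar> / 1"
      using m1[of n x] by (intro divide_left_mono) auto
    also have "\<dots> \<le> \<bar>L n\<bar> * \<bar>u - v\<bar>" using G_lip by simp
    finally show ?thesis .
  qed
  have \<phi>_norm: "(\<integral>v. \<bar>\<phi> n (set_coord x t v)\<bar> powr p \<partial>\<kappa> t x) powr (1 / p) \<le> 1" for n x
  proof -
    have "(\<integral>v. \<bar>\<phi> n (set_coord x t v)\<bar> powr p \<partial>\<kappa> t x) = (\<integral>v. \<bar>G n (set_coord x t v)\<bar> powr p / m n x powr p \<partial>\<kappa> t x)"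
      using m0[of n x] by (simp add: \<phi>_def m_set m_abs powr_divide)
    also have "\<dots> = a n x / m n x powr p" by (simp add: a_def)
    finally have "(\<integral>v. \<bar>\<phi> n (set_coord x t v)\<bar> powr p \<partial>\<kappa> t x) powr (1 / p) = a n x powr (1 / p) / m n x"
      using p_gt_1 m0[of n x] by (simp add: powr_divide powr_powr a_def)
    also have "\<dots> \<le> 1" using m0[of n x] by (simp add: m_def)
    finally show ?thesis .
  qed
  have "AE x in \<mu>. (\<lambda>n. \<phi> n x) \<longlonglongrightarrow> \<psi> x"
    using Glim Glim2 AE_extremal_norm
  proof eventually_elim
    case (elim x)
    interpret k: prob_space "\<kappa> t x" by (rule M.kernel_prob)
    have bR: "\<bar>r\<bar> powr p \<le> R powr p" if "\<bar>r\<bar> \<le> R" for r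
      using that p_gt_1 by (intro powr_mono2) auto
    have "(\<lambda>n. a n x) \<longlonglongrightarrow> (\<integral>v. \<bar>\<psi> (set_coord x t v)\<bar> powr p \<partial>\<kappa> t x)"
      unfolding a_def
    proof (rule integral_dominated_convergence[where w="\<lambda>_. R powr p"])
      show "AE v in \<kappa> t x. (\<lambda>n. \<bar>G n (set_coord x t v)\<bar> powr p) \<longlonglongrightarrow> \<bar>\<psi> (set_coord x t v)\<bar> powr p"
        using elim(2)
      proof eventually_elim
        case (elim v)
        have "((\<lambda>n. \<bar>G n (set_coord x t v)\<bar> powr p) \<longlongrightarrow> \<bar>\<psi> (set_coord x t v)\<bar> powr p) sequentially"
          using p_gt_1 by (intro tendsto_powr2 tendsto_rabs elim tendsto_const) auto
        then show ?case .
      qed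
      show "AE v in \<kappa> t x. norm (\<bar>G n (set_coord x t v)\<bar> powr p) \<le> R powr p" for n
        using bR[OF GR] by (intro AE_I2) simp
    qed auto
    then have "(\<lambda>n. max 1 (a n x powr (1 / p)))
        \<longlonglongrightarrow> max 1 ((\<integral>v. \<bar>\<psi> (set_coord x t v)\<bar> powr p \<partial>\<kappa> t x) powr (1 / p))"
      using p_gt_1 by (intro tendsto_max tendsto_powr2 tendsto_const) (auto simp: a_def)
    moreover have "(\<integral>v. \<bar>\<psi> (set_coord x t v)\<bar> powr p \<partial>\<kappa> t x) \<le> 1"
    proof -
      have "(\<integral>v. \<bar>\<psi> (set_coord x t v)\<bar> powr p \<partial>\<kappa> t x)
          \<le> (\<integral>v. \<bar>extremal t F (set_coord x t v)\<bar> powr p \<partial>\<kappa> t x)"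
      proof (rule integral_mono)
        show "integrable (\<kappa> t x) (\<lambda>v. \<bar>\<psi> (set_coord x t v)\<bar> powr p)"
          using bR[OF \<psi>R] by (intro k.integrable_const_bound[of _ "R powr p"]) auto
        show "integrable (\<kappa> t x) (\<lambda>v. \<bar>extremal t F (set_coord x t v)\<bar> powr p)" using elim by simp
        show "\<bar>\<psi> (set_coord x t v)\<bar> powr p \<le> \<bar>extremal t F (set_coord x t v)\<bar> powr p" for v
          using p_gt_1 R by (intro powr_mono2) (auto simp: \<psi>_def)
      qed
      then show ?thesis using elim by simp
    qed
    then have "(\<integral>v. \<bar>\<psi> (set_coord x t v)\<bar> powr p \<partial>\<kappa> t x) powr (1 / p) \<le> 1"
      using p_gt_1 by (intro powr_le1) auto
    ultimately have "(\<lambda>n. m n x) \<longlonglongrightarrow> 1" by (simp add: m_def max_absorb1)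
    then have "(\<lambda>n. G n x / m n x) \<longlonglongrightarrow> \<psi> x / 1" by (intro tendsto_divide elim(1)) auto
    then show ?case by (simp add: \<phi>_def)
  qed
  moreover have F1: "integrable \<mu> F"
    using holder_integrable[of p q F \<mu> "\<lambda>_. 1"] p_gt_1 q_gt_1 pq F_int by simp
  ultimately have "(\<lambda>n. \<integral>x. F x * \<phi> n x \<partial>\<mu>) \<longlonglongrightarrow> (\<integral>x. F x * \<psi> x \<partial>\<mu>)"
  proof (intro integral_dominated_convergence[where w="\<lambda>x. \<bar>F x\<bar> * R"])
    assume "AE x in \<mu>. (\<lambda>n. \<phi> n x) \<longlonglongrightarrow> \<psi> x"
    then show "AE x in \<mu>. (\<lambda>n. F x * \<phi> n x) \<longlonglongrightarrow> F x * \<psi> x"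
      by eventually_elim (intro tendsto_mult tendsto_const)
    show "AE x in \<mu>. norm (F x * \<phi> n x) \<le> \<bar>F x\<bar> * R" for n
      using \<phi>R by (intro AE_I2) (auto simp: abs_mult intro!: mult_left_mono)
  qed auto
  then have "\<forall>\<^sub>F n in sequentially. (\<integral>x. F x * \<phi> n x \<partial>\<mu>) > (\<integral>x. F x * \<psi> x \<partial>\<mu>) - \<eta> / 2"
    using \<eta> by (intro order_tendstoD(1)) auto
  then obtain n where "(\<integral>x. F x * \<phi> n x \<partial>\<mu>) > (\<integral>x. F x * \<psi> x \<partial>\<mu>) - \<eta> / 2"
    by (auto simp: eventually_sequentially)
  then have "(\<integral>x. F x * \<phi> n x \<partial>\<mu>) > (\<integral>x. cond_norm t F x \<partial>\<mu>) - \<eta>"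
    using R(2) by (simp add: \<psi>_def)
  with \<phi>m \<phi>_adapted \<phi>R abs_ge_zero \<phi>_lip \<phi>_norm show thesis by (rule that)
qed

end
end

section \<open>The sensitivity\<close>

context robust_setting
begin

interpretation mu: prob_space \<mu> by (rule prob_\<mu>)

lemma integrable_norm_Df_bound:
  obtains w where "integrable \<mu> w" "\<And>x a. a \<in> A \<Longrightarrow> norm (Df x a) \<le> w x"
proof -
  obtain B where B: "0 \<le> B" "\<And>x a. a \<in> A \<Longrightarrow> norm (Df x a) powr q \<le> B * (1 + norm x powr p)"
    using Df_powr_growth by metis
  show thesis
  proof (rule that)
    show "integrable \<mu> (\<lambda>x. 1 + B * (1 + norm x powr p))" using integrable_moment by auto
    fix x a :: "'n pts" assume a: "a \<in> A"
    have "norm (Df x a) \<le> 1 + norm (Df x a) powr q"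
      using powr_le_one_plus_powr[of "norm (Df x a)" 1 q] q_gt_1 by simp
    then show "norm (Df x a) \<le> 1 + B * (1 + norm x powr p)" using B(2)[OF a, of x] by linarith
  qed
qed

text \<open>The factor \<open>\<phi>\<close> is known at time \<open>t\<close> and is pulled out of
  the conditional expectation.\<close>

lemma integral_Df_mult_adapted:
  assumes \<alpha>: "\<alpha> \<in> controls K" and \<phi>[measurable]: "\<phi> \<in> borel_measurable borel"
    and ad: "M.adapted t \<phi>" and R: "\<And>x. \<bar>\<phi> x\<bar> \<le> R"
  shows "integrable \<mu> (\<lambda>x. Df x (\<alpha> x) $ t * \<phi> x)"
    and "(\<integral>x. Df x (\<alpha> x) $ t * \<phi> x \<partial>\<mu>) = (\<integral>x. cond_Df \<alpha> t x * \<phi> x \<partial>\<mu>)"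
proof -
  note [measurable] = Df_control_measurable[OF \<alpha>]
  show i: "integrable \<mu> (\<lambda>x. Df x (\<alpha> x) $ t * \<phi> x)"
  proof (rule Bochner_Integration.integrable_bound)
    show "integrable \<mu> (\<lambda>x. R * \<bar>Df x (\<alpha> x) $ t\<bar>)" using integrable_Df_control[OF \<alpha>] by simp
    have "0 \<le> R" using R[of undefined] by linarith
    then show "AE x in \<mu>. norm (Df x (\<alpha> x) $ t * \<phi> x) \<le> norm (R * \<bar>Df x (\<alpha> x) $ t\<bar>)"
      using R by (intro AE_I2) (simp add: abs_mult mult.commute mult_right_mono)
  qed measurable
  have "(\<integral>z. Df z (\<alpha> z) $ t * \<phi> z \<partial>M.law {t<..} x) = cond_Df \<alpha> t x * \<phi> x" for x
  proof -
    have "(\<integral>z. Df z (\<alpha> z) $ t * \<phi> z \<partial>M.law {t<..} x) = (\<integral>z. Df z (\<alpha> z) $ t * \<phi> x \<partial>M.law {t<..} x)"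
    proof (rule integral_cong_AE)
      show "AE z in M.law {t<..} x. Df z (\<alpha> z) $ t * \<phi> z = Df z (\<alpha> z) $ t * \<phi> x"
        using M.AE_law_adapted[OF ad] by eventually_elim simp
    qed measurable
    then show ?thesis by (simp add: cond_Df_def future_law_eq)
  qed
  then show "(\<integral>x. Df x (\<alpha> x) $ t * \<phi> x \<partial>\<mu>) = (\<integral>x. cond_Df \<alpha> t x * \<phi> x \<partial>\<mu>)"
    using M.integral_future[OF \<mu>_law i, of t] by simp
qed

text \<open>The factor \<open>c < 1\<close> makes the cost of the induced coupling strictly smaller than \<open>\<delta>\<close>.\<close>

lemma almost_extremal_direction:
  assumes \<alpha>: "\<alpha> \<in> controls K" and s: "s < sensitivity q \<mu> \<kappa> Df \<alpha>"
  obtains \<Phi> R L c where "\<Phi> \<in> borel_measurable borel"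
    "\<And>t x x'. same_pts {..t} x x' \<Longrightarrow> \<Phi> x $ t = \<Phi> x' $ t"
    "\<And>x. norm (\<Phi> x) \<le> R" "0 \<le> L"
    "\<And>t x u v. \<bar>\<Phi> (set_coord x t u) $ t - \<Phi> (set_coord x t v) $ t\<bar> \<le> L * \<bar>u - v\<bar>"
    "0 \<le> c" "c < 1"
    "\<And>t x. integrable (\<kappa> t x) (\<lambda>v. \<bar>\<Phi> (set_coord x t v) $ t\<bar> powr p)"
    "\<And>t x. (\<integral>v. \<bar>\<Phi> (set_coord x t v) $ t\<bar> powr p \<partial>\<kappa> t x) powr (1 / p) \<le> c"
    "(\<integral>x. Df x (\<alpha> x) \<bullet> \<Phi> x \<partial>\<mu>) > s"
proof -
  define S where "S = sensitivity q \<mu> \<kappa> Df \<alpha>"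
  define n where "n = real CARD('n)"
  have n: "0 < n" by (simp add: n_def)
  \<comment> \<open>The losses of the \<open>n\<close> coordinates add up to
    \<open>(S - s) / 2\<close>, which leaves at least the midpoint \<open>(S + s) / 2\<close>, still
    above \<open>s\<close>.\<close>
  define \<eta> where "\<eta> = (S - s) / (2 * n)"
  have \<eta>: "0 < \<eta>" using s n by (simp add: \<eta>_def S_def)
  define good where "good t \<phi> R L \<longleftrightarrow> \<phi> \<in> borel_measurable borel \<and> M.adapted t \<phi> \<and> (\<forall>x. \<bar>\<phi> x\<bar> \<le> R) \<and> 0 \<le> L \<and>
      (\<forall>x u v. \<bar>\<phi> (set_coord x t u) - \<phi> (set_coord x t v)\<bar> \<le> L * \<bar>u - v\<bar>) \<and>
      (\<forall>x. (\<integral>v. \<bar>\<phi> (set_coord x t v)\<bar> powr p \<partial>\<kappa> t x) powr (1 / p) \<le> 1) \<and>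
      (\<integral>x. cond_Df \<alpha> t x * \<phi> x \<partial>\<mu>) > (\<integral>x. cond_norm t (cond_Df \<alpha> t) x \<partial>\<mu>) - \<eta>" for t \<phi> R L
  have "\<forall>t. \<exists>w. good t (fst w) (fst (snd w)) (snd (snd w))"
  proof
    fix t
    obtain \<phi> R L where "good t \<phi> R L"
      by (rule lipschitz_almost_extremal[OF cond_Df_measurable[OF \<alpha>] cond_Df_adapted[OF \<alpha>]
          integrable_powr_cond_Df[OF \<alpha>] \<eta>, of t]) (rule that, unfold good_def, (intro conjI allI; assumption))
    then show "\<exists>w. good t (fst w) (fst (snd w)) (snd (snd w))"
      by (intro exI[of _ "(\<phi>, R, L)"]) simp
  qed
  from choice[OF this] obtain w where w: "\<And>t. good t (fst (w t)) (fst (snd (w t))) (snd (snd (w t)))" by blast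
  define \<phi> where "\<phi> t = fst (w t)" for t
  define R where "R t = fst (snd (w t))" for t
  define L where "L t = snd (snd (w t))" for t
  have \<phi>m: "\<phi> t \<in> borel_measurable borel" and \<phi>a: "M.adapted t (\<phi> t)"
    and \<phi>R: "\<bar>\<phi> t x\<bar> \<le> R t" and L: "0 \<le> L t"
    and \<phi>L: "\<bar>\<phi> t (set_coord x t u) - \<phi> t (set_coord x t v)\<bar> \<le> L t * \<bar>u - v\<bar>"
    and \<phi>n: "(\<integral>v. \<bar>\<phi> t (set_coord x t v)\<bar> powr p \<partial>\<kappa> t x) powr (1 / p) \<le> 1"
    and \<phi>F: "(\<integral>x. cond_Df \<alpha> t x * \<phi> t x \<partial>\<mu>) > (\<integral>x. cond_norm t (cond_Df \<alpha> t) x \<partial>\<mu>) - \<eta>" for t x u v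
    using w[of t] unfolding good_def \<phi>_def R_def L_def by blast+
  note [measurable] = \<phi>m
  define U where "U = (\<Sum>t\<in>UNIV. \<integral>x. cond_Df \<alpha> t x * \<phi> t x \<partial>\<mu>)"
  have "S - n * \<eta> = (\<Sum>t\<in>UNIV. (\<integral>x. cond_norm t (cond_Df \<alpha> t) x \<partial>\<mu>) - \<eta>)"
    by (simp add: S_def sensitivity_eq sum_subtractf n_def)
  also have "\<dots> \<le> U" unfolding U_def using \<phi>F by (intro sum_mono less_imp_le)
  finally have "S - n * \<eta> \<le> U" .
  moreover have "S - n * \<eta> = (S + s) / 2" using n by (simp add: \<eta>_def field_simps)
  ultimately have U: "s < U" using s by (simp add: S_def)
  \<comment> \<open>For negative \<open>s\<close> the zero direction is good enough; otherwise
    \<open>c\<close> is the midpoint between \<open>s / U\<close> and 1.\<close>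
  obtain c where c: "0 \<le> c" "c < 1" "s < c * U"
  proof (cases "s < 0")
    case True
    then show ?thesis by (intro that[of 0]) auto
  next
    case False
    then have "0 < U" using U by simp
    then show ?thesis using U False by (intro that[of "(1 + s / U) / 2"]) (auto simp: field_simps)
  qed
  define \<Phi> :: "'n pts \<Rightarrow> 'n pts" where "\<Phi> x = (\<chi> t. c * \<phi> t x)" for x
  have cR: "\<bar>c * r\<bar> \<le> \<bar>r\<bar>" for r using c by (simp add: abs_mult mult_left_le_one_le)
  show thesis
  proof (rule that[of \<Phi> "\<Sum>t\<in>UNIV. R t" "\<Sum>t\<in>UNIV. L t" c])
    show \<Phi>m[measurable]: "\<Phi> \<in> borel_measurable borel"
      unfolding \<Phi>_def[abs_def] by (intro vec_lambda_measurable) measurable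
    show "\<Phi> x $ t = \<Phi> x' $ t" if "same_pts {..t} x x'" for t x x'
    proof -
      have "\<phi> t x = \<phi> t x'" using \<phi>a[of t] that unfolding M.adapted_def by blast
      then show ?thesis by (simp add: \<Phi>_def)
    qed
    show "norm (\<Phi> x) \<le> (\<Sum>t\<in>UNIV. R t)" for x
    proof -
      have "norm (\<Phi> x) \<le> (\<Sum>t\<in>UNIV. \<bar>\<Phi> x $ t\<bar>)" by (rule norm_le_l1_cart)
      also have "\<dots> \<le> (\<Sum>t\<in>UNIV. R t)"
        unfolding \<Phi>_def vec_lambda_beta by (intro sum_mono order_trans[OF cR \<phi>R])
      finally show ?thesis .
    qed
    show "0 \<le> (\<Sum>t\<in>UNIV. L t)" by (intro sum_nonneg L)
    show "\<bar>\<Phi> (set_coord x t u) $ t - \<Phi> (set_coord x t v) $ t\<bar> \<le> (\<Sum>t\<in>UNIV. L t) * \<bar>u - v\<bar>" for t x u v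
    proof -
      have "\<bar>\<Phi> (set_coord x t u) $ t - \<Phi> (set_coord x t v) $ t\<bar>
          = \<bar>c * (\<phi> t (set_coord x t u) - \<phi> t (set_coord x t v))\<bar>"
        by (simp add: \<Phi>_def algebra_simps)
      also have "\<dots> \<le> L t * \<bar>u - v\<bar>" by (rule order_trans[OF cR \<phi>L])
      also have "\<dots> \<le> (\<Sum>t\<in>UNIV. L t) * \<bar>u - v\<bar>"
        by (intro mult_right_mono member_le_sum L) auto
      finally show ?thesis .
    qed
    show "integrable (\<kappa> t x) (\<lambda>v. \<bar>\<Phi> (set_coord x t v) $ t\<bar> powr p)" for t x
    proof -
      interpret k: prob_space "\<kappa> t x" by (rule M.kernel_prob)
      show ?thesis
      proof (rule k.integrable_const_bound[of _ "R t powr p"])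
        show "AE v in \<kappa> t x. norm (\<bar>\<Phi> (set_coord x t v) $ t\<bar> powr p) \<le> R t powr p"
          unfolding \<Phi>_def vec_lambda_beta real_norm_def abs_of_nonneg[OF powr_ge_zero]
          using p_gt_1 order_trans[OF cR \<phi>R] by (intro AE_I2 powr_mono2) auto
      qed measurable
    qed
    show "(\<integral>v. \<bar>\<Phi> (set_coord x t v) $ t\<bar> powr p \<partial>\<kappa> t x) powr (1 / p) \<le> c" for t x
    proof -
      have "(\<integral>v. \<bar>\<Phi> (set_coord x t v) $ t\<bar> powr p \<partial>\<kappa> t x)
          = c powr p * (\<integral>v. \<bar>\<phi> t (set_coord x t v)\<bar> powr p \<partial>\<kappa> t x)"
        using c by (simp add: \<Phi>_def abs_mult powr_mult)
      then have "(\<integral>v. \<bar>\<Phi> (set_coord x t v) $ t\<bar> powr p \<partial>\<kappa> t x) powr (1 / p)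
          = c * (\<integral>v. \<bar>\<phi> t (set_coord x t v)\<bar> powr p \<partial>\<kappa> t x) powr (1 / p)"
        using c p_gt_1 by (simp add: powr_mult powr_powr)
      also have "\<dots> \<le> c * 1" using c \<phi>n by (intro mult_left_mono) auto
      finally show ?thesis by simp
    qed
    have "Df x (\<alpha> x) \<bullet> \<Phi> x = c * (\<Sum>t\<in>UNIV. Df x (\<alpha> x) $ t * \<phi> t x)" for x
      by (simp add: inner_vec_def \<Phi>_def sum_distrib_left mult.left_commute)
    then have "(\<integral>x. Df x (\<alpha> x) \<bullet> \<Phi> x \<partial>\<mu>) = c * (\<Sum>t\<in>UNIV. \<integral>x. Df x (\<alpha> x) $ t * \<phi> t x \<partial>\<mu>)"
      using integral_Df_mult_adapted(1)[OF \<alpha> \<phi>m \<phi>a \<phi>R] by simp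
    also have "\<dots> = c * U"
      unfolding U_def using integral_Df_mult_adapted(2)[OF \<alpha> \<phi>m \<phi>a \<phi>R] by simp
    finally show "(\<integral>x. Df x (\<alpha> x) \<bullet> \<Phi> x \<partial>\<mu>) > s" using c by simp
  qed (use c in auto)
qed

text \<open>If the claim fails for arbitrarily small \<delta>, there are controls
  \<open>\<beta> n\<close> with \<open>J (\<beta> n) + \<delta> n * I n < v0 + \<delta> n * (s +
  gap)\<close>, where \<open>I n\<close> is the directional derivative along \<open>\<Phi>\<close>.
  As \<open>v0\<close> is minimal, \<open>I n < s + gap\<close>. As \<open>I n\<close> is bounded,
  \<open>J (\<beta> n)\<close> tends to \<open>v0\<close>, so a subsequence of the controls
  converges to \<alpha>, and \<open>I\<close> tends along it to \<open>k > s + gap\<close>, a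
  contradiction.\<close>

lemma lower_bound:
  assumes \<alpha>: "\<alpha> \<in> optimal_controls \<mu> f K" and s: "s < sensitivity q \<mu> \<kappa> Df \<alpha>"
  shows "\<forall>\<^sub>F \<delta> in at_right 0. ereal (v0 + \<delta> * s) \<le> V_robust p \<kappa> f K \<delta>"
proof (rule ccontr)
  assume neg: "\<not> ?thesis"
  have \<alpha>': "\<alpha> \<in> controls K" using \<alpha> by (simp add: optimal_iff)
  obtain \<Phi> R L c where \<Phi>m[measurable]: "\<Phi> \<in> borel_measurable borel"
    and \<Phi>a: "\<And>t x x'. same_pts {..t} x x' \<Longrightarrow> \<Phi> x $ t = \<Phi> x' $ t"
    and \<Phi>R: "\<And>x. norm (\<Phi> x) \<le> R" and L: "0 \<le> L"
    and \<Phi>L: "\<And>t x u v. \<bar>\<Phi> (set_coord x t u) $ t - \<Phi> (set_coord x t v) $ t\<bar> \<le> L * \<bar>u - v\<bar>"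
    and c: "0 \<le> c" "c < 1"
    and \<Phi>i: "\<And>t x. integrable (\<kappa> t x) (\<lambda>v. \<bar>\<Phi> (set_coord x t v) $ t\<bar> powr p)"
    and \<Phi>n: "\<And>t x. (\<integral>v. \<bar>\<Phi> (set_coord x t v) $ t\<bar> powr p \<partial>\<kappa> t x) powr (1 / p) \<le> c"
    and \<Phi>D: "(\<integral>x. Df x (\<alpha> x) \<bullet> \<Phi> x \<partial>\<mu>) > s"
    by (rule almost_extremal_direction[OF \<alpha>' s]) (rule that; assumption)
  define k where "k = (\<integral>x. Df x (\<alpha> x) \<bullet> \<Phi> x \<partial>\<mu>)"
  \<comment> \<open>Half of the surplus of the direction over \<open>s\<close> is reserved for the
    Taylor remainder.\<close>
  define gap where "gap = (k - s) / 2"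
  have gap: "0 < gap" "s + gap < k" using \<Phi>D by (auto simp: gap_def k_def field_simps)
  define \<eta> where "\<eta> = gap / expansion_const"
  have \<eta>: "0 < \<eta>" using gap expansion_const_pos by (simp add: \<eta>_def)
  obtain \<delta>0 where \<delta>0: "0 < \<delta>0" and T: "\<And>\<delta> x y a. 0 < \<delta> \<Longrightarrow> \<delta> < \<delta>0 \<Longrightarrow> a \<in> A \<Longrightarrow>
      \<bar>f y a - f x a - Df x a \<bullet> (y - x)\<bar> \<le> \<delta> * \<eta> * (1 + norm x powr p + (norm (y - x) / \<delta>) powr p)"
    by (rule taylor[OF \<eta>]) (rule that; assumption)
  \<comment> \<open>The second bound ensures \<open>\<delta> * L < 1\<close>, which makes the
    transport invertible; the summand 1 covers \<open>L = 0\<close>.\<close>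
  define \<delta>1 where "\<delta>1 = min \<delta>0 (1 / (L + 1))"
  have \<delta>1: "0 < \<delta>1" using \<delta>0 L by (simp add: \<delta>1_def)
  obtain w where w: "integrable \<mu> w" "\<And>x a. a \<in> A \<Longrightarrow> norm (Df x a) \<le> w x"
    by (rule integrable_norm_Df_bound) (rule that; assumption)
  have R: "0 \<le> R" using \<Phi>R[of undefined] norm_ge_zero order_trans by blast
  have inner_le: "\<bar>Df x a \<bullet> \<Phi> x\<bar> \<le> w x * R" if "a \<in> A" for x a
  proof -
    have "\<bar>Df x a \<bullet> \<Phi> x\<bar> \<le> norm (Df x a) * norm (\<Phi> x)" by (rule Cauchy_Schwarz_ineq2)
    also have "\<dots> \<le> w x * R"
      using w(2)[OF that] order_trans[OF norm_ge_zero w(2)[OF that]] by (intro mult_mono \<Phi>R) auto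
    finally show ?thesis .
  qed
  have step: "\<exists>\<beta>. \<beta> \<in> controls K \<and> J \<beta> + \<delta> * (\<integral>x. Df x (\<beta> x) \<bullet> \<Phi> x \<partial>\<mu>) < v0 + \<delta> * (s + gap)"
    if \<delta>: "0 < \<delta>" "\<delta> < \<delta>1" and V: "V_robust p \<kappa> f K \<delta> < ereal (v0 + \<delta> * s)" for \<delta>
  proof -
    have \<delta>': "\<delta> < \<delta>0" "\<delta> * L < 1"
    proof -
      show "\<delta> < \<delta>0" using \<delta> by (simp add: \<delta>1_def)
      have "\<delta> * (L + 1) < 1" using \<delta> L by (simp add: \<delta>1_def pos_less_divide_eq)
      then show "\<delta> * L < 1" using \<delta> by (simp add: algebra_simps)
    qed
    interpret tr: triangular_transport \<delta> L c p \<mu> \<kappa> \<Phi>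
      by unfold_locales (use p_gt_1 \<delta> \<delta>' c \<mu>_disint \<Phi>m \<Phi>a \<Phi>L \<Phi>i \<Phi>n in auto)
    interpret nc: near_coupling_setting p q C e K \<mu> \<kappa> f Df eps \<delta> tr.graph_law tr.pair_kernel
      using \<delta> tr.pair_disintegration tr.pair_kernel_near by unfold_locales auto
    obtain a where a: "a \<in> pair_controls K"
      and aV: "(SUP \<gamma>\<in>Pi_bc p \<kappa> \<delta>. ereal (\<integral>z. f (snd z) (a z) \<partial>\<gamma>)) < ereal (v0 + \<delta> * s)"
      using V unfolding V_robust_def INF_less_iff by blast
    have "ereal (\<integral>z. f (snd z) (a z) \<partial>tr.graph_law) < ereal (v0 + \<delta> * s)"
      by (rule le_less_trans[OF SUP_upper[OF tr.graph_law_Pi_bc] aV])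
    then have less: "(\<integral>z. f (snd z) (a z) \<partial>tr.graph_law) < v0 + \<delta> * s" by simp
    have am[measurable]: "a \<in> borel_measurable borel" and aA[simp]: "\<And>z. a z \<in> A"
      using a by (auto simp: pair_controls_def)
    \<comment> \<open>Predictability survives because \<open>tr.transport x\<close> before
      \<open>t\<close> is determined by \<open>x\<close> before \<open>t\<close>.\<close>
    define \<beta> where "\<beta> x = a (x, tr.transport x)" for x
    have \<beta>: "\<beta> \<in> controls K"
      unfolding controls_def
    proof (intro CollectI conjI allI impI)
      show "\<beta> \<in> borel_measurable borel"
        unfolding \<beta>_def[abs_def] by (rule measurable_compose[OF tr.graph_measurable am])
      show "\<beta> x \<in> A" for x by (simp add: \<beta>_def)
      fix t :: 'n and x x' :: "'n pts" assume ag: "agree_before t x x'"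
      have "tr.transport x $ r = tr.transport x' $ r" if "r < t" for r
      proof -
        have "same_pts {..r} x x'" using ag that by (auto simp: agree_before_def same_pts_def)
        then have "\<Phi> x $ r = \<Phi> x' $ r" by (rule \<Phi>a)
        then show ?thesis using ag that by (simp add: tr.transport_def agree_before_def)
      qed
      then have "agree_before t (tr.transport x) (tr.transport x')" by (simp add: agree_before_def)
      with ag a show "\<beta> x $ t = \<beta> x' $ t" unfolding \<beta>_def pair_controls_def by blast
    qed
    note [measurable] = controlsD(1)[OF \<beta>] and controlsD(2)[OF \<beta>, simp]
    have fst: "(\<integral>z. f (fst z) (a z) \<partial>tr.graph_law) = J \<beta>"
      unfolding tr.graph_law_def J_def by (subst integral_distr) (auto simp: \<beta>_def)
    have "(\<integral>z. Df (fst z) (a z) \<bullet> (snd z - fst z) \<partial>tr.graph_law)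
        = (\<integral>x. Df x (\<beta> x) \<bullet> (\<delta> *\<^sub>R \<Phi> x) \<partial>\<mu>)"
      unfolding tr.graph_law_def by (subst integral_distr) (auto simp: \<beta>_def tr.transport_def)
    then have inner: "(\<integral>z. Df (fst z) (a z) \<bullet> (snd z - fst z) \<partial>tr.graph_law)
        = \<delta> * (\<integral>x. Df x (\<beta> x) \<bullet> \<Phi> x \<partial>\<mu>)" by simp
    have "J \<beta> + \<delta> * (\<integral>x. Df x (\<beta> x) \<bullet> \<Phi> x \<partial>\<mu>) - \<delta> * \<eta> * expansion_const
        \<le> (\<integral>z. f (snd z) (a z) \<partial>tr.graph_law)"
      using nc.expansion[OF am aA less_imp_le[OF \<eta>] T[OF \<delta>(1) \<delta>'(1)]]
      unfolding fst inner expansion_const_def by linarith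
    moreover have "\<delta> * \<eta> * expansion_const = \<delta> * gap" using expansion_const_pos by (simp add: \<eta>_def)
    ultimately have "J \<beta> + \<delta> * (\<integral>x. Df x (\<beta> x) \<bullet> \<Phi> x \<partial>\<mu>) < v0 + \<delta> * (s + gap)"
      using less unfolding distrib_left by linarith
    with \<beta> show ?thesis by blast
  qed
  define good where "good n \<beta> \<delta> \<longleftrightarrow> \<beta> \<in> controls K \<and> 0 < \<delta> \<and> \<delta> < 1 / real (Suc n)
      \<and> J \<beta> + \<delta> * (\<integral>x. Df x (\<beta> x) \<bullet> \<Phi> x \<partial>\<mu>) < v0 + \<delta> * (s + gap)" for n \<beta> \<delta>
  have "\<forall>n. \<exists>w. good n (fst w) (snd w)"
  proof
    fix n
    have "0 < min \<delta>1 (1 / real (Suc n))" using \<delta>1 by simp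
    then obtain \<delta> where \<delta>: "0 < \<delta>" "\<delta> < min \<delta>1 (1 / real (Suc n))" "V_robust p \<kappa> f K \<delta> < ereal (v0 + \<delta> * s)"
      using neg unfolding eventually_at_right_field by (metis not_le)
    obtain \<beta> where "\<beta> \<in> controls K" "J \<beta> + \<delta> * (\<integral>x. Df x (\<beta> x) \<bullet> \<Phi> x \<partial>\<mu>) < v0 + \<delta> * (s + gap)"
      using step[of \<delta>] \<delta> by auto
    with \<delta> show "\<exists>w. good n (fst w) (snd w)" by (intro exI[of _ "(\<beta>, \<delta>)"]) (simp add: good_def)
  qed
  from choice[OF this] obtain w' where w': "\<And>n. good n (fst (w' n)) (snd (w' n))" by blast
  define \<beta> where "\<beta> n = fst (w' n)" for n
  define \<delta> where "\<delta> n = snd (w' n)" for n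
  have \<beta>: "\<beta> n \<in> controls K" and \<delta>: "0 < \<delta> n" "\<delta> n < 1 / real (Suc n)"
    and J\<beta>: "J (\<beta> n) + \<delta> n * (\<integral>x. Df x (\<beta> n x) \<bullet> \<Phi> x \<partial>\<mu>) < v0 + \<delta> n * (s + gap)" for n
    using w'[of n] unfolding good_def \<beta>_def \<delta>_def by blast+
  define I where "I n = (\<integral>x. Df x (\<beta> n x) \<bullet> \<Phi> x \<partial>\<mu>)" for n
  note m[measurable] = controlsD(1)[OF \<beta>] controlsD(1)[OF \<alpha>'] and mA[simp] = controlsD(2)[OF \<beta>] controlsD(2)[OF \<alpha>']
  have i: "integrable \<mu> (\<lambda>x. w x * R)" using w by simp
  have [measurable]: "w \<in> borel_measurable \<mu>" using w by simp
  have I_le: "\<bar>I n\<bar> \<le> (\<integral>x. w x * R \<partial>\<mu>)" for n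
    unfolding I_def
  proof (rule order_trans[OF integral_abs_bound])
    have "integrable \<mu> (\<lambda>x. Df x (\<beta> n x) \<bullet> \<Phi> x)"
      by (rule Bochner_Integration.integrable_bound[OF i])
        (auto intro!: AE_I2 order_trans[OF inner_le abs_ge_self])
    then show "(\<integral>x. \<bar>Df x (\<beta> n x) \<bullet> \<Phi> x\<bar> \<partial>\<mu>) \<le> (\<integral>x. w x * R \<partial>\<mu>)"
      using i inner_le by (intro integral_mono) auto
  qed
  have I_less: "I n < s + gap" for n
  proof -
    have "\<delta> n * I n < \<delta> n * (s + gap)" using J\<beta>[of n] v0_le[OF \<beta>, of n] by (simp add: I_def)
    then show ?thesis using \<delta>(1)[of n] by simp
  qed
  have "(\<lambda>n. J (\<beta> n)) \<longlonglongrightarrow> v0"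
  proof (rule tendsto_sandwich[OF _ _ tendsto_const])
    define D where "D = \<bar>s + gap\<bar> + \<bar>\<integral>x. w x * R \<partial>\<mu>\<bar>"
    show "\<forall>\<^sub>F n in sequentially. J (\<beta> n) \<le> v0 + 1 / real (Suc n) * D"
    proof (rule always_eventually, rule allI)
      fix n
      have "J (\<beta> n) \<le> v0 + \<delta> n * (s + gap - I n)"
        using J\<beta>[of n] by (simp add: I_def algebra_simps)
      also have "\<dots> \<le> v0 + \<delta> n * D"
        using I_le[of n] \<delta>(1)[of n] by (intro add_left_mono mult_left_mono) (auto simp: D_def)
      also have "\<dots> \<le> v0 + 1 / real (Suc n) * D"
        using \<delta>(2)[of n] by (intro add_left_mono mult_right_mono) (auto simp: D_def)
      finally show "J (\<beta> n) \<le> v0 + 1 / real (Suc n) * D" .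
    qed
    have "(\<lambda>n. v0 + 1 / real (Suc n) * D) \<longlonglongrightarrow> v0 + 0 * D"
      by (intro tendsto_intros LIMSEQ_Suc[OF lim_1_over_n])
    then show "(\<lambda>n. v0 + 1 / real (Suc n) * D) \<longlonglongrightarrow> v0" by simp
  qed (use v0_le \<beta> in auto)
  from minimizing_subseq[OF \<beta> \<alpha> this] obtain r
    where r: "AE x in \<mu>. (\<lambda>n. \<beta> (r n) x) \<longlonglongrightarrow> \<alpha> x" by blast
  have "(\<lambda>n. I (r n)) \<longlonglongrightarrow> k"
    unfolding I_def k_def
  proof (rule integral_dominated_convergence[where w="\<lambda>x. w x * R"])
    show "AE x in \<mu>. (\<lambda>n. Df x (\<beta> (r n) x) \<bullet> \<Phi> x) \<longlonglongrightarrow> Df x (\<alpha> x) \<bullet> \<Phi> x"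
      using r
    proof eventually_elim
      case (elim x)
      have "(\<lambda>n. Df x (\<beta> (r n) x)) \<longlonglongrightarrow> Df x (\<alpha> x)"
        by (rule continuous_on_tendsto_compose[OF continuous_Df2 elim]) auto
      then show ?case by (intro tendsto_inner tendsto_const)
    qed
    show "AE x in \<mu>. norm (Df x (\<beta> (r n) x) \<bullet> \<Phi> x) \<le> w x * R" for n
      using inner_le by (intro AE_I2) auto
  qed (use i in auto)
  then have "k \<le> s + gap"
    by (rule LIMSEQ_le_const2) (use I_less in \<open>auto intro: less_imp_le\<close>)
  then show False using gap by simp
qed

text \<open>The two halves use the optimal controls differently. From below a single one suffices,
  its sensitivity being at least the infimum; its existence excludes an infimum over the empty set.
  From above one is picked whose sensitivity lies below the given \<open>b\<close>. In both cases a
  real \<open>s\<close> in between absorbs the error terms.\<close>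

lemma sensitivity_limit:
  "((\<lambda>\<delta>. (V_robust p \<kappa> f K \<delta> - V_zero \<mu> f K) / ereal \<delta>)
     \<longlongrightarrow> (INF \<alpha> \<in> optimal_controls \<mu> f K. ereal (sensitivity q \<mu> \<kappa> Df \<alpha>))) (at_right 0)"
    (is "(?Q \<longlongrightarrow> ?U) _")
proof (rule order_tendstoI)
  have quot: "(ereal (v0 + \<delta> * s) - ereal v0) / ereal \<delta> = ereal s" if "0 < \<delta>" for \<delta> s :: real
    using that by simp
  fix b assume b: "b < ?U"
  obtain \<alpha> where \<alpha>: "\<alpha> \<in> optimal_controls \<mu> f K" by (rule optimal_exists)
  have "b < ereal (sensitivity q \<mu> \<kappa> Df \<alpha>)" using b INF_lower[OF \<alpha>] by (rule less_le_trans)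
  then obtain s where s: "b < ereal s" "ereal s < ereal (sensitivity q \<mu> \<kappa> Df \<alpha>)"
    using ereal_dense2 by blast
  have "\<forall>\<^sub>F \<delta> in at_right (0::real). 0 < \<delta>" by (rule eventually_at_right_less)
  moreover have "\<forall>\<^sub>F \<delta> in at_right 0. ereal (v0 + \<delta> * s) \<le> V_robust p \<kappa> f K \<delta>"
    using \<alpha> s(2) by (intro lower_bound) auto
  ultimately show "\<forall>\<^sub>F \<delta> in at_right 0. b < ?Q \<delta>"
  proof eventually_elim
    case (elim \<delta>)
    have "ereal s \<le> ?Q \<delta>"
      unfolding quot[OF elim(1), symmetric, of s] V_zero_eq using elim
      by (intro ereal_divide_right_mono ereal_minus_mono) auto
    then show ?case using s(1) by (rule less_le_trans[rotated])
  qed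
next
  have quot: "(ereal (v0 + \<delta> * s) - ereal v0) / ereal \<delta> = ereal s" if "0 < \<delta>" for \<delta> s :: real
    using that by simp
  fix b assume "?U < b"
  then obtain \<alpha> where \<alpha>: "\<alpha> \<in> optimal_controls \<mu> f K" "ereal (sensitivity q \<mu> \<kappa> Df \<alpha>) < b"
    unfolding INF_less_iff by blast
  then obtain s where s: "ereal (sensitivity q \<mu> \<kappa> Df \<alpha>) < ereal s" "ereal s < b"
    using ereal_dense2 by blast
  then have "0 < s - sensitivity q \<mu> \<kappa> Df \<alpha>" by simp
  from upper_bound[OF \<alpha>(1) this] obtain \<delta>0 where \<delta>0: "0 < \<delta>0"
    "\<And>\<delta>. 0 < \<delta> \<Longrightarrow> \<delta> < \<delta>0 \<Longrightarrow> V_robust p \<kappa> f K \<delta> \<le> ereal (v0 + \<delta> * s)" by auto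
  then have "\<forall>\<^sub>F \<delta> in at_right 0. V_robust p \<kappa> f K \<delta> \<le> ereal (v0 + \<delta> * s)"
    unfolding eventually_at_right_field by blast
  moreover have "\<forall>\<^sub>F \<delta> in at_right (0::real). 0 < \<delta>" by (rule eventually_at_right_less)
  ultimately show "\<forall>\<^sub>F \<delta> in at_right 0. ?Q \<delta> < b"
  proof eventually_elim
    case (elim \<delta>)
    have "?Q \<delta> \<le> ereal s"
      unfolding quot[OF elim(2), symmetric, of s] V_zero_eq using elim
      by (intro ereal_divide_right_mono ereal_minus_mono) auto
    then show ?case using s(2) by (rule le_less_trans)
  qed
qed

end

theorem theorem5p1:
  fixes p q C C' e :: real
    and K :: "real set"
    and \<mu> :: "('n::{finite,linorder}) pts measure"
    and \<kappa> :: "'n \<Rightarrow> 'n pts \<Rightarrow> real measure"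
    and f :: "'n pts \<Rightarrow> 'n pts \<Rightarrow> real"
    and Df :: "'n pts \<Rightarrow> 'n pts \<Rightarrow> 'n pts"
    and eps :: "'n pts \<Rightarrow> real"
  assumes "p > 1" and "q = p / (p - 1)"
    and "compact K"
    and "\<mu> \<in> moment_probs p (pnorm p)"
    and "disintegration \<mu> \<kappa>"
    and "successively_continuous p \<kappa>"
    and "\<And>t x. (\<integral>\<^sup>+ z. ennreal (pnorm_on {t<..} p z powr p) \<partial>future_law \<kappa> t x)
                \<le> ennreal (C' * (1 + pnorm_on {..t} p x powr p))"
    and "lsc_on (UNIV \<times> cube K) (\<lambda>(x, a). f x a)"
    and "\<And>x a. a \<in> cube K \<Longrightarrow> GDERIV (\<lambda>x. f x a) x :> Df x a"
    and "continuous_on (UNIV \<times> cube K) (\<lambda>(x, a). Df x a)"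
    and "e > 0" and "C > 0"
    and "\<And>x a. a \<in> cube K \<Longrightarrow> pnorm p (Df x a) \<le> C * (1 + pnorm p x powr (p - 1 - e))"
    and "\<And>x. x \<in> spt \<mu> \<Longrightarrow> strongly_convex_on p (cube K) (f x) (eps x)"
    and "AE x in \<mu>. eps x > 0"
  shows "((\<lambda>\<delta>. (V_robust p \<kappa> f K \<delta> - V_zero \<mu> f K) / ereal \<delta>)
           \<longlongrightarrow> (INF \<alpha> \<in> optimal_controls \<mu> f K. ereal (sensitivity q \<mu> \<kappa> Df \<alpha>))) (at_right 0)"
proof (cases "K = {}")
  case True
  \<comment> \<open>Without controls all infima are over the empty set: both values are infinite,
    their difference is infinite by the convention of \<open>ereal\<close>, and so is the right-hand
    side.\<close>
  have 1: "controls K = ({} :: ('n pts \<Rightarrow> 'n pts) set)"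
    and 2: "pair_controls K = ({} :: ('n pts \<times> 'n pts \<Rightarrow> 'n pts) set)"
    by (auto simp: controls_def pair_controls_def cube_def True)
  have 3: "optimal_controls \<mu> f K = {}"
    by (auto simp: optimal_controls_def is_arg_min_def 1)
  have "\<forall>\<^sub>F \<delta> in at_right (0::real). 0 < \<delta>" by (rule eventually_at_right_less)
  then have "\<forall>\<^sub>F \<delta> in at_right 0. (V_robust p \<kappa> f K \<delta> - V_zero \<mu> f K) / ereal \<delta> = \<infinity>"
    by eventually_elim (simp add: V_robust_def V_zero_def 1 2 top_ereal_def)
  then show ?thesis unfolding 3 by (simp add: top_ereal_def tendsto_eventually)
next
  case False
  interpret robust_setting p q C e K \<mu> \<kappa> f Df eps
    using assms False by unfold_locales
  show ?thesis by (rule sensitivity_limit)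
qed

end
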